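(* Let $F$ be an algebraically closed field of characteristic zero and $G$ a finite abelian group. Let $R_1\cong M_k(F)$ and $R_2\cong M_n(F)$ be two $G$-graded matrix algebras with identity elements $e_1$ and $e_2$, respectively, and let $R_1=C_1D_1\cong C_1\otimes D_1$, $R_2=C_2D_2\cong C_2\otimes D_2$ be decompositions in which $C_1, C_2$ are graded matrix subalgebras with elementary grading, $D_1, D_2$ are graded matrix subalgebras with fine grading, and $\mathrm{Supp}\,C_i\cap\mathrm{Supp}\,D_i=\{1\}$ for $i=1,2$. Suppose that $D_1\cong D_2$ as graded algebras and that $\varphi:R_1\to R_2$ is an injective homomorphism of graded algebras (not necessarily mapping $e_1$ to $e_2$). Then there exists a decomposition $R_2=\widetilde{C}_2\widetilde{D}_2\cong\widetilde{C}_2\otimes\widetilde{D}_2$ such that $\widetilde{C}_2$ is a matrix algebra with elementary grading, $\widetilde{D}_2$ is a matrix algebra with fine grading, $\widetilde{D}_2\cong D_2$ as graded algebras, and $\varphi(C_1)\subset\widetilde{C}_2$. If $\varphi(e_1)R_2\varphi(e_1)=\varphi(R_1)$, then also $\varphi(e_1)\widetilde{C}_2\varphi(e_1)=\varphi(C_1)$. Besides, there is an isomorphism $\psi: D_1\to\widetilde{D}_2$ such that $\varphi(a)\varphi(d)=\varphi(a)\psi(d)$ for any $a\in R_1$, $d\in D_1$.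
   Context: A $G$-grading on an algebra $R$ is a vector space decomposition $R=\bigoplus_{g\in G}R^{(g)}$ with $R^{(g)}R^{(h)}\subset R^{(gh)}$ for all $g,h\in G$; $\mathrm{Supp}\,R=\{g\in G\mid R^{(g)}\neq 0\}$. A subspace (subalgebra) $W\subset R$ is graded if $W=\bigoplus_{g}(W\cap R^{(g)})$. A homomorphism $\varphi:R\to R'$ of $G$-graded algebras is a homomorphism of graded algebras if $\varphi(R^{(g)})\subset (R')^{(g)}$ for all $g$. The identity element of $G$ is $1$. A grading on a matrix algebra (an algebra isomorphic to $M_p(F)$) is elementary if, for a suitable identification with $M_p(F)$, there is a tuple $(g_1,\ldots,g_p)\in G^p$ such that every matrix unit $E_{ij}$ is homogeneous of degree $g_i^{-1}g_j$. A grading on a matrix algebra $D$ is fine if $\dim D^{(g)}=1$ for every $g\in\mathrm{Supp}\,D$; the support is then a subgroup of $G$. A decomposition $R=CD\cong C\otimes D$ of a graded matrix algebra $R$ means that $C$ and $D$ are graded subalgebras of $R$, both isomorphic to full matrix algebras and containing the identity of $R$, which commute elementwise and for which the multiplication map $C\otimes D\to R$ is an isomorphism (so $C$ is the centralizer of $D$ in $R$). *)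

theory Defs
  imports
    "HOL-Computational_Algebra.Polynomial"
    "HOL-Algebra.QuotRing"
    "HOL-Algebra.Subrings"
    "Jordan_Normal_Form.VS_Connect"
begin

section \<open>Associative algebras over a field\<close>

text \<open>
  The ground field is a type of class \<^class>\<open>field\<close>, viewed as a ring record through
  \<^term>\<open>class_ring\<close>. The locale \<open>algebra\<close> of HOL-Algebra assumes commutativity
  of the multiplication, so it cannot be used for matrix algebras.
\<close>

locale assoc_algebra =
  vectorspace "class_ring :: 'f ring" A + A?: ring A
  for A :: "('f :: field, 'a) module" (structure) +
  assumes smult_mult_left:
      "\<lbrakk>x \<in> carrier A; y \<in> carrier A\<rbrakk> \<Longrightarrow> (c \<odot> x) \<otimes> y = c \<odot> (x \<otimes> y)"
    and smult_mult_right: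
      "\<lbrakk>x \<in> carrier A; y \<in> carrier A\<rbrakk> \<Longrightarrow> x \<otimes> (c \<odot> y) = c \<odot> (x \<otimes> y)"

text \<open>Homomorphisms need not preserve the identity element.\<close>

definition alg_hom :: "('f :: field, 'a) module \<Rightarrow> ('f, 'b) module \<Rightarrow> ('a \<Rightarrow> 'b) set" where
  "alg_hom A B = module_hom class_ring A B \<inter> hom A B"

definition alg_iso :: "('f :: field, 'a) module \<Rightarrow> ('f, 'b) module \<Rightarrow> ('a \<Rightarrow> 'b) set" where
  "alg_iso A B = {h \<in> alg_hom A B. bij_betw h (carrier A) (carrier B)}"

definition is_matrix_algebra :: "nat \<Rightarrow> ('f :: field, 'a) module \<Rightarrow> bool" where
  "is_matrix_algebra p A \<longleftrightarrow> p > 0 \<and> alg_iso (module_mat TYPE('f) p p) A \<noteq> {}"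

abbreviation sub_alg :: "('f, 'a) module \<Rightarrow> 'a set \<Rightarrow> ('f, 'a) module" where
  "sub_alg A W \<equiv> A\<lparr>carrier := W\<rparr>"

definition unital_subalgebra :: "('f :: field, 'a) module \<Rightarrow> 'a set \<Rightarrow> bool" where
  "unital_subalgebra A W \<longleftrightarrow> subspace class_ring W A \<and> subring W A"


section \<open>Gradings\<close>

text \<open>
  A grading is a family of subspaces indexed by the group; its values outside the carrier
  of the group are irrelevant. The first definition says that \<open>A\<close> is the direct sum of the
  \<open>\<Gamma> g\<close>, for a finite group.
\<close>

definition graded_space ::
  "'g monoid \<Rightarrow> ('f :: field, 'a) module \<Rightarrow> ('g \<Rightarrow> 'a set) \<Rightarrow> bool" where
  "graded_space G A \<Gamma> \<longleftrightarrow>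
     (\<forall>g\<in>carrier G. subspace class_ring (\<Gamma> g) A) \<and>
     (\<forall>x\<in>carrier A. \<exists>!c. c \<in> (\<Pi>\<^sub>E g\<in>carrier G. \<Gamma> g) \<and> x = finsum A c (carrier G))"

definition graded_algebra ::
  "'g monoid \<Rightarrow> ('f :: field, 'a) module \<Rightarrow> ('g \<Rightarrow> 'a set) \<Rightarrow> bool" where
  "graded_algebra G A \<Gamma> \<longleftrightarrow>
     assoc_algebra A \<and> graded_space G A \<Gamma> \<and>
     (\<forall>g\<in>carrier G. \<forall>h\<in>carrier G. \<forall>x\<in>\<Gamma> g. \<forall>y\<in>\<Gamma> h. x \<otimes>\<^bsub>A\<^esub> y \<in> \<Gamma> (g \<otimes>\<^bsub>G\<^esub> h))"

definition grading_support ::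
  "'g monoid \<Rightarrow> ('f, 'a) module \<Rightarrow> ('g \<Rightarrow> 'a set) \<Rightarrow> 'g set" where
  "grading_support G A \<Gamma> = {g \<in> carrier G. \<Gamma> g \<noteq> {\<zero>\<^bsub>A\<^esub>}}"

abbreviation (input) sub_grading :: "('g \<Rightarrow> 'a set) \<Rightarrow> 'a set \<Rightarrow> 'g \<Rightarrow> 'a set" where
  "sub_grading \<Gamma> W \<equiv> \<lambda>g. W \<inter> \<Gamma> g"

definition graded_subalgebra ::
  "'g monoid \<Rightarrow> ('f :: field, 'a) module \<Rightarrow> ('g \<Rightarrow> 'a set) \<Rightarrow> 'a set \<Rightarrow> bool" where
  "graded_subalgebra G A \<Gamma> W \<longleftrightarrow>
     unital_subalgebra A W \<and> graded_space G (sub_alg A W) (sub_grading \<Gamma> W)"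

definition graded_hom ::
  "'g monoid \<Rightarrow> ('f :: field, 'a) module \<Rightarrow> ('g \<Rightarrow> 'a set) \<Rightarrow>
   ('f, 'b) module \<Rightarrow> ('g \<Rightarrow> 'b set) \<Rightarrow> ('a \<Rightarrow> 'b) set" where
  "graded_hom G A \<Gamma> B \<Delta> = {h \<in> alg_hom A B. \<forall>g\<in>carrier G. h ` \<Gamma> g \<subseteq> \<Delta> g}"

definition graded_iso ::
  "'g monoid \<Rightarrow> ('f :: field, 'a) module \<Rightarrow> ('g \<Rightarrow> 'a set) \<Rightarrow>
   ('f, 'b) module \<Rightarrow> ('g \<Rightarrow> 'b set) \<Rightarrow> ('a \<Rightarrow> 'b) set" where
  "graded_iso G A \<Gamma> B \<Delta> = graded_hom G A \<Gamma> B \<Delta> \<inter> alg_iso A B"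

definition matrix_unit :: "nat \<Rightarrow> nat \<Rightarrow> nat \<Rightarrow> 'f :: field mat" where
  "matrix_unit p i j = mat p p (\<lambda>(a, b). if a = i \<and> b = j then 1 else 0)"

definition elementary_grading ::
  "'g monoid \<Rightarrow> ('f :: field, 'a) module \<Rightarrow> ('g \<Rightarrow> 'a set) \<Rightarrow> bool" where
  "elementary_grading G A \<Gamma> \<longleftrightarrow>
     (\<exists>p>0. \<exists>h \<in> alg_iso (module_mat TYPE('f) p p) A. \<exists>t \<in> {..<p} \<rightarrow> carrier G.
        \<forall>i<p. \<forall>j<p. h (matrix_unit p i j) \<in> \<Gamma> (inv\<^bsub>G\<^esub> (t i) \<otimes>\<^bsub>G\<^esub> t j))"

definition fine_grading ::
  "'g monoid \<Rightarrow> ('f :: field, 'a) module \<Rightarrow> ('g \<Rightarrow> 'a set) \<Rightarrow> bool" where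
  "fine_grading G A \<Gamma> \<longleftrightarrow>
     (\<exists>p. is_matrix_algebra p A) \<and>
     (\<forall>g\<in>grading_support G A \<Gamma>. vectorspace.dim class_ring (sub_alg A (\<Gamma> g)) = 1)"


section \<open>Tensor products of algebras\<close>

text \<open>
  The tensor product of \<open>A\<close> and \<open>B\<close> is the free vector space on pairs, i.e. the finitely
  supported functions on \<open>carrier A \<times> carrier B\<close>, with product
  \<open>(x, y) (x', y') = (x x', y y')\<close> on the basis, modulo the span of the bilinearity relations.
\<close>

definition pair_basis :: "'a \<Rightarrow> 'b \<Rightarrow> 'a \<times> 'b \<Rightarrow> 'f :: field" where
  "pair_basis x y = (\<lambda>s. if s = (x, y) then 1 else 0)"

definition pair_algebra ::
  "('f :: field, 'a) module \<Rightarrow> ('f, 'b) module \<Rightarrow> ('f, 'a \<times> 'b \<Rightarrow> 'f) module" where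
  "pair_algebra A B =
     \<lparr>carrier = {u. finite {s. u s \<noteq> 0} \<and> {s. u s \<noteq> 0} \<subseteq> carrier A \<times> carrier B},
      mult = (\<lambda>u v s. \<Sum>p | u p \<noteq> 0. \<Sum>q | v q \<noteq> 0.
                u p * v q * pair_basis (fst p \<otimes>\<^bsub>A\<^esub> fst q) (snd p \<otimes>\<^bsub>B\<^esub> snd q) s),
      one = pair_basis \<one>\<^bsub>A\<^esub> \<one>\<^bsub>B\<^esub>,
      zero = (\<lambda>s. 0),
      add = (\<lambda>u v s. u s + v s),
      smult = (\<lambda>c u s. c * u s)\<rparr>"

definition bilinearity_relations ::
  "('f :: field, 'a) module \<Rightarrow> ('f, 'b) module \<Rightarrow> ('a \<times> 'b \<Rightarrow> 'f) set" where
  "bilinearity_relations A B =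
     {\<lambda>s. pair_basis (x \<oplus>\<^bsub>A\<^esub> x') y s - pair_basis x y s - pair_basis x' y s | x x' y.
        x \<in> carrier A \<and> x' \<in> carrier A \<and> y \<in> carrier B} \<union>
     {\<lambda>s. pair_basis x (y \<oplus>\<^bsub>B\<^esub> y') s - pair_basis x y s - pair_basis x y' s | x y y'.
        x \<in> carrier A \<and> y \<in> carrier B \<and> y' \<in> carrier B} \<union>
     {\<lambda>s. pair_basis (c \<odot>\<^bsub>A\<^esub> x) y s - c * pair_basis x y s | c x y.
        x \<in> carrier A \<and> y \<in> carrier B} \<union>
     {\<lambda>s. pair_basis x (c \<odot>\<^bsub>B\<^esub> y) s - c * pair_basis x y s | c x y.
        x \<in> carrier A \<and> y \<in> carrier B}"

definition bilinearity_ideal ::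
  "('f :: field, 'a) module \<Rightarrow> ('f, 'b) module \<Rightarrow> ('a \<times> 'b \<Rightarrow> 'f) set" where
  "bilinearity_ideal A B =
     LinearCombinations.module.span class_ring (pair_algebra A B) (bilinearity_relations A B)"

definition tensor_algebra ::
  "('f :: field, 'a) module \<Rightarrow> ('f, 'b) module \<Rightarrow> ('f, ('a \<times> 'b \<Rightarrow> 'f) set) module" where
  "tensor_algebra A B =
     ring.extend (pair_algebra A B Quot bilinearity_ideal A B)
       (module.fields (\<lambda>c X. bilinearity_ideal A B <+>\<^bsub>pair_algebra A B\<^esub>
                                ((\<lambda>u. c \<odot>\<^bsub>pair_algebra A B\<^esub> u) ` X)))"

definition pure_tensor ::
  "('f :: field, 'a) module \<Rightarrow> ('f, 'b) module \<Rightarrow> 'a \<Rightarrow> 'b \<Rightarrow> ('a \<times> 'b \<Rightarrow> 'f) set" where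
  "pure_tensor A B x y = bilinearity_ideal A B +>\<^bsub>pair_algebra A B\<^esub> pair_basis x y"

text \<open>
  Since pure tensors span, the map \<open>\<mu>\<close> below can only be the multiplication map
  \<open>c \<otimes> d \<mapsto> c d\<close>.
\<close>

definition graded_matrix_decomposition ::
  "'g monoid \<Rightarrow> ('f :: field, 'a) module \<Rightarrow> ('g \<Rightarrow> 'a set) \<Rightarrow> 'a set \<Rightarrow> 'a set \<Rightarrow> bool" where
  "graded_matrix_decomposition G A \<Gamma> C D \<longleftrightarrow>
     graded_subalgebra G A \<Gamma> C \<and> graded_subalgebra G A \<Gamma> D \<and>
     (\<exists>p. is_matrix_algebra p (sub_alg A C)) \<and> (\<exists>q. is_matrix_algebra q (sub_alg A D)) \<and>
     (\<forall>c\<in>C. \<forall>d\<in>D. c \<otimes>\<^bsub>A\<^esub> d = d \<otimes>\<^bsub>A\<^esub> c) \<and>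
     (\<exists>\<mu> \<in> alg_iso (tensor_algebra (sub_alg A C) (sub_alg A D)) A.
        \<forall>c\<in>C. \<forall>d\<in>D. \<mu> (pure_tensor (sub_alg A C) (sub_alg A D) c d) = c \<otimes>\<^bsub>A\<^esub> d)"

end

theory Submission
  imports Defs
begin

text \<open>
  Let \<open>\<theta>\<close> be the given isomorphism from \<open>D\<^sub>1\<close> to \<open>D\<^sub>2\<close>, and put \<open>e = \<phi> 1\<close>, an idempotent
  of degree \<open>1\<close>. The support condition forces the degree \<open>1\<close> part of \<open>R\<^sub>2\<close> into \<open>C\<^sub>2\<close>, so \<open>e\<close>
  commutes with \<open>D\<^sub>2\<close> and \<open>\<psi> d = \<phi> d + (1 - e) \<theta> d\<close> is a unital graded homomorphism
  \<open>D\<^sub>1 \<rightarrow> R\<^sub>2\<close> with \<open>\<phi> a \<phi> d = \<phi> a \<psi> d\<close>. It remains to see that \<open>\<psi> \<circ> \<theta>\<^sup>-\<^sup>1\<close> is conjugation by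
  a unit \<open>w\<close> for which \<open>w C\<^sub>2 w\<^sup>-\<^sup>1\<close> is again elementary.

  Let \<open>X\<^sub>t\<close> be the invertible homogeneous basis of \<open>D\<^sub>2\<close>, with \<open>X\<^sub>s X\<^sub>t = \<beta>(s,t) X\<^sub>t X\<^sub>s\<close>. Then
  \<open>U\<^sub>t = \<psi>(\<theta>\<^sup>-\<^sup>1 X\<^sub>t) X\<^sub>t\<^sup>-\<^sup>1\<close> has degree \<open>1\<close>, hence lies in \<open>C\<^sub>2\<close>, and \<open>t \<mapsto> U\<^sub>t\<close> is a representation
  of the support. As \<open>\<beta>\<close> is nondegenerate, \<open>C\<^sub>2\<close> has matrix units \<open>Q\<^sup>-\<^sup>1 E\<^sub>i\<^sub>j Q\<close> of unchanged degrees
  that diagonalize all \<open>U\<^sub>t\<close>, with eigenvalues \<open>\<beta>(\<sigma>(i),t)\<close>, and \<open>w = Q\<^sup>-\<^sup>1 \<Sum>\<^sub>i E\<^sub>i\<^sub>i X\<^bsub>\<sigma>(i)\<^esub>\<close>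
  does the job.
\<close>

section \<open>Graded algebras and their homogeneous components\<close>

text \<open>The element \<open>w\<close> is not homogeneous, so conjugation by it need not respect
  degrees on \<open>R2\<close>. The new fine factor is still graded, because there the conjugation
  agrees with a degree-preserving map; the new elementary factor is graded because it is the
  centralizer of a graded subalgebra. Centralizers also carry the inclusion of the image of
  \<open>C1\<close> and the corner statement: averaging over the conjugations by all X_s shows, in
  \<open>R1\<close> as in \<open>R2\<close>, that whatever commutes with the fine factor lies in the
  elementary one. This averaging and the spectral projections of the U_t divide by the order of the
  support. The diagonalizer Q must have degree 1, so arbitrary eigenbases will not do. The spectral
  projections have degree 1 and add up to 1; multilinearity of the determinant picks for every row i
  a projection, indexed by \<sigma>(i), such that the chosen rows form an invertible Q. The factor
  with index \<sigma>(i) in \<open>w\<close> is there because conjugation by it scales X_t by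
  exactly the eigenvalue of U_t in row i.\<close>

context assoc_algebra
begin

lemma scal_closed [simp, intro]: "x \<in> carrier A \<Longrightarrow> c \<odot> x \<in> carrier A"
  using smult_closed by simp

lemma scal_add: "x \<in> carrier A \<Longrightarrow> y \<in> carrier A \<Longrightarrow> c \<odot> (x \<oplus> y) = c \<odot> x \<oplus> c \<odot> y"
  using smult_r_distr by simp

lemma add_scal: "x \<in> carrier A \<Longrightarrow> (c + d) \<odot> x = c \<odot> x \<oplus> d \<odot> x"
  using smult_l_distr[of c d x] by simp

lemma scal_scal: "x \<in> carrier A \<Longrightarrow> c \<odot> (d \<odot> x) = (c * d) \<odot> x"
  using smult_assoc1[of c d x] by simp

lemma one_scal [simp]: "x \<in> carrier A \<Longrightarrow> 1 \<odot> x = x"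
  using smult_one by simp

lemma zero_scal [simp]: "x \<in> carrier A \<Longrightarrow> 0 \<odot> x = \<zero>"
  using smult_l_null by simp

lemma scal_zero [simp]: "c \<odot> \<zero> = \<zero>"
  using smult_r_null by simp

lemma scal_eq_zero_iff: "x \<in> carrier A \<Longrightarrow> c \<odot> x = \<zero> \<longleftrightarrow> c = 0 \<or> x = \<zero>"
proof -
  assume x: "x \<in> carrier A"
  have "x = \<zero>" if "c \<odot> x = \<zero>" "c \<noteq> 0"
  proof -
    have "x = (inverse c * c) \<odot> x" using x that by simp
    also have "\<dots> = inverse c \<odot> (c \<odot> x)" using x by (simp add: scal_scal)
    finally show ?thesis using that by simp
  qed
  then show ?thesis using x by auto
qed

lemma finsum_scal:
  assumes "f \<in> I \<rightarrow> carrier A"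
  shows "c \<odot> finsum A f I = finsum A (\<lambda>i. c \<odot> f i) I"
  using assms
proof (induct I rule: infinite_finite_induct)
  case (insert i I)
  then have "f \<in> I \<rightarrow> carrier A" "f i \<in> carrier A" by auto
  then show ?case
    using insert by (simp add: M.finsum_insert scal_add Pi_iff)
qed auto

lemma finsum_scal_left:
  assumes "x \<in> carrier A"
  shows "finsum A (\<lambda>i. f i \<odot> x) I = (\<Sum>i\<in>I. f i) \<odot> x"
proof (induct I rule: infinite_finite_induct)
  case (insert i I)
  then show ?case using assms by (simp add: M.finsum_insert add_scal Pi_iff)
qed (use assms in auto)

lemma subspaceI:
  assumes "W \<subseteq> carrier A" "\<zero> \<in> W"
    and "\<And>x y. x \<in> W \<Longrightarrow> y \<in> W \<Longrightarrow> x \<oplus> y \<in> W"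
    and "\<And>c x. x \<in> W \<Longrightarrow> c \<odot> x \<in> W"
  shows "subspace class_ring W A"
  using assms vectorspace_axioms module_axioms
  by (simp add: subspace_def submodule_def)

lemma subspaceD:
  assumes "subspace class_ring W A"
  shows "W \<subseteq> carrier A" "\<zero> \<in> W"
    and "\<And>x y. x \<in> W \<Longrightarrow> y \<in> W \<Longrightarrow> x \<oplus> y \<in> W"
    and "\<And>c x. x \<in> W \<Longrightarrow> c \<odot> x \<in> W"
  using assms by (auto simp: subspace_def submodule_def)

lemma subspace_finsum:
  assumes "subspace class_ring W A" "f \<in> I \<rightarrow> W"
  shows "finsum A f I \<in> W"
  using assms(2)
proof (induct I rule: infinite_finite_induct)
  case (insert i I)
  then have "f \<in> I \<rightarrow> carrier A" "f i \<in> carrier A"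
    using subspaceD(1)[OF assms(1)] by auto
  then show ?case
    using insert subspaceD[OF assms(1)] by (simp add: M.finsum_insert)
qed (use subspaceD(2)[OF assms(1)] in auto)

lemma finsum_sub_alg:
  assumes W: "subspace class_ring W A" and f: "f \<in> I \<rightarrow> W"
  shows "finsum (sub_alg A W) f I = finsum A f I"
proof -
  interpret W: module class_ring "sub_alg A W"
    using subspace_is_vs[OF W] by (simp add: vectorspace_def)
  show ?thesis
    using f
  proof (induct I rule: infinite_finite_induct)
    case (insert i I)
    then have "f \<in> I \<rightarrow> carrier A" "f i \<in> carrier A"
      using subspaceD(1)[OF W] by auto
    then show ?case
      using insert by (simp add: M.finsum_insert W.finsum_insert)
  qed auto
qed

lemma subspace_sub_algI:
  assumes W: "subspace class_ring W A" and V: "subspace class_ring V A" and "V \<subseteq> W"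
  shows "subspace class_ring V (sub_alg A W)"
  using subspace_is_vs[OF W] subspaceD[OF V] assms(3)
  by (auto simp: subspace_def submodule_def vectorspace_def)

lemma subspace_inter:
  assumes W: "subspace class_ring W A" and V: "subspace class_ring V A"
  shows "subspace class_ring (W \<inter> V) A"
  using subspaceD[OF W] subspaceD[OF V] by (intro subspaceI) auto

lemma unital_subalgebraD:
  assumes "unital_subalgebra A W"
  shows "subspace class_ring W A" "W \<subseteq> carrier A" "\<one> \<in> W" "\<zero> \<in> W"
    and "\<And>x y. x \<in> W \<Longrightarrow> y \<in> W \<Longrightarrow> x \<otimes> y \<in> W"
    and "\<And>x y. x \<in> W \<Longrightarrow> y \<in> W \<Longrightarrow> x \<oplus> y \<in> W"
    and "\<And>c x. x \<in> W \<Longrightarrow> c \<odot> x \<in> W"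
  using assms subspaceD[of W] subringE[of W A] by (auto simp: unital_subalgebra_def)

lemma unital_subalgebraI:
  assumes W: "subspace class_ring W A" and "\<one> \<in> W"
    and "\<And>x y. x \<in> W \<Longrightarrow> y \<in> W \<Longrightarrow> x \<otimes> y \<in> W"
  shows "unital_subalgebra A W"
proof -
  have "\<ominus> x \<in> W" if "x \<in> W" for x
    using subspaceD(4)[OF W that, of "-1"] subspaceD(1)[OF W] that smult_minus_1[of x]
    by (auto simp: class_ring_simps)
  then show ?thesis
    using assms subspaceD[OF W] by (auto simp: unital_subalgebra_def intro!: subringI)
qed

end

locale graded_alg = assoc_algebra A + G: comm_group G
  for A :: "('f :: field, 'a) module" (structure) and G :: "'g monoid" +
  fixes \<Gamma> :: "'g \<Rightarrow> 'a set"
  assumes finite_G: "finite (carrier G)"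
    and graded_space: "graded_space G A \<Gamma>"
    and graded_mult: "\<lbrakk>g \<in> carrier G; h \<in> carrier G; x \<in> \<Gamma> g; y \<in> \<Gamma> h\<rbrakk> \<Longrightarrow> x \<otimes> y \<in> \<Gamma> (g \<otimes>\<^bsub>G\<^esub> h)"
begin

text \<open>Families of components are extensional in \<open>graded_space\<close>, so for
  \<open>x\<close> in the carrier the description denotes one function, \<open>undefined\<close>
  outside \<open>carrier G\<close>.\<close>

definition comp :: "'a \<Rightarrow> 'g \<Rightarrow> 'a" where
  "comp x = (THE c. c \<in> (\<Pi>\<^sub>E g\<in>carrier G. \<Gamma> g) \<and> x = finsum A c (carrier G))"

lemma subspace_hom: "g \<in> carrier G \<Longrightarrow> subspace class_ring (\<Gamma> g) A"
  using graded_space by (simp add: graded_space_def)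

lemmas hom_add = subspaceD(3)[OF subspace_hom]
  and hom_scal = subspaceD(4)[OF subspace_hom]
  and hom_zero = subspaceD(2)[OF subspace_hom]

lemma hom_closed: "g \<in> carrier G \<Longrightarrow> x \<in> \<Gamma> g \<Longrightarrow> x \<in> carrier A"
  using subspaceD(1)[OF subspace_hom] by blast

lemma comp_props:
  assumes "x \<in> carrier A"
  shows "comp x \<in> (\<Pi>\<^sub>E g\<in>carrier G. \<Gamma> g) \<and> x = finsum A (comp x) (carrier G)"
proof -
  have "\<exists>!c. c \<in> (\<Pi>\<^sub>E g\<in>carrier G. \<Gamma> g) \<and> x = finsum A c (carrier G)"
    using assms graded_space by (simp add: graded_space_def)
  from theI'[OF this] show ?thesis unfolding comp_def .
qed

lemma comp_hom: "x \<in> carrier A \<Longrightarrow> g \<in> carrier G \<Longrightarrow> comp x g \<in> \<Gamma> g"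
  using comp_props by blast

lemma comp_closed [simp]: "x \<in> carrier A \<Longrightarrow> g \<in> carrier G \<Longrightarrow> comp x g \<in> carrier A"
  using comp_hom hom_closed by blast

lemma sum_comp: "x \<in> carrier A \<Longrightarrow> finsum A (comp x) (carrier G) = x"
  using comp_props by simp

lemma comp_finsum_hom:
  assumes "\<And>g. g \<in> carrier G \<Longrightarrow> f g \<in> \<Gamma> g" "g \<in> carrier G"
  shows "comp (finsum A f (carrier G)) g = f g"
proof -
  let ?f = "restrict f (carrier G)" and ?x = "finsum A f (carrier G)"
  have x: "?x \<in> carrier A"
    using assms(1) hom_closed by (intro M.finsum_closed) blast
  have "?f \<in> (\<Pi>\<^sub>E g\<in>carrier G. \<Gamma> g) \<and> ?x = finsum A ?f (carrier G)"
    using assms(1) hom_closed by (auto intro!: M.finsum_cong')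
  moreover have "\<exists>!c. c \<in> (\<Pi>\<^sub>E g\<in>carrier G. \<Gamma> g) \<and> ?x = finsum A c (carrier G)"
    using x graded_space by (simp add: graded_space_def)
  ultimately have "comp ?x = ?f"
    using comp_props[OF x] by blast
  then show ?thesis using assms(2) by simp
qed

lemma comp_eqI:
  assumes "x = finsum A f (carrier G)" "\<And>g. g \<in> carrier G \<Longrightarrow> f g \<in> \<Gamma> g" "g \<in> carrier G"
  shows "comp x g = f g"
  using comp_finsum_hom[of f g] assms by simp

lemma comp_of_hom:
  assumes "x \<in> \<Gamma> h" "h \<in> carrier G" "g \<in> carrier G"
  shows "comp x g = (if g = h then x else \<zero>)"
proof (rule comp_eqI)
  have "finsum A (\<lambda>g. if h = g then x else \<zero>) (carrier G) = x"
    using finite_G assms hom_closed by (intro M.finsum_singleton[where f = "\<lambda>_. x"]) auto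
  moreover have "finsum A (\<lambda>g. if h = g then x else \<zero>) (carrier G) =
      finsum A (\<lambda>g. if g = h then x else \<zero>) (carrier G)"
    using assms hom_closed by (intro M.finsum_cong') auto
  ultimately show "x = finsum A (\<lambda>g. if g = h then x else \<zero>) (carrier G)" by simp
qed (use assms hom_zero in auto)

lemma comp_add:
  assumes "x \<in> carrier A" "y \<in> carrier A" "g \<in> carrier G"
  shows "comp (x \<oplus> y) g = comp x g \<oplus> comp y g"
proof (rule comp_eqI)
  show "x \<oplus> y = (\<Oplus>g\<in>carrier G. comp x g \<oplus> comp y g)"
    using assms by (simp add: M.finsum_addf Pi_iff sum_comp)
qed (use assms comp_hom hom_add in auto)

lemma comp_scal:
  assumes "x \<in> carrier A" "g \<in> carrier G"
  shows "comp (c \<odot> x) g = c \<odot> comp x g"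
proof (rule comp_eqI)
  show "c \<odot> x = (\<Oplus>g\<in>carrier G. c \<odot> comp x g)"
    using assms by (simp add: Pi_iff sum_comp flip: finsum_scal)
qed (use assms comp_hom hom_scal in auto)

lemma comp_zero [simp]: "g \<in> carrier G \<Longrightarrow> comp \<zero> g = \<zero>"
  using comp_of_hom[of \<zero> g g] hom_zero by simp

lemma comp_finsum:
  assumes "f \<in> I \<rightarrow> carrier A" "g \<in> carrier G"
  shows "comp (finsum A f I) g = finsum A (\<lambda>i. comp (f i) g) I"
  using assms(1)
proof (induct I rule: infinite_finite_induct)
  case (insert i I)
  then have "f \<in> I \<rightarrow> carrier A" "f i \<in> carrier A" by auto
  then show ?case
    using insert assms(2) by (simp add: M.finsum_insert comp_add Pi_iff)
qed (use assms(2) in auto)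

lemma finsum_translate:
  assumes "h \<in> carrier G" "f \<in> carrier G \<rightarrow> carrier A"
  shows "finsum A (\<lambda>g. f (g \<otimes>\<^bsub>G\<^esub> h)) (carrier G) = finsum A f (carrier G)"
proof -
  have "finsum A f ((\<lambda>g. g \<otimes>\<^bsub>G\<^esub> h) ` carrier G) = finsum A (\<lambda>g. f (g \<otimes>\<^bsub>G\<^esub> h)) (carrier G)"
    using assms by (intro M.finsum_reindex) (auto simp: inj_on_def)
  moreover have "(\<lambda>g. g \<otimes>\<^bsub>G\<^esub> h) ` carrier G = carrier G"
  proof
    show "carrier G \<subseteq> (\<lambda>g. g \<otimes>\<^bsub>G\<^esub> h) ` carrier G"
    proof
      fix g assume "g \<in> carrier G"
      then have "g = (g \<otimes>\<^bsub>G\<^esub> inv\<^bsub>G\<^esub> h) \<otimes>\<^bsub>G\<^esub> h" "g \<otimes>\<^bsub>G\<^esub> inv\<^bsub>G\<^esub> h \<in> carrier G"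
        using assms by (auto simp: G.m_assoc)
      then show "g \<in> (\<lambda>g. g \<otimes>\<^bsub>G\<^esub> h) ` carrier G" by blast
    qed
  qed (use assms in auto)
  ultimately show ?thesis by simp
qed

text \<open>Multiplication by a homogeneous element of degree \<open>h\<close> shifts all components
  by \<open>h\<close>: the shifted family has the right degrees and sums to the product, and such a
  family is unique.\<close>

lemma comp_mult_right:
  assumes "x \<in> carrier A" "y \<in> \<Gamma> h" "h \<in> carrier G" "g \<in> carrier G"
  shows "comp (x \<otimes> y) (g \<otimes>\<^bsub>G\<^esub> h) = comp x g \<otimes> y"
proof -
  have y: "y \<in> carrier A" using assms hom_closed by blast
  let ?f = "\<lambda>k. comp x (k \<otimes>\<^bsub>G\<^esub> inv\<^bsub>G\<^esub> h) \<otimes> y"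
  have "comp (x \<otimes> y) (g \<otimes>\<^bsub>G\<^esub> h) = ?f (g \<otimes>\<^bsub>G\<^esub> h)"
  proof (rule comp_eqI)
    have "finsum A ?f (carrier G) = (\<Oplus>k\<in>carrier G. comp x k \<otimes> y)"
      using assms y by (intro finsum_translate[of "inv\<^bsub>G\<^esub> h" "\<lambda>k. comp x k \<otimes> y"]) auto
    also have "\<dots> = x \<otimes> y"
      using assms y finite_G by (simp add: sum_comp Pi_iff flip: A.finsum_ldistr)
    finally show "x \<otimes> y = finsum A ?f (carrier G)" by simp
  next
    fix k assume k: "k \<in> carrier G"
    then have "?f k \<in> \<Gamma> (k \<otimes>\<^bsub>G\<^esub> inv\<^bsub>G\<^esub> h \<otimes>\<^bsub>G\<^esub> h)"
      using assms comp_hom by (intro graded_mult) auto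
    then show "?f k \<in> \<Gamma> k" using k assms by (simp add: G.m_assoc)
  qed (use assms in auto)
  then show ?thesis using assms by (simp add: G.m_assoc)
qed

lemma comp_mult_left:
  assumes "x \<in> carrier A" "y \<in> \<Gamma> h" "h \<in> carrier G" "g \<in> carrier G"
  shows "comp (y \<otimes> x) (h \<otimes>\<^bsub>G\<^esub> g) = y \<otimes> comp x g"
proof -
  have y: "y \<in> carrier A" using assms hom_closed by blast
  let ?f = "\<lambda>k. y \<otimes> comp x (k \<otimes>\<^bsub>G\<^esub> inv\<^bsub>G\<^esub> h)"
  have "comp (y \<otimes> x) (g \<otimes>\<^bsub>G\<^esub> h) = ?f (g \<otimes>\<^bsub>G\<^esub> h)"
  proof (rule comp_eqI)
    have "finsum A ?f (carrier G) = (\<Oplus>k\<in>carrier G. y \<otimes> comp x k)"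
      using assms y by (intro finsum_translate[of "inv\<^bsub>G\<^esub> h" "\<lambda>k. y \<otimes> comp x k"]) auto
    also have "\<dots> = y \<otimes> x"
      using assms y finite_G by (simp add: sum_comp Pi_iff flip: A.finsum_rdistr)
    finally show "y \<otimes> x = finsum A ?f (carrier G)" by simp
  next
    fix k assume k: "k \<in> carrier G"
    then have "?f k \<in> \<Gamma> (h \<otimes>\<^bsub>G\<^esub> (k \<otimes>\<^bsub>G\<^esub> inv\<^bsub>G\<^esub> h))"
      using assms comp_hom by (intro graded_mult) auto
    moreover have "h \<otimes>\<^bsub>G\<^esub> (k \<otimes>\<^bsub>G\<^esub> inv\<^bsub>G\<^esub> h) = k"
      using k assms G.m_lcomm[of h k "inv\<^bsub>G\<^esub> h"] by simp
    ultimately show "?f k \<in> \<Gamma> k" by simp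
  qed (use assms in auto)
  moreover have "g \<otimes>\<^bsub>G\<^esub> h \<otimes>\<^bsub>G\<^esub> inv\<^bsub>G\<^esub> h = g"
    using assms by (simp add: G.m_assoc)
  ultimately show ?thesis using assms by (simp add: G.m_comm[of h g])
qed

text \<open>Comparing components in \<open>x = x \<otimes> \<one>\<close> shows that the component
  \<open>?e\<close> of the identity in degree 1 is a right identity for homogeneous elements.
  Summing over the components of \<open>\<one>\<close> gives
  \<open>\<one> \<otimes> ?e = \<one>\<close>.\<close>

lemma one_hom: "\<one> \<in> \<Gamma> \<one>\<^bsub>G\<^esub>"
proof -
  let ?e = "comp \<one> \<one>\<^bsub>G\<^esub>"
  have *: "x \<otimes> ?e = x" if "x \<in> \<Gamma> g" "g \<in> carrier G" for x g
    using comp_mult_left[of \<one> x g "\<one>\<^bsub>G\<^esub>"] that hom_closed comp_of_hom by auto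
  have "(\<Oplus>g\<in>carrier G. comp \<one> g) \<otimes> ?e = (\<Oplus>g\<in>carrier G. comp \<one> g \<otimes> ?e)"
    using finite_G by (intro A.finsum_ldistr) auto
  also have "\<dots> = (\<Oplus>g\<in>carrier G. comp \<one> g)"
    using *[OF comp_hom[OF one_closed]] by (intro M.finsum_cong') auto
  finally have "\<one> \<otimes> ?e = \<one>" by (simp add: sum_comp)
  then show ?thesis using comp_hom[of \<one> "\<one>\<^bsub>G\<^esub>"] by simp
qed

text \<open>The component \<open>?z\<close> of \<open>y\<close> in the inverse degree is already a
  right inverse of \<open>x\<close>, and right inverses of an invertible element are unique.\<close>

lemma hom_inverse:
  assumes "x \<in> \<Gamma> g" "g \<in> carrier G" "y \<in> carrier A" "x \<otimes> y = \<one>" "y \<otimes> x = \<one>"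
  shows "y \<in> \<Gamma> (inv\<^bsub>G\<^esub> g)"
proof -
  let ?z = "comp y (inv\<^bsub>G\<^esub> g)"
  have x: "x \<in> carrier A" using assms hom_closed by blast
  have "x \<otimes> ?z = comp \<one> \<one>\<^bsub>G\<^esub>"
    using comp_mult_left[of y x g "inv\<^bsub>G\<^esub> g"] assms by simp
  also have "\<dots> = \<one>" using comp_of_hom[OF one_hom] by simp
  finally have "y \<otimes> (x \<otimes> ?z) = y" using assms by simp
  then have "?z = y"
    using assms x by (simp flip: A.m_assoc)
  then show ?thesis using comp_hom[of y "inv\<^bsub>G\<^esub> g"] assms by simp
qed

lemma hom_disjoint:
  assumes "x \<in> \<Gamma> g" "x \<in> \<Gamma> h" "g \<in> carrier G" "h \<in> carrier G" "x \<noteq> \<zero>"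
  shows "g = h"
  using comp_of_hom[of x g h] comp_of_hom[of x h h] assms by (auto split: if_splits)

text \<open>Gradedness of a subspace becomes stability under the ambient \<open>comp\<close>, the
  form in which both new factors of \<open>R2\<close> are treated.\<close>

lemma graded_space_iff:
  assumes W: "subspace class_ring W A"
  shows "graded_space G (sub_alg A W) (sub_grading \<Gamma> W) \<longleftrightarrow>
    (\<forall>x\<in>W. \<forall>g\<in>carrier G. comp x g \<in> W)"
proof
  assume gr: "graded_space G (sub_alg A W) (sub_grading \<Gamma> W)"
  show "\<forall>x\<in>W. \<forall>g\<in>carrier G. comp x g \<in> W"
  proof (intro ballI)
    fix x g assume x: "x \<in> W" and g: "g \<in> carrier G"
    obtain c where c: "c \<in> (\<Pi>\<^sub>E g\<in>carrier G. W \<inter> \<Gamma> g)"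
      and xc: "x = finsum (sub_alg A W) c (carrier G)"
      using gr x unfolding graded_space_def by auto
    have "x = finsum A c (carrier G)"
      unfolding xc using c by (intro finsum_sub_alg[OF W]) auto
    then have "comp x g = c g" by (rule comp_eqI) (use c g in auto)
    then show "comp x g \<in> W" using c g by auto
  qed
next
  assume cl: "\<forall>x\<in>W. \<forall>g\<in>carrier G. comp x g \<in> W"
  show "graded_space G (sub_alg A W) (sub_grading \<Gamma> W)"
    unfolding graded_space_def
  proof (intro conjI ballI)
    fix g assume "g \<in> carrier G"
    then show "subspace class_ring (W \<inter> \<Gamma> g) (sub_alg A W)"
      by (intro subspace_sub_algI W subspace_inter subspace_hom) auto
  next
    fix x assume "x \<in> carrier (sub_alg A W)"
    then have x: "x \<in> W" by simp
    then have xA: "x \<in> carrier A" using subspaceD(1)[OF W] by blast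
    show "\<exists>!c. c \<in> (\<Pi>\<^sub>E g\<in>carrier G. W \<inter> \<Gamma> g) \<and> x = finsum (sub_alg A W) c (carrier G)"
    proof (rule ex1I[of _ "comp x"], intro conjI)
      show c: "comp x \<in> (\<Pi>\<^sub>E g\<in>carrier G. W \<inter> \<Gamma> g)"
        using comp_props[OF xA] cl x by auto
      have "finsum (sub_alg A W) (comp x) (carrier G) = finsum A (comp x) (carrier G)"
        using c by (intro finsum_sub_alg[OF W]) auto
      then show "x = finsum (sub_alg A W) (comp x) (carrier G)"
        using sum_comp[OF xA] by simp
    next
      fix c assume c: "c \<in> (\<Pi>\<^sub>E g\<in>carrier G. W \<inter> \<Gamma> g) \<and> x = finsum (sub_alg A W) c (carrier G)"
      then have "finsum (sub_alg A W) c (carrier G) = finsum A c (carrier G)"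
        by (intro finsum_sub_alg[OF W]) auto
      then have "x = finsum A c (carrier G)" using c by simp
      then have *: "comp x g = c g" if "g \<in> carrier G" for g
        by (rule comp_eqI) (use c that in auto)
      show "c = comp x"
      proof
        fix g show "c g = comp x g"
          using * c comp_props[OF xA]
          by (cases "g \<in> carrier G") (simp, metis PiE_arb)
      qed
    qed
  qed
qed

end

lemma graded_algI:
  assumes "comm_group G" "finite (carrier G)" "graded_algebra G A \<Gamma>"
  shows "graded_alg A G \<Gamma>"
  using assms by (auto simp: graded_alg_def graded_alg_axioms_def graded_algebra_def)

section \<open>Matrix algebras\<close>

lemma matrix_unit_carrier [simp, intro]: "matrix_unit p i j \<in> carrier_mat p p"
  by (simp add: matrix_unit_def)

lemma matrix_unit_dim [simp]:
  "dim_row (matrix_unit p i j) = p" "dim_col (matrix_unit p i j) = p"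
  by (simp_all add: matrix_unit_def)

lemma matrix_unit_mult_index:
  assumes "M \<in> carrier_mat p p" "j < p" "a < p" "b < p"
  shows "(matrix_unit p i j * M) $$ (a, b) = (if a = i then M $$ (j, b) else 0)"
proof -
  have "(matrix_unit p i j * M) $$ (a, b) =
      (\<Sum>k<p. (if a = i \<and> k = j then 1 else 0) * M $$ (k, b))"
    using assms by (auto simp: matrix_unit_def scalar_prod_def atLeast0LessThan)
  also have "\<dots> = (\<Sum>k<p. if j = k then (if a = i then M $$ (k, b) else 0) else 0)"
    by (intro sum.cong) auto
  also have "\<dots> = (if a = i then M $$ (j, b) else 0)"
    using assms by (simp add: sum.delta)
  finally show ?thesis .
qed

lemma mult_matrix_unit_index:
  assumes "M \<in> carrier_mat p p" "i < p" "a < p" "b < p"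
  shows "(M * matrix_unit p i j) $$ (a, b) = (if b = j then M $$ (a, i) else 0)"
proof -
  have "(M * matrix_unit p i j) $$ (a, b) =
      (\<Sum>k<p. M $$ (a, k) * (if k = i \<and> b = j then 1 else 0))"
    using assms by (auto simp: matrix_unit_def scalar_prod_def atLeast0LessThan)
  also have "\<dots> = (\<Sum>k<p. if i = k then (if b = j then M $$ (a, k) else 0) else 0)"
    by (intro sum.cong) auto
  also have "\<dots> = (if b = j then M $$ (a, i) else 0)"
    using assms by (simp add: sum.delta)
  finally show ?thesis .
qed

lemma matrix_unit_mult:
  assumes "i < p" "j < p" "k < p" "l < p"
  shows "matrix_unit p i j * matrix_unit p k l = (if j = k then matrix_unit p i l else 0\<^sub>m p p)"
proof (rule eq_matI)
  fix a b assume "a < dim_row (if j = k then matrix_unit p i l else (0\<^sub>m p p :: 'a mat))"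
    "b < dim_col (if j = k then matrix_unit p i l else (0\<^sub>m p p :: 'a mat))"
  then have ab: "a < p" "b < p" by (auto split: if_splits)
  have "(matrix_unit p i j * (matrix_unit p k l :: 'a mat)) $$ (a, b) =
      (if a = i then (matrix_unit p k l :: 'a mat) $$ (j, b) else 0)"
    by (rule matrix_unit_mult_index) (use assms ab in auto)
  then show "(matrix_unit p i j * (matrix_unit p k l :: 'a mat)) $$ (a, b) =
      (if j = k then matrix_unit p i l else (0\<^sub>m p p :: 'a mat)) $$ (a, b)"
    using assms ab by (auto simp: matrix_unit_def)
qed auto

lemma matrix_unit_sandwich:
  assumes M: "M \<in> carrier_mat p p" and "i < p" "j < p" "k < p" "l < p"
  shows "matrix_unit p i j * M * matrix_unit p k l = M $$ (j, k) \<cdot>\<^sub>m matrix_unit p i l"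
proof (rule eq_matI)
  fix a b assume "a < dim_row (M $$ (j, k) \<cdot>\<^sub>m matrix_unit p i l)"
    "b < dim_col (M $$ (j, k) \<cdot>\<^sub>m matrix_unit p i l)"
  then have ab: "a < p" "b < p" by auto
  have "(matrix_unit p i j * M * matrix_unit p k l) $$ (a, b) =
      (if b = l then (matrix_unit p i j * M) $$ (a, k) else 0)"
    by (rule mult_matrix_unit_index) (use assms ab in auto)
  also have "(matrix_unit p i j * M) $$ (a, k) = (if a = i then M $$ (j, k) else 0)"
    by (rule matrix_unit_mult_index) (use assms ab in auto)
  finally show "(matrix_unit p i j * M * matrix_unit p k l) $$ (a, b) =
      (M $$ (j, k) \<cdot>\<^sub>m matrix_unit p i l) $$ (a, b)"
    using assms ab by (auto simp: matrix_unit_def)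
qed auto

lemma finsum_module_mat_index:
  assumes "P \<in> I \<rightarrow> carrier_mat p q" "a < p" "b < q"
  shows "finsum (module_mat TYPE('f :: field) p q) P I $$ (a, b) = (\<Sum>i\<in>I. P i $$ (a, b))"
  using assms(1)
proof (induct I rule: infinite_finite_induct)
  case (insert i I)
  interpret M: abelian_group "module_mat TYPE('f) p q" by (rule abelian_group_mat)
  have "finsum (module_mat TYPE('f) p q) P I \<in> carrier_mat p q"
    using M.finsum_closed[of P I] insert by (auto simp: module_mat_simps Pi_iff)
  then show ?case
    using insert assms(2,3) by (simp add: M.finsum_insert module_mat_simps Pi_iff)
next
  case (infinite I)
  interpret M: abelian_group "module_mat TYPE('f) p q" by (rule abelian_group_mat)
  show ?case using infinite assms by (simp add: M.finsum_infinite module_mat_simps)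
next
  case empty
  interpret M: abelian_group "module_mat TYPE('f) p q" by (rule abelian_group_mat)
  show ?case using assms by (simp add: module_mat_simps)
qed

text \<open>Expand the determinant of the identity matrix along all its rows at once.\<close>

lemma invertible_row_selection:
  fixes P :: "'i \<Rightarrow> 'f :: field mat"
  assumes "finite I" and P: "P \<in> I \<rightarrow> carrier_mat p p"
    and one: "finsum (module_mat TYPE('f) p p) P I = 1\<^sub>m p"
  shows "\<exists>\<sigma>\<in>{..<p} \<rightarrow> I. \<exists>Q R. Q \<in> carrier_mat p p \<and> R \<in> carrier_mat p p \<and>
    Q * R = 1\<^sub>m p \<and> R * Q = 1\<^sub>m p \<and>
    (\<forall>i<p. \<forall>j<p. Q $$ (i, j) = P (\<sigma> i) $$ (i, j))"
proof -
  \<comment> \<open>The expansion of the determinant normalises choice functions by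
    \<open>f i = i\<close> outside the row range, so the summation indices have to be natural
    numbers; \<open>e\<close> enumerates \<open>I\<close>.\<close>
  obtain n :: nat and e where e: "bij_betw e {..<n} I"
    using ex_bij_betw_nat_finite[OF \<open>finite I\<close>] by (auto simp: atLeast0LessThan)
  let ?a = "\<lambda>i s. row (P (e s)) i"
  have eI: "e s \<in> I" if "s < n" for s using e that by (auto simp: bij_betw_def)
  then have PeI: "P (e s) \<in> carrier_mat p p" if "s < n" for s using P that by auto
  have a: "?a \<in> {0..<p} \<rightarrow> {..<n} \<rightarrow> carrier_vec p"
    using P eI by (force simp: Pi_iff row_def)
  have *: "finsum_vec TYPE('f) p (?a i) {..<n} = row (1\<^sub>m p) i" if i: "i < p" for i
  proof (rule eq_vecI)
    have c: "?a i \<in> {..<n} \<rightarrow> carrier_vec p" using a i by auto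
    have d: "finsum_vec TYPE('f) p (?a i) {..<n} \<in> carrier_vec p"
      by (rule finsum_vec_closed[OF c])
    then show "dim_vec (finsum_vec TYPE('f) p (?a i) {..<n}) = dim_vec (row (1\<^sub>m p) i)" by simp
    fix j assume "j < dim_vec (row (1\<^sub>m p :: 'f mat) i)"
    then have j: "j < p" by simp
    have "finsum_vec TYPE('f) p (?a i) {..<n} $ j = (\<Sum>s<n. row (P (e s)) i $ j)"
      by (rule index_finsum_vec) (use j c in auto)
    also have "\<dots> = (\<Sum>s<n. P (e s) $$ (i, j))"
      using PeI[THEN carrier_matD(1)] PeI[THEN carrier_matD(2)] i j
      by (intro sum.cong refl index_row) simp_all
    also have "\<dots> = (\<Sum>s\<in>I. P s $$ (i, j))"
      by (rule sum.reindex_bij_betw[OF e])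
    also have "\<dots> = 1\<^sub>m p $$ (i, j)"
      by (simp only: one flip: finsum_module_mat_index[OF P i j])
    also have "\<dots> = row (1\<^sub>m p) i $ j"
      using i j by simp
    finally show "finsum_vec TYPE('f) p (?a i) {..<n} $ j = row (1\<^sub>m p) i $ j" .
  qed
  have "mat\<^sub>r p p (\<lambda>i. finsum_vec TYPE('f) p (?a i) {..<n}) = 1\<^sub>m p"
    using * by (intro eq_rowI) simp_all
  then have "(\<Sum>f | (\<forall>i\<in>{0..<p}. f i \<in> {..<n}) \<and> (\<forall>i. i \<notin> {0..<p} \<longrightarrow> f i = i).
      det (mat\<^sub>r p p (\<lambda>i. ?a i (f i)))) \<noteq> 0"
    by (subst det_linear_rows_sum[OF _ a, symmetric]) simp_all
  \<comment> \<open>A nonzero sum has a nonzero term, and its choice of rows gives an invertible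
    matrix.\<close>
  from sum.not_neutral_contains_not_neutral[OF this]
  obtain f where f: "\<forall>i\<in>{0..<p}. f i \<in> {..<n}" and d: "det (mat\<^sub>r p p (\<lambda>i. ?a i (f i))) \<noteq> 0"
    by blast
  let ?Q = "mat\<^sub>r p p (\<lambda>i. ?a i (f i))"
  have Q: "?Q \<in> carrier_mat p p" by simp
  obtain R where R: "R \<in> carrier_mat p p" "?Q * R = 1\<^sub>m p" "R * ?Q = 1\<^sub>m p"
    using det_non_zero_imp_unit[OF Q d, of "()"] by (auto simp: Units_def ring_mat_simps)
  moreover have "(\<lambda>i. e (f i)) \<in> {..<p} \<rightarrow> I" using f eI by auto
  moreover have "?Q $$ (i, j) = P (e (f i)) $$ (i, j)" if ij: "i < p" "j < p" for i j
  proof -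
    have c: "P (e (f i)) \<in> carrier_mat p p" using PeI f ij by simp
    have "?Q $$ (i, j) = row ?Q i $ j"
      using Q ij by (intro index_row(1)[symmetric]) auto
    also have "row ?Q i = row (P (e (f i))) i" using c ij by simp
    also have "\<dots> $ j = P (e (f i)) $$ (i, j)"
      using c ij by (intro index_row(1)) auto
    finally show ?thesis .
  qed
  ultimately show ?thesis using Q
    by - (rule bexI[of _ "\<lambda>i. e (f i)"], rule exI[of _ ?Q], rule exI[of _ R], simp_all)
qed

section \<open>Algebra homomorphisms and unital subalgebras isomorphic to a full matrix
  algebra\<close>

lemma alg_homD:
  assumes "h \<in> alg_hom A B"
  shows "x \<in> carrier A \<Longrightarrow> h x \<in> carrier B"
    and "x \<in> carrier A \<Longrightarrow> y \<in> carrier A \<Longrightarrow> h (x \<oplus>\<^bsub>A\<^esub> y) = h x \<oplus>\<^bsub>B\<^esub> h y"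
    and "x \<in> carrier A \<Longrightarrow> y \<in> carrier A \<Longrightarrow> h (x \<otimes>\<^bsub>A\<^esub> y) = h x \<otimes>\<^bsub>B\<^esub> h y"
    and "x \<in> carrier A \<Longrightarrow> h (c \<odot>\<^bsub>A\<^esub> x) = c \<odot>\<^bsub>B\<^esub> h x"
  using assms by (auto simp: alg_hom_def module_hom_def hom_def)

lemma alg_homI:
  assumes "\<And>x. x \<in> carrier A \<Longrightarrow> h x \<in> carrier B"
    and "\<And>x y. x \<in> carrier A \<Longrightarrow> y \<in> carrier A \<Longrightarrow> h (x \<oplus>\<^bsub>A\<^esub> y) = h x \<oplus>\<^bsub>B\<^esub> h y"
    and "\<And>x y. x \<in> carrier A \<Longrightarrow> y \<in> carrier A \<Longrightarrow> h (x \<otimes>\<^bsub>A\<^esub> y) = h x \<otimes>\<^bsub>B\<^esub> h y"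
    and "\<And>c x. x \<in> carrier A \<Longrightarrow> h (c \<odot>\<^bsub>A\<^esub> x) = c \<odot>\<^bsub>B\<^esub> h x"
  shows "h \<in> alg_hom A B"
  using assms by (auto simp: alg_hom_def module_hom_def hom_def)

lemma alg_iso_imp_hom: "h \<in> alg_iso A B \<Longrightarrow> h \<in> alg_hom A B"
  by (simp add: alg_iso_def)

lemma alg_iso_imp_bij: "h \<in> alg_iso A B \<Longrightarrow> bij_betw h (carrier A) (carrier B)"
  by (simp add: alg_iso_def)

lemma alg_iso_comp:
  assumes "h \<in> alg_iso A B" "k \<in> alg_iso B C"
  shows "(\<lambda>x. k (h x)) \<in> alg_iso A C"
proof -
  note h = alg_homD[OF alg_iso_imp_hom[OF assms(1)]]
    and k = alg_homD[OF alg_iso_imp_hom[OF assms(2)]]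
  have "(\<lambda>x. k (h x)) \<in> alg_hom A C"
    by (intro alg_homI) (simp_all add: h k)
  moreover have "bij_betw (\<lambda>x. k (h x)) (carrier A) (carrier C)"
    using bij_betw_trans[OF assms[THEN alg_iso_imp_bij]] by (simp add: o_def)
  ultimately show ?thesis by (simp add: alg_iso_def)
qed

lemma alg_iso_inv:
  assumes "module class_ring A" "Group.monoid A" "h \<in> alg_iso A B"
  shows "inv_into (carrier A) h \<in> alg_iso B A"
proof -
  interpret A: module class_ring A by fact
  interpret AM: Group.monoid A by fact
  note h = alg_homD[OF alg_iso_imp_hom[OF assms(3)]]
  have bij: "bij_betw h (carrier A) (carrier B)" using assms(3) by (rule alg_iso_imp_bij)
  let ?k = "inv_into (carrier A) h"
  have kc: "?k y \<in> carrier A" and hk: "h (?k y) = y" if "y \<in> carrier B" for y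
    using bij that by (auto simp: bij_betw_def inv_into_into f_inv_into_f)
  have eq: "?k y = x" if "x \<in> carrier A" "y = h x" for x y
    using bij that by (simp add: bij_betw_def)
  have "?k \<in> alg_hom B A"
  proof (rule alg_homI)
    fix x y assume xy: "x \<in> carrier B" "y \<in> carrier B"
    show "?k (x \<oplus>\<^bsub>B\<^esub> y) = ?k x \<oplus>\<^bsub>A\<^esub> ?k y"
      by (rule eq) (simp_all add: xy kc hk h)
    show "?k (x \<otimes>\<^bsub>B\<^esub> y) = ?k x \<otimes>\<^bsub>A\<^esub> ?k y"
      by (rule eq) (simp_all add: xy kc hk h)
  next
    fix c x assume "x \<in> carrier B"
    then show "?k (c \<odot>\<^bsub>B\<^esub> x) = c \<odot>\<^bsub>A\<^esub> ?k x"
      using A.smult_closed[of c "?k x"] by (intro eq) (simp_all add: kc hk h)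
  qed (rule kc)
  then show ?thesis
    using bij_betw_inv_into[OF bij] by (simp add: alg_iso_def)
qed

locale matrix_subalgebra = assoc_algebra A
  for A :: "('f :: field, 'a) module" (structure) +
  fixes W :: "'a set" and p :: nat and h :: "'f mat \<Rightarrow> 'a"
  assumes sub: "unital_subalgebra A W"
    and h_iso: "h \<in> alg_iso (module_mat TYPE('f) p p) (sub_alg A W)"
begin

lemmas W_closed = unital_subalgebraD[OF sub]

lemma W_carrier [simp]: "x \<in> W \<Longrightarrow> x \<in> carrier A"
  using W_closed(2) by blast

lemmas h_hom = alg_homD[OF alg_iso_imp_hom[OF h_iso], simplified, unfolded module_mat_simps]

lemma h_carrier [simp]: "M \<in> carrier_mat p p \<Longrightarrow> h M \<in> carrier A"
  using h_hom(1) W_carrier by blast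

lemma h_inj: "h M = h N \<Longrightarrow> M \<in> carrier_mat p p \<Longrightarrow> N \<in> carrier_mat p p \<Longrightarrow> M = N"
  using alg_iso_imp_bij[OF h_iso] by (auto simp: bij_betw_def inj_on_def module_mat_simps)

lemma h_surj: "x \<in> W \<Longrightarrow> \<exists>M\<in>carrier_mat p p. h M = x"
  using alg_iso_imp_bij[OF h_iso] by (auto simp: bij_betw_def image_iff module_mat_simps)

text \<open>Homomorphisms are not assumed unital. Surjectivity onto \<open>W\<close> compensates:
  some \<open>M\<close> is sent to the identity, and \<open>1\<^sub>m p * M = M\<close> then forces
  the value at \<open>1\<^sub>m p\<close>.\<close>

lemma h_one: "h (1\<^sub>m p) = \<one>"
proof -
  obtain M where M: "M \<in> carrier_mat p p" "h M = \<one>"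
    using h_surj[OF W_closed(3)] by blast
  have "\<one> = h (1\<^sub>m p * M)" using M by simp
  also have "\<dots> = h (1\<^sub>m p)" using M h_hom(3)[of "1\<^sub>m p" M] by simp
  finally show ?thesis by simp
qed

lemma h_zero: "h (0\<^sub>m p p) = \<zero>"
  using h_hom(4)[of "0\<^sub>m p p" 0] by simp

lemma h_finsum:
  assumes "P \<in> I \<rightarrow> carrier_mat p p"
  shows "h (finsum (module_mat TYPE('f) p p) P I) = (\<Oplus>i\<in>I. h (P i))"
  using assms
proof (induct I rule: infinite_finite_induct)
  case (insert i I)
  interpret M: abelian_group "module_mat TYPE('f) p p" by (rule abelian_group_mat)
  have "finsum (module_mat TYPE('f) p p) P I \<in> carrier_mat p p"
    using M.finsum_closed[of P I] insert by (auto simp: module_mat_simps Pi_iff)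
  then show ?case
    using insert by (simp add: M.finsum_insert finsum_insert h_hom module_mat_simps Pi_iff)
next
  case (infinite I)
  interpret M: abelian_group "module_mat TYPE('f) p p" by (rule abelian_group_mat)
  show ?case using infinite by (simp add: M.finsum_infinite finsum_infinite h_zero module_mat_simps)
next
  case empty
  interpret M: abelian_group "module_mat TYPE('f) p p" by (rule abelian_group_mat)
  show ?case by (simp add: h_zero module_mat_simps)
qed

definition unit :: "nat \<Rightarrow> nat \<Rightarrow> 'a" where
  "unit i j = h (matrix_unit p i j)"

lemma unit_W [simp]: "unit i j \<in> W"
  by (simp add: unit_def h_hom)

lemma unit_mult:
  assumes "i < p" "j < p" "k < p" "l < p"
  shows "unit i j \<otimes> unit k l = (if j = k then unit i l else \<zero>)"
  using assms by (simp add: unit_def matrix_unit_mult h_zero flip: h_hom(3))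

lemma sum_unit: "(\<Oplus>i\<in>{..<p}. unit i i) = \<one>"
proof -
  have "finsum (module_mat TYPE('f) p p) (\<lambda>i. matrix_unit p i i) {..<p} = 1\<^sub>m p" (is "?S = _")
  proof (rule eq_matI)
    interpret M: abelian_group "module_mat TYPE('f) p p" by (rule abelian_group_mat)
    have c: "?S \<in> carrier_mat p p"
      using M.finsum_closed[of "\<lambda>i. matrix_unit p i i" "{..<p}"] by (auto simp: module_mat_simps)
    then show "dim_row ?S = dim_row (1\<^sub>m p)" "dim_col ?S = dim_col (1\<^sub>m p)" by auto
    fix a b assume "a < dim_row (1\<^sub>m p :: 'f mat)" "b < dim_col (1\<^sub>m p :: 'f mat)"
    then have ab: "a < p" "b < p" by auto
    have "?S $$ (a, b) = (\<Sum>i<p. matrix_unit p i i $$ (a, b))"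
      by (rule finsum_module_mat_index) (use ab in auto)
    also have "\<dots> = (\<Sum>i<p. if a = i then (if a = b then 1 else 0) else 0)"
      using ab by (intro sum.cong) (auto simp: matrix_unit_def)
    also have "\<dots> = 1\<^sub>m p $$ (a, b)" using ab by (simp add: sum.delta)
    finally show "?S $$ (a, b) = 1\<^sub>m p $$ (a, b)" .
  qed
  then show ?thesis
    using h_finsum[of "\<lambda>i. matrix_unit p i i" "{..<p}"] h_one by (simp add: unit_def)
qed

text \<open>One-sided inverses of square matrices are two-sided, and \<open>h\<close> carries this
  over to \<open>W\<close>.\<close>

lemma left_inverse_imp_right:
  assumes "x \<in> W" "y \<in> W" "x \<otimes> y = \<one>"
  shows "y \<otimes> x = \<one>"
proof -
  obtain M N where MN: "M \<in> carrier_mat p p" "h M = x" "N \<in> carrier_mat p p" "h N = y"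
    using assms h_surj by metis
  then have "h (M * N) = h (1\<^sub>m p)" using assms h_hom(3)[of M N] h_one by simp
  then have "M * N = 1\<^sub>m p" using MN by (intro h_inj) auto
  then have "N * M = 1\<^sub>m p" using mat_mult_left_right_inverse MN by blast
  then show ?thesis using MN h_hom(3)[of N M] h_one by simp
qed

text \<open>
  This single identity yields both the simplicity of a matrix algebra and the fact that its
  center consists of scalars.
\<close>

lemma sandwich_eq_one:
  assumes "x \<in> W" "x \<noteq> \<zero>"
  shows "\<exists>a\<in>{..<p} \<rightarrow> W. \<exists>b\<in>{..<p} \<rightarrow> W. \<exists>c.
    (\<Oplus>i\<in>{..<p}. a i \<otimes> x \<otimes> b i) = \<one> \<and> (\<Oplus>i\<in>{..<p}. a i \<otimes> b i) = c \<odot> \<one>"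
proof -
  obtain M where M: "M \<in> carrier_mat p p" "h M = x" using assms h_surj by metis
  have "M \<noteq> 0\<^sub>m p p" using M h_zero assms by auto
  \<comment> \<open>One nonzero entry suffices: E_ij M E_ki is the entry at \<open>(j, k)\<close>
    times E_ii. Dividing by that entry and summing over \<open>i\<close> gives the identity.\<close>
  then obtain j k where jk: "j < p" "k < p" "M $$ (j, k) \<noteq> 0"
    using M by (metis carrier_matD eq_matI index_zero_mat)
  let ?c = "inverse (M $$ (j, k))"
  let ?a = "\<lambda>i. ?c \<odot> unit i j" and ?b = "\<lambda>i. unit k i"
  have "?a i \<otimes> x \<otimes> ?b i = unit i i" if "i < p" for i
  proof -
    have "unit i j \<otimes> x \<otimes> unit k i = h (matrix_unit p i j * M * matrix_unit p k i)"
      using M by (simp add: unit_def h_hom mult_carrier_mat[of _ p p])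
    also have "\<dots> = M $$ (j, k) \<odot> unit i i"
      using M jk that by (simp add: matrix_unit_sandwich h_hom unit_def)
    finally show ?thesis
      using jk assms by (simp add: smult_mult_left scal_scal)
  qed
  then have "(\<Oplus>i\<in>{..<p}. ?a i \<otimes> x \<otimes> ?b i) = (\<Oplus>i\<in>{..<p}. unit i i)"
    by (intro M.finsum_cong') auto
  then have 1: "(\<Oplus>i\<in>{..<p}. ?a i \<otimes> x \<otimes> ?b i) = \<one>"
    by (simp add: sum_unit)
  \<comment> \<open>The same coefficients with \<open>x\<close> left out multiply to E_ij E_ki up to
    a scalar, which is zero unless \<open>j = k\<close>.\<close>
  have "?a i \<otimes> ?b i = (if j = k then ?c else 0) \<odot> unit i i" if "i < p" for i
    using jk that by (simp add: smult_mult_left unit_mult)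
  then have "(\<Oplus>i\<in>{..<p}. ?a i \<otimes> ?b i) = (\<Oplus>i\<in>{..<p}. (if j = k then ?c else 0) \<odot> unit i i)"
    by (intro M.finsum_cong') auto
  also have "\<dots> = (if j = k then ?c else 0) \<odot> \<one>"
    using sum_unit by (simp add: Pi_iff flip: finsum_scal)
  finally show ?thesis
    using 1 W_closed(7) by - (rule bexI[of _ ?a], rule bexI[of _ ?b], blast, auto)
qed

end

section \<open>Matrix algebras with a fine grading\<close>

lemma (in vectorspace) dim_one_iff_line:
  assumes "fin_dim" "dim = 1"
  shows "\<exists>x\<in>carrier V. \<forall>y\<in>carrier V. \<exists>c\<in>carrier K. y = c \<odot>\<^bsub>V\<^esub> x"
proof -
  obtain B where B: "finite B" "basis B" using finite_basis_exists[OF assms(1)] by blast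
  then have "card B = 1" using dim_basis assms(2) by simp
  then obtain x where Bx: "B = {x}" by (auto simp: card_1_singleton_iff)
  with B have x: "x \<in> carrier V" and gen: "span {x} = carrier V" by (auto simp: basis_def)
  have "\<exists>c\<in>carrier K. y = c \<odot>\<^bsub>V\<^esub> x" if "y \<in> carrier V" for y
  proof -
    have "y \<in> span {x}" using that gen by simp
    then obtain a where "a \<in> {x} \<rightarrow> carrier K" "y = lincomb a {x}"
      using finite_span[of "{x}"] x by auto
    then show ?thesis using x by (auto simp: lincomb_def)
  qed
  then show ?thesis using x by blast
qed

lemma (in vectorspace) dim_line:
  assumes "x \<in> carrier V" "x \<noteq> \<zero>\<^bsub>V\<^esub>" "\<And>y. y \<in> carrier V \<Longrightarrow> \<exists>c\<in>carrier K. y = c \<odot>\<^bsub>V\<^esub> x"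
  shows "dim = 1"
proof (rule dim1I)
  have "y \<in> span {x}" if y: "y \<in> carrier V" for y
  proof -
    obtain c where c: "c \<in> carrier K" "y = c \<odot>\<^bsub>V\<^esub> x" using assms(3)[OF y] by blast
    then have "y = lincomb (\<lambda>_. c) {x}" using assms(1) by (simp add: lincomb_def)
    then show ?thesis using c assms(1) by (auto simp: finite_span)
  qed
  then show "span {x} = carrier V" using span_is_subset2[of "{x}"] assms(1) by auto
qed (use assms in auto)

context matrix_subalgebra
begin

text \<open>Reading \<open>dim = 1\<close> as "spanned by one vector" presupposes finite dimension.
  For a homogeneous component this comes from writing it as a linear image of matrices, hence of
  coordinate vectors of length \<open>p * p\<close>.\<close>

lemma fin_dim_linear_image:
  assumes V: "subspace class_ring V A"
    and f: "\<And>x. x \<in> W \<Longrightarrow> f x \<in> V"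
    and f_add: "\<And>x y. x \<in> W \<Longrightarrow> y \<in> W \<Longrightarrow> f (x \<oplus> y) = f x \<oplus> f y"
    and f_scal: "\<And>c x. x \<in> W \<Longrightarrow> f (c \<odot> x) = c \<odot> f x"
    and surj: "V \<subseteq> f ` W"
  shows "vectorspace.fin_dim class_ring (sub_alg A V)"
proof -
  interpret VV: vectorspace class_ring "sub_alg A V"
    using subspace_is_vs[OF V] .
  interpret vec: vec_space "TYPE('f)" "p * p" .
  define m :: "'f vec \<Rightarrow> 'f mat" where "m = (\<lambda>v. mat p p (\<lambda>(i, j). v $ (i * p + j)))"
  have mc: "m v \<in> carrier_mat p p" for v by (simp add: m_def)
  have idx: "i * p + j < p * p" if "i < p" "j < p" for i j
  proof -
    have "i * p + j < Suc i * p" using that by simp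
    also have "\<dots> \<le> p * p" using that by (intro mult_le_mono1) simp
    finally show ?thesis .
  qed
  have m_add: "m (v + w) = m v + m w" if "v \<in> carrier_vec (p * p)" "w \<in> carrier_vec (p * p)" for v w
    using that idx by (intro eq_matI) (auto simp: m_def)
  have m_scal: "m (c \<cdot>\<^sub>v v) = c \<cdot>\<^sub>m m v" if "v \<in> carrier_vec (p * p)" for c v
    using that idx by (intro eq_matI) (auto simp: m_def)
  have m_surj: "\<exists>v\<in>carrier_vec (p * p). m v = M" if "M \<in> carrier_mat p p" for M
  proof (intro bexI)
    show "m (vec (p * p) (\<lambda>k. M $$ (k div p, k mod p))) = M"
      using that idx by (intro eq_matI) (auto simp: m_def)
  qed simp
  let ?T = "\<lambda>v. f (h (m v))"
  interpret lin: linear_map class_ring "module_vec TYPE('f) (p * p)" "sub_alg A V" ?T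
  proof (unfold_locales)
    show "?T \<in> module_hom class_ring (module_vec TYPE('f) (p * p)) (sub_alg A V)"
      using f mc
      by (auto simp: module_hom_def module_vec_simps m_add m_scal h_hom f_add f_scal)
  qed
  have "V \<subseteq> ?T ` carrier_vec (p * p)"
  proof
    fix y assume "y \<in> V"
    then obtain x where "x \<in> W" "y = f x" using surj by blast
    moreover obtain M where "M \<in> carrier_mat p p" "h M = x" using \<open>x \<in> W\<close> h_surj by blast
    moreover obtain v where "v \<in> carrier_vec (p * p)" "m v = M"
      using \<open>M \<in> carrier_mat p p\<close> m_surj by blast
    ultimately show "y \<in> ?T ` carrier_vec (p * p)" by blast
  qed
  then have "?T ` carrier (module_vec TYPE('f) (p * p)) = carrier (sub_alg A V)"
    using f h_hom(1) mc by (auto simp: module_vec_simps)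
  then show ?thesis
    using lin.surj_fin_dim vec.fin_dim by blast
qed

end

section \<open>The homogeneous basis of a matrix algebra with fine grading\<close>

locale fine_subalgebra = graded_alg A G \<Gamma>
  for A :: "('f :: field, 'a) module" (structure) and G :: "'g monoid" and \<Gamma> :: "'g \<Rightarrow> 'a set" +
  fixes D :: "'a set"
  assumes graded_D: "graded_subalgebra G A \<Gamma> D"
    and fine_D: "fine_grading G (sub_alg A D) (sub_grading \<Gamma> D)"
begin

lemma unital_D: "unital_subalgebra A D"
  using graded_D by (simp add: graded_subalgebra_def)

lemmas D_closed = unital_subalgebraD[OF unital_D]

lemma D_carrier [simp]: "x \<in> D \<Longrightarrow> x \<in> carrier A"
  using D_closed(2) by blast

lemma comp_D: "x \<in> D \<Longrightarrow> g \<in> carrier G \<Longrightarrow> comp x g \<in> D"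
  using graded_D graded_space_iff[OF D_closed(1)] by (simp add: graded_subalgebra_def)

definition T :: "'g set" where
  "T = grading_support G (sub_alg A D) (sub_grading \<Gamma> D)"

lemma T_def': "T = {g \<in> carrier G. D \<inter> \<Gamma> g \<noteq> {\<zero>}}"
  by (simp add: T_def grading_support_def)

lemma T_carrier [simp]: "t \<in> T \<Longrightarrow> t \<in> carrier G"
  by (simp add: T_def')

lemma finite_T: "finite T"
  using finite_G by (rule rev_finite_subset) auto

lemma T_memI: "x \<in> D \<Longrightarrow> x \<in> \<Gamma> g \<Longrightarrow> g \<in> carrier G \<Longrightarrow> x \<noteq> \<zero> \<Longrightarrow> g \<in> T"
  by (auto simp: T_def' simp del: T_carrier)

lemma matrix_D: "\<exists>p h. p > 0 \<and> matrix_subalgebra A D p h"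
proof -
  obtain p h where "p > 0" "h \<in> alg_iso (module_mat TYPE('f) p p) (sub_alg A D)"
    using fine_D by (auto simp: fine_grading_def is_matrix_algebra_def)
  then have "matrix_subalgebra A D p h"
    using unital_D assoc_algebra_axioms
    by (intro matrix_subalgebra.intro matrix_subalgebra_axioms.intro)
  then show ?thesis using \<open>p > 0\<close> by blast
qed

text \<open>The component is the image of \<open>D\<close> under the linear projection to degree
  \<open>t\<close>, hence finite-dimensional, and dimension one supplies a generator. It is nonzero
  because \<open>t\<close> lies in the support.\<close>

lemma ex_X:
  assumes t: "t \<in> T"
  shows "\<exists>x. x \<in> D \<and> x \<in> \<Gamma> t \<and> x \<noteq> \<zero> \<and> (\<forall>y\<in>D \<inter> \<Gamma> t. \<exists>c. y = c \<odot> x)"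
proof -
  have tG: "t \<in> carrier G" using t by simp
  have V: "subspace class_ring (D \<inter> \<Gamma> t) A"
    using subspace_inter[OF D_closed(1) subspace_hom[OF tG]] .
  interpret V: vectorspace class_ring "sub_alg A (D \<inter> \<Gamma> t)"
    using subspace_is_vs[OF V] .
  obtain p h where "matrix_subalgebra A D p h" using matrix_D by blast
  then interpret D: matrix_subalgebra A D p h .
  have "V.fin_dim"
  proof (rule D.fin_dim_linear_image[OF V])
    show "D \<inter> \<Gamma> t \<subseteq> (\<lambda>x. comp x t) ` D"
      using comp_of_hom tG by (force simp: image_iff)
  qed (use tG comp_D comp_hom comp_add comp_scal in auto)
  moreover have "V.dim = 1"
    using fine_D t by (auto simp: fine_grading_def T_def)
  ultimately obtain x where x: "x \<in> D \<inter> \<Gamma> t"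
    and gen: "\<forall>y\<in>D \<inter> \<Gamma> t. \<exists>c. y = c \<odot> x"
    using V.dim_one_iff_line by auto
  have "x \<noteq> \<zero>"
    using gen t hom_zero[OF tG] D_closed(4) by (auto simp: T_def' simp del: T_carrier)
  then show ?thesis using x gen by blast
qed

definition X :: "'g \<Rightarrow> 'a" where
  "X t = (SOME x. x \<in> D \<and> x \<in> \<Gamma> t \<and> x \<noteq> \<zero> \<and> (\<forall>y\<in>D \<inter> \<Gamma> t. \<exists>c. y = c \<odot> x))"

lemma
  assumes "t \<in> T"
  shows X_D [simp]: "X t \<in> D" and X_hom [simp]: "X t \<in> \<Gamma> t" and X_nonzero: "X t \<noteq> \<zero>"
    and X_line: "y \<in> D \<Longrightarrow> y \<in> \<Gamma> t \<Longrightarrow> \<exists>c. y = c \<odot> X t"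
  using someI_ex[OF ex_X[OF assms]] unfolding X_def[symmetric] by auto

lemma X_carrier [simp]: "t \<in> T \<Longrightarrow> X t \<in> carrier A"
  by simp

lemma one_nonzero: "\<one> \<noteq> \<zero>"
proof
  assume "\<one> = \<zero>"
  obtain p h where ph: "p > 0" "matrix_subalgebra A D p h" using matrix_D by blast
  then interpret D: matrix_subalgebra A D p h by simp
  have "h (1\<^sub>m p) = h (0\<^sub>m p p)" using \<open>\<one> = \<zero>\<close> by (simp add: D.h_one D.h_zero)
  then have "(1\<^sub>m p :: 'f mat) = 0\<^sub>m p p" by (intro D.h_inj) auto
  \<comment> \<open>Positivity of the matrix size provides an entry in which the two matrices
    differ.\<close>
  then have "(1\<^sub>m p :: 'f mat) $$ (0, 0) = 0\<^sub>m p p $$ (0, 0)" by simp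
  then show False using ph(1) by simp
qed

lemma one_T [simp]: "\<one>\<^bsub>G\<^esub> \<in> T"
  using one_hom D_closed(3) one_nonzero by (intro T_memI[of \<one>]) auto

lemma D_one: "x \<in> D \<Longrightarrow> x \<in> \<Gamma> \<one>\<^bsub>G\<^esub> \<Longrightarrow> \<exists>c. x = c \<odot> \<one>"
proof -
  assume x: "x \<in> D" "x \<in> \<Gamma> \<one>\<^bsub>G\<^esub>"
  obtain c where c: "x = c \<odot> X \<one>\<^bsub>G\<^esub>" using X_line[OF one_T x] by blast
  obtain d where d: "\<one> = d \<odot> X \<one>\<^bsub>G\<^esub>" using X_line[OF one_T D_closed(3) one_hom] by blast
  have "d \<noteq> 0" using d one_nonzero by auto
  then have "x = (c / d) \<odot> \<one>" unfolding c d by (simp add: scal_scal)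
  then show ?thesis by blast
qed

text \<open>Simplicity of \<open>D\<close> writes the identity as a sum of terms
  \<open>a \<otimes> X t \<otimes> b\<close>. Passing to degree 1 and to homogeneous factors leaves
  one nonzero product around \<open>X t\<close>, which is a scalar because the degree 1 part of
  \<open>D\<close> is a line. One-sided inverses in a matrix algebra do the rest.\<close>

lemma X_inverse:
  assumes t: "t \<in> T"
  shows "\<exists>y\<in>D. y \<otimes> X t = \<one> \<and> X t \<otimes> y = \<one>"
proof -
  obtain p h where "matrix_subalgebra A D p h" using matrix_D by blast
  then interpret D: matrix_subalgebra A D p h .
  have tG: "t \<in> carrier G" and x: "X t \<in> D" "X t \<in> \<Gamma> t" "X t \<in> carrier A" using t by auto
  obtain a b where a: "a \<in> {..<p} \<rightarrow> D" and b: "b \<in> {..<p} \<rightarrow> D"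
    and ab: "(\<Oplus>i\<in>{..<p}. a i \<otimes> X t \<otimes> b i) = \<one>"
    using D.sandwich_eq_one[OF x(1) X_nonzero[OF t]] by blast
  \<comment> \<open>If every such component vanished, so would the identity, being homogeneous of
    degree 1.\<close>
  have "\<exists>u\<in>D. \<exists>v\<in>D. comp (u \<otimes> X t \<otimes> v) \<one>\<^bsub>G\<^esub> \<noteq> \<zero>"
  proof (rule ccontr)
    assume neg: "\<not> ?thesis"
    have ab': "(\<lambda>i. a i \<otimes> X t \<otimes> b i) \<in> {..<p} \<rightarrow> carrier A"
      using a b x by (auto simp: Pi_iff)
    have "\<one> = comp (\<Oplus>i\<in>{..<p}. a i \<otimes> X t \<otimes> b i) \<one>\<^bsub>G\<^esub>"
      using comp_of_hom[OF one_hom] by (simp add: ab)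
    also have "\<dots> = (\<Oplus>i\<in>{..<p}. comp (a i \<otimes> X t \<otimes> b i) \<one>\<^bsub>G\<^esub>)"
      using ab' by (simp add: comp_finsum)
    also have "\<dots> = (\<Oplus>i\<in>{..<p}. \<zero>)"
      using neg a b by (intro M.finsum_cong') (auto simp: Pi_iff)
    finally show False using one_nonzero by simp
  qed
  then obtain u v where u: "u \<in> D" and v: "v \<in> D"
    and uv: "comp (u \<otimes> X t \<otimes> v) \<one>\<^bsub>G\<^esub> \<noteq> \<zero>" by blast
  define v' where "v' = comp v"
  have v': "v' g \<in> D" "v' g \<in> \<Gamma> g" "v' g \<in> carrier A" if "g \<in> carrier G" for g
    using that v comp_D comp_hom by (auto simp: v'_def)
  \<comment> \<open>The same contradiction, now expanding \<open>v\<close>, replaces the right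
    factor by one of its components.\<close>
  have "\<exists>g\<in>carrier G. comp (u \<otimes> X t \<otimes> v' g) \<one>\<^bsub>G\<^esub> \<noteq> \<zero>"
  proof (rule ccontr)
    assume neg: "\<not> ?thesis"
    have "u \<otimes> X t \<otimes> v = u \<otimes> X t \<otimes> (\<Oplus>g\<in>carrier G. v' g)"
      using v by (simp add: v'_def sum_comp)
    also have "\<dots> = (\<Oplus>g\<in>carrier G. u \<otimes> X t \<otimes> v' g)"
      using u v' x finite_G by (intro A.finsum_rdistr) auto
    finally have "comp (u \<otimes> X t \<otimes> v) \<one>\<^bsub>G\<^esub> = (\<Oplus>g\<in>carrier G. comp (u \<otimes> X t \<otimes> v' g) \<one>\<^bsub>G\<^esub>)"
      using u v' x by (simp add: comp_finsum Pi_iff)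
    also have "\<dots> = (\<Oplus>g\<in>carrier G. \<zero>)"
      using neg by (intro M.finsum_cong') auto
    finally show False using uv by simp
  qed
  then obtain g where g: "g \<in> carrier G" and nz: "comp (u \<otimes> X t \<otimes> v' g) \<one>\<^bsub>G\<^esub> \<noteq> \<zero>" by blast
  \<comment> \<open>Once the right part is homogeneous of degree \<open>t g\<close>, only the
    component of \<open>u\<close> in the inverse degree contributes to degree 1.\<close>
  let ?k = "inv\<^bsub>G\<^esub> (t \<otimes>\<^bsub>G\<^esub> g)"
  define u' where "u' = comp u ?k"
  have u': "u' \<in> D" "u' \<in> carrier A" using u comp_D tG g by (auto simp: u'_def)
  have xv: "X t \<otimes> v' g \<in> \<Gamma> (t \<otimes>\<^bsub>G\<^esub> g)"
    using graded_mult tG g x v' by blast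
  have "comp (u \<otimes> (X t \<otimes> v' g)) (?k \<otimes>\<^bsub>G\<^esub> (t \<otimes>\<^bsub>G\<^esub> g)) = u' \<otimes> (X t \<otimes> v' g)"
    unfolding u'_def using u tG g xv by (intro comp_mult_right) auto
  then have eq: "comp (u \<otimes> X t \<otimes> v' g) \<one>\<^bsub>G\<^esub> = u' \<otimes> X t \<otimes> v' g"
    using u u' v' x tG g by (simp add: A.m_assoc)
  have "u' \<otimes> X t \<otimes> v' g \<in> \<Gamma> \<one>\<^bsub>G\<^esub>"
    unfolding eq[symmetric] using u v'[OF g] x by (intro comp_hom) auto
  moreover have "u' \<otimes> X t \<otimes> v' g \<in> D" using u' v'[OF g] x D_closed(5) by blast
  ultimately obtain c where c: "u' \<otimes> X t \<otimes> v' g = c \<odot> \<one>" using D_one by blast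
  have "c \<noteq> 0" using nz c eq by auto
  define w where "w = inverse c \<odot> v' g"
  have w: "w \<in> D" "w \<in> carrier A" using v'[OF g] D_closed(7) by (auto simp: w_def)
  have "(u' \<otimes> X t) \<otimes> w = \<one>"
    using c \<open>c \<noteq> 0\<close> u' v'[OF g] x by (simp add: w_def smult_mult_right scal_scal)
  \<comment> \<open>Inverses are switched from one side to the other twice: the first switch
    isolates \<open>X t\<close> on the right of \<open>w \<otimes> u'\<close>, the second makes that
    inverse two-sided.\<close>
  then have "w \<otimes> (u' \<otimes> X t) = \<one>"
    by (rule D.left_inverse_imp_right[rotated 2]) (intro D_closed(5) u' x w)+
  then have 1: "(w \<otimes> u') \<otimes> X t = \<one>" using u' x w by (simp add: A.m_assoc)
  then have "X t \<otimes> (w \<otimes> u') = \<one>"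
    by (rule D.left_inverse_imp_right[rotated 2]) (intro D_closed(5) u' x w)+
  then show ?thesis using 1 u' w D_closed(5) by blast
qed

lemma X_Units [simp]: "t \<in> T \<Longrightarrow> X t \<in> Units A"
  using X_inverse D_carrier by (fastforce simp: Units_def)

lemma inv_X_D [simp]: "t \<in> T \<Longrightarrow> inv X t \<in> D"
proof -
  assume t: "t \<in> T"
  then obtain y where y: "y \<in> D" "y \<otimes> X t = \<one>" "X t \<otimes> y = \<one>" using X_inverse by blast
  then have "inv X t = y" using t by (intro A.inv_char) auto
  then show ?thesis using y by simp
qed

lemma inv_X_hom [simp]: "t \<in> T \<Longrightarrow> inv X t \<in> \<Gamma> (inv\<^bsub>G\<^esub> t)"
  by (rule hom_inverse[of "X t"]) auto

lemma unit_mult_nonzero: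
  assumes "u \<in> Units A" "x \<in> carrier A" "u \<otimes> x = \<zero>"
  shows "x = \<zero>"
proof -
  have "inv u \<otimes> (u \<otimes> x) = x"
    using assms(1,2) A.Units_closed[OF assms(1)] by (simp flip: A.m_assoc)
  then show ?thesis using assms by simp
qed

text \<open>A unit times a nonzero element is nonzero, so the product of the two generators
  witnesses that the product degree lies in the support.\<close>

lemma T_mult [simp]: "s \<in> T \<Longrightarrow> t \<in> T \<Longrightarrow> s \<otimes>\<^bsub>G\<^esub> t \<in> T"
  using D_closed(5)[of "X s" "X t"] graded_mult[of s t "X s" "X t"]
    unit_mult_nonzero[of "X s" "X t"] X_nonzero
  by (intro T_memI[of "X s \<otimes> X t"]) auto

lemma T_inv [simp]: "t \<in> T \<Longrightarrow> inv\<^bsub>G\<^esub> t \<in> T"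
  using one_nonzero A.Units_r_inv[of "X t"]
  by (intro T_memI[of "inv X t"]) (auto simp del: A.Units_r_inv)

lemma X_mult:
  assumes "s \<in> T" "t \<in> T"
  shows "\<exists>c. c \<noteq> 0 \<and> X s \<otimes> X t = c \<odot> X (s \<otimes>\<^bsub>G\<^esub> t)"
proof -
  obtain c where c: "X s \<otimes> X t = c \<odot> X (s \<otimes>\<^bsub>G\<^esub> t)"
    using X_line[of "s \<otimes>\<^bsub>G\<^esub> t" "X s \<otimes> X t"] assms D_closed(5) graded_mult by auto
  moreover have "c \<noteq> 0"
    using c assms unit_mult_nonzero[of "X s" "X t"] X_nonzero by auto
  ultimately show ?thesis by blast
qed

text \<open>Every element is the sum of its components, and these are multiples of the generators.
  Since the scalar is part of the \<open>hom\<close> case, \<open>P\<close> need not be stable under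
  scaling, and \<open>P \<zero>\<close> is the case of scalar 0.\<close>

lemma D_induct [consumes 1, case_names add hom]:
  assumes d: "d \<in> D"
    and add: "\<And>x y. x \<in> D \<Longrightarrow> y \<in> D \<Longrightarrow> P x \<Longrightarrow> P y \<Longrightarrow> P (x \<oplus> y)"
    and hom: "\<And>c t. t \<in> T \<Longrightarrow> P (c \<odot> X t)"
  shows "P d"
proof -
  have P0: "P \<zero>" using hom[OF one_T, of 0] by simp
  have *: "P (comp d g)" if g: "g \<in> carrier G" for g
  proof (cases "comp d g = \<zero>")
    case False
    then have "g \<in> T" using d g comp_D comp_hom by (intro T_memI[of "comp d g"]) auto
    then show ?thesis using X_line[of g "comp d g"] d g comp_D comp_hom hom by auto
  qed (simp add: P0)
  have "P (finsum A (comp d) I) \<and> finsum A (comp d) I \<in> D" if "finite I" "I \<subseteq> carrier G" for I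
    using that
  proof (induct I rule: finite_induct)
    case (insert g I)
    then have "finsum A (comp d) (insert g I) = comp d g \<oplus> finsum A (comp d) I"
      using d by (intro M.finsum_insert) (auto simp: subset_eq)
    then show ?case using insert add[of "comp d g"] * comp_D[OF d] D_closed(6) by auto
  qed (simp add: P0 D_closed(4))
  then show ?thesis using sum_comp[of d] d finite_G by force
qed

end

section \<open>Functoriality of tensor products\<close>

lemma carrier_pair_algebra:
  "carrier (pair_algebra A B) = {u. finite {s. u s \<noteq> 0} \<and> {s. u s \<noteq> 0} \<subseteq> carrier A \<times> carrier B}"
  by (simp add: pair_algebra_def)

lemma pair_algebra_simps [simp]:
  "add (pair_algebra A B) = (\<lambda>u v s. u s + v s)"
  "zero (pair_algebra A B) = (\<lambda>s. 0)"
  "smult (pair_algebra A B) = (\<lambda>c u s. c * u s)"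
  by (simp_all add: pair_algebra_def)

lemma tensor_algebra_simps:
  "carrier (tensor_algebra A B) =
    (\<Union>u\<in>carrier (pair_algebra A B). {bilinearity_ideal A B +>\<^bsub>pair_algebra A B\<^esub> u})"
  "add (tensor_algebra A B) = set_add (pair_algebra A B)"
  "mult (tensor_algebra A B) = rcoset_mult (pair_algebra A B) (bilinearity_ideal A B)"
  "smult (tensor_algebra A B) = (\<lambda>c X. bilinearity_ideal A B <+>\<^bsub>pair_algebra A B\<^esub>
     ((\<lambda>u. c \<odot>\<^bsub>pair_algebra A B\<^esub> u) ` X))"
  by (simp_all add: tensor_algebra_def ring.defs module.defs FactRing_def A_RCOSETS_def'
      a_r_coset_def')

lemma pair_basis_carrier:
  "x \<in> carrier A \<Longrightarrow> y \<in> carrier B \<Longrightarrow> pair_basis x y \<in> carrier (pair_algebra A B)"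
  by (auto simp: pair_basis_def carrier_pair_algebra)

lemma pair_algebra_zero: "(\<lambda>s. 0) \<in> carrier (pair_algebra A B)"
  by (simp add: carrier_pair_algebra)

lemma pair_algebra_add_closed:
  fixes u v :: "'a \<times> 'b \<Rightarrow> 'f :: field"
  assumes "u \<in> carrier (pair_algebra A B)" "v \<in> carrier (pair_algebra A B)"
  shows "(\<lambda>s. u s + v s) \<in> carrier (pair_algebra A B)"
proof -
  have "{s. u s + v s \<noteq> 0} \<subseteq> {s. u s \<noteq> 0} \<union> {s. v s \<noteq> 0}" by auto
  then show ?thesis using assms unfolding carrier_pair_algebra by (auto intro: finite_subset)
qed

lemma pair_algebra_smult_closed:
  assumes "u \<in> carrier (pair_algebra A B)"
  shows "(\<lambda>s. c * u s) \<in> carrier (pair_algebra A B)"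
  using assms unfolding carrier_pair_algebra by (auto intro: rev_finite_subset)

lemma pair_algebra_module: "module class_ring (pair_algebra A B)"
proof (rule moduleI)
  show "cring (class_ring :: 'a ring)" by (rule class_cring.cring_axioms)
  show "abelian_group (pair_algebra A B)"
  proof (rule abelian_groupI)
    fix u assume u: "u \<in> carrier (pair_algebra A B)"
    show "\<exists>v\<in>carrier (pair_algebra A B). v \<oplus>\<^bsub>pair_algebra A B\<^esub> u = \<zero>\<^bsub>pair_algebra A B\<^esub>"
      using pair_algebra_smult_closed[OF u, of "-1"] by (intro bexI[of _ "\<lambda>s. -1 * u s"]) auto
  qed (use pair_algebra_add_closed pair_algebra_zero in \<open>auto simp: add.assoc add.commute\<close>)
qed (use pair_algebra_smult_closed in \<open>auto simp: algebra_simps\<close>)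

text \<open>Each of the four kinds of relation has the form \<open>v + c w - z\<close> with basis
  vectors or zero in place of \<open>v\<close>, \<open>w\<close>, \<open>z\<close>. The inclusion is
  what makes their span a submodule.\<close>

lemma bilinearity_relations_carrier:
  assumes "abelian_monoid A" "abelian_monoid B"
    and "\<And>c x. x \<in> carrier A \<Longrightarrow> c \<odot>\<^bsub>A\<^esub> x \<in> carrier A"
    and "\<And>c x. x \<in> carrier B \<Longrightarrow> c \<odot>\<^bsub>B\<^esub> x \<in> carrier B"
  shows "bilinearity_relations A B \<subseteq> carrier (pair_algebra A B)"
proof
  let ?P = "pair_algebra A B"
  fix u assume "u \<in> bilinearity_relations A B"
  then consider
    (add_left) x x' y where "x \<in> carrier A" "x' \<in> carrier A" "y \<in> carrier B"
      "u = (\<lambda>s. pair_basis (x \<oplus>\<^bsub>A\<^esub> x') y s - pair_basis x y s - pair_basis x' y s)"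
  | (add_right) x y y' where "x \<in> carrier A" "y \<in> carrier B" "y' \<in> carrier B"
      "u = (\<lambda>s. pair_basis x (y \<oplus>\<^bsub>B\<^esub> y') s - pair_basis x y s - pair_basis x y' s)"
  | (smult_left) c x y where "x \<in> carrier A" "y \<in> carrier B"
      "u = (\<lambda>s. pair_basis (c \<odot>\<^bsub>A\<^esub> x) y s - c * pair_basis x y s)"
  | (smult_right) c x y where "x \<in> carrier A" "y \<in> carrier B"
      "u = (\<lambda>s. pair_basis x (c \<odot>\<^bsub>B\<^esub> y) s - c * pair_basis x y s)"
    unfolding bilinearity_relations_def by blast
  then have "\<exists>v w c z. v \<in> carrier ?P \<and> w \<in> carrier ?P \<and> z \<in> carrier ?P \<and>
    u = (\<lambda>s. (v s + c * w s) + (- 1) * z s)"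
  proof cases
    case add_left
    then have "x \<oplus>\<^bsub>A\<^esub> x' \<in> carrier A" using assms(1) by (simp add: abelian_monoid.a_closed)
    with add_left show ?thesis
      by (intro exI[of _ "pair_basis (x \<oplus>\<^bsub>A\<^esub> x') y"] exI[of _ "pair_basis x y"]
          exI[of _ "pair_basis x' y"] exI[of _ "-1"]) (simp add: pair_basis_carrier)
  next
    case add_right
    then have "y \<oplus>\<^bsub>B\<^esub> y' \<in> carrier B" using assms(2) by (simp add: abelian_monoid.a_closed)
    with add_right show ?thesis
      by (intro exI[of _ "pair_basis x (y \<oplus>\<^bsub>B\<^esub> y')"] exI[of _ "pair_basis x y"]
          exI[of _ "pair_basis x y'"] exI[of _ "-1"]) (simp add: pair_basis_carrier)
  next
    case smult_left
    then show ?thesis using assms(3)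
      by (intro exI[of _ "pair_basis (c \<odot>\<^bsub>A\<^esub> x) y"] exI[of _ "pair_basis x y"]
          exI[of _ "\<lambda>s. 0"] exI[of _ "-c"])
        (use pair_algebra_zero in \<open>simp add: pair_basis_carrier\<close>)
  next
    case smult_right
    then show ?thesis using assms(4)
      by (intro exI[of _ "pair_basis x (c \<odot>\<^bsub>B\<^esub> y)"] exI[of _ "pair_basis x y"]
          exI[of _ "\<lambda>s. 0"] exI[of _ "-c"])
        (use pair_algebra_zero in \<open>simp add: pair_basis_carrier\<close>)
  qed
  then obtain v w c z where vwz: "v \<in> carrier ?P" "w \<in> carrier ?P" "z \<in> carrier ?P"
    and u: "u = (\<lambda>s. (v s + c * w s) + (- 1) * z s)" by blast
  show "u \<in> carrier ?P"
    unfolding u by (intro pair_algebra_add_closed pair_algebra_smult_closed vwz)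
qed

context
  fixes A :: "('f :: field, 'a) module" and B :: "('f, 'b) module"
  assumes abelian: "abelian_monoid A" "abelian_monoid B"
    and smult_cl: "\<And>c x. x \<in> carrier A \<Longrightarrow> c \<odot>\<^bsub>A\<^esub> x \<in> carrier A"
      "\<And>c x. x \<in> carrier B \<Longrightarrow> c \<odot>\<^bsub>B\<^esub> x \<in> carrier B"
begin

interpretation P: module class_ring "pair_algebra A B"
  by (rule pair_algebra_module)

lemma bilinearity_ideal_submodule:
  "submodule class_ring (bilinearity_ideal A B) (pair_algebra A B)"
  unfolding bilinearity_ideal_def
  by (intro P.span_is_submodule bilinearity_relations_carrier abelian smult_cl)

lemma
  shows bilinearity_ideal_zero: "(\<lambda>s. 0) \<in> bilinearity_ideal A B"
    and bilinearity_ideal_add: "u \<in> bilinearity_ideal A B \<Longrightarrow> v \<in> bilinearity_ideal A B \<Longrightarrow>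
      (\<lambda>s. u s + v s) \<in> bilinearity_ideal A B"
    and bilinearity_ideal_smult: "u \<in> bilinearity_ideal A B \<Longrightarrow>
      (\<lambda>s. c * u s) \<in> bilinearity_ideal A B"
  using bilinearity_ideal_submodule by (auto simp: submodule_def)

lemma coset_add:
  "(bilinearity_ideal A B +>\<^bsub>pair_algebra A B\<^esub> u) \<oplus>\<^bsub>tensor_algebra A B\<^esub>
   (bilinearity_ideal A B +>\<^bsub>pair_algebra A B\<^esub> v) =
   bilinearity_ideal A B +>\<^bsub>pair_algebra A B\<^esub> (\<lambda>s. u s + v s)"
  (is "?L = ?R")
proof
  show "?L \<subseteq> ?R"
  proof
    fix w assume "w \<in> ?L"
    then obtain i j where ij: "i \<in> bilinearity_ideal A B" "j \<in> bilinearity_ideal A B"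
      "w = (\<lambda>s. (i s + u s) + (j s + v s))"
      by (auto simp: tensor_algebra_simps set_add_def' a_r_coset_def')
    then have "w = (\<lambda>s. (i s + j s) + (u s + v s))" by (auto simp: algebra_simps)
    then show "w \<in> ?R"
      unfolding a_r_coset_def' using bilinearity_ideal_add[OF ij(1,2)]
      by (intro UN_I[of "\<lambda>s. i s + j s"]) simp_all
  qed
  show "?R \<subseteq> ?L"
  proof
    fix w assume "w \<in> ?R"
    then obtain i where i: "i \<in> bilinearity_ideal A B" "w = (\<lambda>s. i s + (u s + v s))"
      by (auto simp: a_r_coset_def')
    have "(\<lambda>s. i s + u s) \<in> bilinearity_ideal A B +>\<^bsub>pair_algebra A B\<^esub> u"
      unfolding a_r_coset_def' using i(1) by (intro UN_I[of i]) simp_all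
    moreover have "v \<in> bilinearity_ideal A B +>\<^bsub>pair_algebra A B\<^esub> v"
      unfolding a_r_coset_def' using bilinearity_ideal_zero by (intro UN_I[of "\<lambda>s. 0"]) simp_all
    moreover have "w = (\<lambda>s. (i s + u s) + v s)" using i(2) by (simp add: add.assoc)
    ultimately show "w \<in> ?L"
      unfolding tensor_algebra_simps set_add_def'
      by (intro UN_I[of "\<lambda>s. i s + u s"] UN_I[of v]) simp_all
  qed
qed

lemma coset_smult:
  "c \<odot>\<^bsub>tensor_algebra A B\<^esub> (bilinearity_ideal A B +>\<^bsub>pair_algebra A B\<^esub> u) =
   bilinearity_ideal A B +>\<^bsub>pair_algebra A B\<^esub> (\<lambda>s. c * u s)"
  (is "?L = ?R")
proof
  show "?L \<subseteq> ?R"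
  proof
    fix w assume "w \<in> ?L"
    then obtain i j where ij: "i \<in> bilinearity_ideal A B" "j \<in> bilinearity_ideal A B"
      "w = (\<lambda>s. i s + c * (j s + u s))"
      by (auto simp: tensor_algebra_simps set_add_def' a_r_coset_def')
    then have "w = (\<lambda>s. (i s + c * j s) + c * u s)" by (auto simp: algebra_simps)
    then show "w \<in> ?R"
      unfolding a_r_coset_def'
      using bilinearity_ideal_add[OF ij(1) bilinearity_ideal_smult[OF ij(2)]]
      by (intro UN_I[of "\<lambda>s. i s + c * j s"]) simp_all
  qed
  show "?R \<subseteq> ?L"
  proof
    fix w assume "w \<in> ?R"
    then obtain i where i: "i \<in> bilinearity_ideal A B" "w = (\<lambda>s. i s + c * u s)"
      by (auto simp: a_r_coset_def')
    have "u \<in> bilinearity_ideal A B +>\<^bsub>pair_algebra A B\<^esub> u"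
      unfolding a_r_coset_def' using bilinearity_ideal_zero by (intro UN_I[of "\<lambda>s. 0"]) simp_all
    then have "(\<lambda>s. c * u s) \<in> (\<lambda>u. c \<odot>\<^bsub>pair_algebra A B\<^esub> u) `
        (bilinearity_ideal A B +>\<^bsub>pair_algebra A B\<^esub> u)"
      by (rule rev_image_eqI) simp
    with i show "w \<in> ?L"
      unfolding tensor_algebra_simps set_add_def'
      by (intro UN_I[of i] UN_I[of "\<lambda>s. c * u s"]) simp_all
  qed
qed

lemma coset_carrier:
  "u \<in> carrier (pair_algebra A B) \<Longrightarrow>
    bilinearity_ideal A B +>\<^bsub>pair_algebra A B\<^esub> u \<in> carrier (tensor_algebra A B)"
  by (auto simp: tensor_algebra_simps)

text \<open>Pure tensors span: points are removed one at a time from the support of a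
  representative. With \<open>S\<close> cut out by a predicate, this becomes an induction principle
  over products.\<close>

lemma tensor_hom_image_subset:
  fixes E :: "('f, 'c) module"
  assumes \<mu>: "\<mu> \<in> alg_hom (tensor_algebra A B) E"
    and zero: "\<zero>\<^bsub>E\<^esub> \<in> S" "\<And>z. z \<in> carrier E \<Longrightarrow> 0 \<odot>\<^bsub>E\<^esub> z = \<zero>\<^bsub>E\<^esub>"
    and add: "\<And>x y. x \<in> S \<Longrightarrow> y \<in> S \<Longrightarrow> x \<oplus>\<^bsub>E\<^esub> y \<in> S"
    and smult: "\<And>c x. x \<in> S \<Longrightarrow> c \<odot>\<^bsub>E\<^esub> x \<in> S"
    and pure: "\<And>x y. x \<in> carrier A \<Longrightarrow> y \<in> carrier B \<Longrightarrow> \<mu> (pure_tensor A B x y) \<in> S"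
  shows "\<mu> ` carrier (tensor_algebra A B) \<subseteq> S"
proof -
  let ?P = "pair_algebra A B" and ?I = "bilinearity_ideal A B"
  note hom = alg_homD[OF \<mu>]
  have "\<mu> (?I +>\<^bsub>?P\<^esub> u) \<in> S" if "finite F" "u \<in> carrier ?P" "{s. u s \<noteq> 0} \<subseteq> F" for F u
    using that
  proof (induct F arbitrary: u rule: finite_induct)
    case empty
    \<comment> \<open>The representative is zero. Writing it as 0 times itself lets compatibility
      with scalars compute its image.\<close>
    then have u0: "u = (\<lambda>s. 0 * u s)" by auto
    have "\<mu> (?I +>\<^bsub>?P\<^esub> u) = 0 \<odot>\<^bsub>E\<^esub> \<mu> (?I +>\<^bsub>?P\<^esub> u)"
      using coset_smult[of 0 u] hom(4)[OF coset_carrier[OF empty(1)], of 0] u0 by simp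
    then show ?case using zero hom(1)[OF coset_carrier[OF empty(1)]] by simp
  next
    case (insert s F)
    show ?case
    proof (cases "u s = 0")
      case True
      then have "{t. u t \<noteq> 0} \<subseteq> F" using insert by auto
      then show ?thesis using insert by blast
    next
      case False
      obtain x y where s: "s = (x, y)" by (cases s)
      have xy: "x \<in> carrier A" "y \<in> carrier B"
        using False insert(4) by (auto simp: s carrier_pair_algebra)
      let ?v = "u(s := 0)"
      have v: "?v \<in> carrier ?P"
        using insert(4) by (auto simp: carrier_pair_algebra intro: rev_finite_subset)
      have vS: "\<mu> (?I +>\<^bsub>?P\<^esub> ?v) \<in> S" using insert(5) by (intro insert(3)[OF v]) auto
      have b: "pair_basis x y \<in> carrier ?P" using xy by (rule pair_basis_carrier)
      have sb: "(\<lambda>t. u s * pair_basis x y t) \<in> carrier ?P"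
        by (rule pair_algebra_smult_closed[OF b])
      have pS: "\<mu> (?I +>\<^bsub>?P\<^esub> (\<lambda>t. u s * pair_basis x y t)) \<in> S"
        using smult[OF pure[OF xy], of "u s"] hom(4)[OF coset_carrier[OF b], of "u s"]
          coset_smult[of "u s" "pair_basis x y"]
        by (simp add: pure_tensor_def)
      have "u = (\<lambda>t. ?v t + u s * pair_basis x y t)"
        by (auto simp: pair_basis_def s)
      then have "\<mu> (?I +>\<^bsub>?P\<^esub> u) = \<mu> (?I +>\<^bsub>?P\<^esub> ?v) \<oplus>\<^bsub>E\<^esub> \<mu> (?I +>\<^bsub>?P\<^esub> (\<lambda>t. u s * pair_basis x y t))"
        using hom(2)[OF coset_carrier[OF v] coset_carrier[OF sb]] coset_add by simp
      then show ?thesis using add[OF vS pS] by simp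
    qed
  qed
  then have "\<mu> (?I +>\<^bsub>?P\<^esub> u) \<in> S" if "u \<in> carrier ?P" for u
    using that by (auto simp: carrier_pair_algebra)
  then show ?thesis
    by (auto simp: tensor_algebra_simps)
qed

end

text \<open>
  Transport of a tensor product along a bijection \<open>\<alpha>\<close> of the whole type, so that the
  reindexing map on functions is itself a bijection.
\<close>

locale tensor_transport =
  fixes A A' :: "('f :: field, 'a) module" and B B' :: "('f, 'a) module"
    and \<alpha> :: "'a \<Rightarrow> 'a"
  assumes bij: "bij \<alpha>"
    and isoA: "\<alpha> \<in> alg_iso A A'" and isoB: "\<alpha> \<in> alg_iso B B'"
    and cl: "abelian_monoid A" "abelian_monoid B" "abelian_monoid A'" "abelian_monoid B'"
      "\<And>c x. x \<in> carrier A \<Longrightarrow> c \<odot>\<^bsub>A\<^esub> x \<in> carrier A"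
      "\<And>c x. x \<in> carrier B \<Longrightarrow> c \<odot>\<^bsub>B\<^esub> x \<in> carrier B"
      "\<And>c x. x \<in> carrier A' \<Longrightarrow> c \<odot>\<^bsub>A'\<^esub> x \<in> carrier A'"
      "\<And>c x. x \<in> carrier B' \<Longrightarrow> c \<odot>\<^bsub>B'\<^esub> x \<in> carrier B'"
    and mult_cl: "\<And>x y. x \<in> carrier A \<Longrightarrow> y \<in> carrier A \<Longrightarrow> x \<otimes>\<^bsub>A\<^esub> y \<in> carrier A"
      "\<And>x y. x \<in> carrier B \<Longrightarrow> y \<in> carrier B \<Longrightarrow> x \<otimes>\<^bsub>B\<^esub> y \<in> carrier B"
begin

abbreviation "P \<equiv> pair_algebra A B"
abbreviation "P' \<equiv> pair_algebra A' B'"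
abbreviation "I \<equiv> bilinearity_ideal A B"
abbreviation "I' \<equiv> bilinearity_ideal A' B'"

definition \<tau> :: "'a \<times> 'a \<Rightarrow> 'a \<times> 'a" where "\<tau> = map_prod \<alpha> \<alpha>"
text \<open>Pullback runs backwards, from functions on the primed pairs to functions on the unprimed
  ones. It sends the basis vector at \<open>\<tau> s\<close> to the one at \<open>s\<close>, so the
  computations with products and relations involve no inverse of \<alpha>.\<close>

definition r :: "('a \<times> 'a \<Rightarrow> 'f) \<Rightarrow> ('a \<times> 'a \<Rightarrow> 'f)" where "r u = (\<lambda>s. u (\<tau> s))"

lemma \<tau>_bij: "bij \<tau>"
  unfolding \<tau>_def using bij by (simp add: bij_def map_prod_surj prod.inj_map)

lemma r_surj: "\<exists>u. r u = v"
  by (rule exI[of _ "\<lambda>s. v (inv_into UNIV \<tau> s)"]) (simp add: r_def bij_is_inj[OF \<tau>_bij] inv_f_f)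

lemma r_inj: "r u = r v \<Longrightarrow> u = v"
proof
  fix s assume eq: "r u = r v"
  obtain s' where "s = \<tau> s'" using bij_is_surj[OF \<tau>_bij] by blast
  then show "u s = v s" using fun_cong[OF eq, of s'] by (simp add: r_def)
qed

lemma \<alpha>_mem: "\<alpha> x \<in> carrier A' \<longleftrightarrow> x \<in> carrier A" "\<alpha> x \<in> carrier B' \<longleftrightarrow> x \<in> carrier B"
proof -
  have "carrier A' = \<alpha> ` carrier A" "carrier B' = \<alpha> ` carrier B"
    using alg_iso_imp_bij[OF isoA] alg_iso_imp_bij[OF isoB] by (auto simp: bij_betw_def)
  then show "\<alpha> x \<in> carrier A' \<longleftrightarrow> x \<in> carrier A" "\<alpha> x \<in> carrier B' \<longleftrightarrow> x \<in> carrier B"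
    by (simp_all add: inj_image_mem_iff[OF bij_is_inj[OF bij]])
qed

lemmas homA = alg_homD[OF alg_iso_imp_hom[OF isoA]]
  and homB = alg_homD[OF alg_iso_imp_hom[OF isoB]]

lemma \<alpha>_eq [simp]: "\<alpha> x = \<alpha> y \<longleftrightarrow> x = y"
  using bij_is_inj[OF bij] by (auto simp: inj_eq)

lemma r_support: "{s. u s \<noteq> 0} = \<tau> ` {s. r u s \<noteq> 0}"
proof
  show "{s. u s \<noteq> 0} \<subseteq> \<tau> ` {s. r u s \<noteq> 0}"
  proof
    fix s assume s: "s \<in> {s. u s \<noteq> 0}"
    obtain s' where "s = \<tau> s'" using bij_is_surj[OF \<tau>_bij] by blast
    then show "s \<in> \<tau> ` {s. r u s \<noteq> 0}" using s by (auto simp: r_def)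
  qed
qed (auto simp: r_def)

lemma r_carrier: "r u \<in> carrier P \<longleftrightarrow> u \<in> carrier P'"
proof -
  have "finite {s. r u s \<noteq> 0} \<longleftrightarrow> finite {s. u s \<noteq> 0}"
    unfolding r_support[of u] using bij_is_inj[OF \<tau>_bij]
    by (simp add: finite_image_iff inj_on_subset)
  moreover have "{s. r u s \<noteq> 0} \<subseteq> carrier A \<times> carrier B \<longleftrightarrow> {s. u s \<noteq> 0} \<subseteq> carrier A' \<times> carrier B'"
    unfolding r_support[of u] by (auto simp: \<tau>_def \<alpha>_mem map_prod_def split: prod.splits)
  ultimately show ?thesis by (simp add: carrier_pair_algebra)
qed

lemma r_pair_basis [simp]: "r (pair_basis (\<alpha> x) (\<alpha> y)) = pair_basis x y"
  by (auto simp: r_def pair_basis_def \<tau>_def)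

text \<open>Both sums are reindexed along \<open>\<tau>\<close>. The supports lie in the carriers,
  where \<alpha> is multiplicative, so basis vectors of products pull back to basis vectors of
  products.\<close>

lemma r_mult:
  assumes "u \<in> carrier P'" "v \<in> carrier P'"
  shows "r (u \<otimes>\<^bsub>P'\<^esub> v) = r u \<otimes>\<^bsub>P\<^esub> r v"
proof
  fix s
  have inj: "inj_on \<tau> X" for X using bij_is_inj[OF \<tau>_bij] by (rule inj_on_subset) simp
  have "r (u \<otimes>\<^bsub>P'\<^esub> v) s = (\<Sum>p\<in>\<tau> ` {s. r u s \<noteq> 0}. \<Sum>q\<in>\<tau> ` {s. r v s \<noteq> 0}.
      u p * v q * pair_basis (fst p \<otimes>\<^bsub>A'\<^esub> fst q) (snd p \<otimes>\<^bsub>B'\<^esub> snd q) (\<tau> s))"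
    unfolding r_support[of u, symmetric] r_support[of v, symmetric] r_def[of "u \<otimes>\<^bsub>P'\<^esub> v"]
    by (simp add: pair_algebra_def)
  also have "\<dots> = (\<Sum>p | r u p \<noteq> 0. \<Sum>q | r v q \<noteq> 0. u (\<tau> p) * v (\<tau> q) *
      pair_basis (fst (\<tau> p) \<otimes>\<^bsub>A'\<^esub> fst (\<tau> q)) (snd (\<tau> p) \<otimes>\<^bsub>B'\<^esub> snd (\<tau> q)) (\<tau> s))"
    by (simp add: sum.reindex inj)
  also have "\<dots> = (\<Sum>p | r u p \<noteq> 0. \<Sum>q | r v q \<noteq> 0. r u p * r v q *
      pair_basis (fst p \<otimes>\<^bsub>A\<^esub> fst q) (snd p \<otimes>\<^bsub>B\<^esub> snd q) s)"
  proof (intro sum.cong refl)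
    fix p q assume pq: "p \<in> {p. r u p \<noteq> 0}" "q \<in> {q. r v q \<noteq> 0}"
    have uP: "r u \<in> carrier P" and vP: "r v \<in> carrier P" using assms r_carrier by blast+
    obtain a b where p: "p = (a, b)" by (cases p)
    obtain c d where q: "q = (c, d)" by (cases q)
    have mem: "a \<in> carrier A" "b \<in> carrier B" "c \<in> carrier A" "d \<in> carrier B"
      using uP vP pq by (auto simp: p q carrier_pair_algebra)
    have "pair_basis (fst (\<tau> p) \<otimes>\<^bsub>A'\<^esub> fst (\<tau> q)) (snd (\<tau> p) \<otimes>\<^bsub>B'\<^esub> snd (\<tau> q)) (\<tau> s) =
        (r (pair_basis (\<alpha> (a \<otimes>\<^bsub>A\<^esub> c)) (\<alpha> (b \<otimes>\<^bsub>B\<^esub> d))) s :: 'f)"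
      using mem by (simp add: r_def p q \<tau>_def homA homB)
    also have "\<dots> = pair_basis (a \<otimes>\<^bsub>A\<^esub> c) (b \<otimes>\<^bsub>B\<^esub> d) s" by simp
    finally show "u (\<tau> p) * v (\<tau> q) *
      pair_basis (fst (\<tau> p) \<otimes>\<^bsub>A'\<^esub> fst (\<tau> q)) (snd (\<tau> p) \<otimes>\<^bsub>B'\<^esub> snd (\<tau> q)) (\<tau> s) =
      r u p * r v q * pair_basis (fst p \<otimes>\<^bsub>A\<^esub> fst q) (snd p \<otimes>\<^bsub>B\<^esub> snd q) s"
      by (simp add: r_def p q)
  qed
  also have "\<dots> = (r u \<otimes>\<^bsub>P\<^esub> r v) s" by (simp add: pair_algebra_def)
  finally show "r (u \<otimes>\<^bsub>P'\<^esub> v) s = (r u \<otimes>\<^bsub>P\<^esub> r v) s" .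
qed

text \<open>Relations of each kind correspond to relations of the same kind, because \<alpha> is
  linear on both factors and every element of a primed carrier has the form
  \<open>\<alpha> x\<close>.\<close>

lemma r_relations: "r ` bilinearity_relations A' B' = bilinearity_relations A B"
proof -
  have lin: "r (\<lambda>s. u s - v s - w s) = (\<lambda>s. r u s - r v s - r w s)"
    "r (\<lambda>s. u s - c * v s) = (\<lambda>s. r u s - c * r v s)" for u v w c
    by (auto simp: r_def)
  have A': "carrier A' = \<alpha> ` carrier A" and B': "carrier B' = \<alpha> ` carrier B"
    using alg_iso_imp_bij[OF isoA] alg_iso_imp_bij[OF isoB] by (auto simp: bij_betw_def)
  have 1: "r (\<lambda>s. pair_basis (\<alpha> x \<oplus>\<^bsub>A'\<^esub> \<alpha> x') (\<alpha> y) s - pair_basis (\<alpha> x) (\<alpha> y) s - pair_basis (\<alpha> x') (\<alpha> y) s) =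
    (\<lambda>s. pair_basis (x \<oplus>\<^bsub>A\<^esub> x') y s - pair_basis x y s - pair_basis x' y s)"
    if "x \<in> carrier A" "x' \<in> carrier A" for x x' y
    unfolding lin using that by (simp flip: homA(2))
  have 2: "r (\<lambda>s. pair_basis (\<alpha> x) (\<alpha> y \<oplus>\<^bsub>B'\<^esub> \<alpha> y') s - pair_basis (\<alpha> x) (\<alpha> y) s - pair_basis (\<alpha> x) (\<alpha> y') s) =
    (\<lambda>s. pair_basis x (y \<oplus>\<^bsub>B\<^esub> y') s - pair_basis x y s - pair_basis x y' s)"
    if "y \<in> carrier B" "y' \<in> carrier B" for x y y'
    unfolding lin using that by (simp flip: homB(2))
  have 3: "r (\<lambda>s. pair_basis (c \<odot>\<^bsub>A'\<^esub> \<alpha> x) (\<alpha> y) s - c * pair_basis (\<alpha> x) (\<alpha> y) s) =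
    (\<lambda>s. pair_basis (c \<odot>\<^bsub>A\<^esub> x) y s - c * pair_basis x y s)"
    if "x \<in> carrier A" for c x y
    unfolding lin using that by (simp flip: homA(4))
  have 4: "r (\<lambda>s. pair_basis (\<alpha> x) (c \<odot>\<^bsub>B'\<^esub> \<alpha> y) s - c * pair_basis (\<alpha> x) (\<alpha> y) s) =
    (\<lambda>s. pair_basis x (c \<odot>\<^bsub>B\<^esub> y) s - c * pair_basis x y s)"
    if "y \<in> carrier B" for c x y
    unfolding lin using that by (simp flip: homB(4))
  show ?thesis
  proof
    show "r ` bilinearity_relations A' B' \<subseteq> bilinearity_relations A B"
    proof
      fix w assume "w \<in> r ` bilinearity_relations A' B'"
      then obtain u where u: "u \<in> bilinearity_relations A' B'" "w = r u" by blast
      from u(1) consider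
        (a) x x' y where "x \<in> carrier A" "x' \<in> carrier A" "y \<in> carrier B"
          "u = (\<lambda>s. pair_basis (\<alpha> x \<oplus>\<^bsub>A'\<^esub> \<alpha> x') (\<alpha> y) s - pair_basis (\<alpha> x) (\<alpha> y) s - pair_basis (\<alpha> x') (\<alpha> y) s)"
      | (b) x y y' where "x \<in> carrier A" "y \<in> carrier B" "y' \<in> carrier B"
          "u = (\<lambda>s. pair_basis (\<alpha> x) (\<alpha> y \<oplus>\<^bsub>B'\<^esub> \<alpha> y') s - pair_basis (\<alpha> x) (\<alpha> y) s - pair_basis (\<alpha> x) (\<alpha> y') s)"
      | (c) c x y where "x \<in> carrier A" "y \<in> carrier B"
          "u = (\<lambda>s. pair_basis (c \<odot>\<^bsub>A'\<^esub> \<alpha> x) (\<alpha> y) s - c * pair_basis (\<alpha> x) (\<alpha> y) s)"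
      | (d) c x y where "x \<in> carrier A" "y \<in> carrier B"
          "u = (\<lambda>s. pair_basis (\<alpha> x) (c \<odot>\<^bsub>B'\<^esub> \<alpha> y) s - c * pair_basis (\<alpha> x) (\<alpha> y) s)"
        unfolding bilinearity_relations_def A' B' by blast
      then show "w \<in> bilinearity_relations A B"
      proof cases
        case a
        then show ?thesis unfolding u(2) a(4) 1[OF a(1,2)] bilinearity_relations_def by blast
      next
        case b
        then show ?thesis unfolding u(2) b(4) 2[OF b(2,3)] bilinearity_relations_def by blast
      next
        case c
        then show ?thesis unfolding u(2) c(3) 3[OF c(1)] bilinearity_relations_def by blast
      next
        case d
        then show ?thesis unfolding u(2) d(3) 4[OF d(2)] bilinearity_relations_def by blast
      qed
    qed
    show "bilinearity_relations A B \<subseteq> r ` bilinearity_relations A' B'"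
    proof
      fix w assume "w \<in> bilinearity_relations A B"
      then consider
        (a) x x' y where "x \<in> carrier A" "x' \<in> carrier A" "y \<in> carrier B"
          "w = (\<lambda>s. pair_basis (x \<oplus>\<^bsub>A\<^esub> x') y s - pair_basis x y s - pair_basis x' y s)"
      | (b) x y y' where "x \<in> carrier A" "y \<in> carrier B" "y' \<in> carrier B"
          "w = (\<lambda>s. pair_basis x (y \<oplus>\<^bsub>B\<^esub> y') s - pair_basis x y s - pair_basis x y' s)"
      | (c) c x y where "x \<in> carrier A" "y \<in> carrier B"
          "w = (\<lambda>s. pair_basis (c \<odot>\<^bsub>A\<^esub> x) y s - c * pair_basis x y s)"
      | (d) c x y where "x \<in> carrier A" "y \<in> carrier B"
          "w = (\<lambda>s. pair_basis x (c \<odot>\<^bsub>B\<^esub> y) s - c * pair_basis x y s)"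
        unfolding bilinearity_relations_def by blast
      then show "w \<in> r ` bilinearity_relations A' B'"
      proof cases
        case a
        show ?thesis unfolding a(4) 1[OF a(1,2), symmetric] bilinearity_relations_def
          using homA(1) homB(1) a by (intro imageI) blast
      next
        case b
        show ?thesis unfolding b(4) 2[OF b(2,3), symmetric] bilinearity_relations_def
          using homA(1) homB(1) b by (intro imageI) blast
      next
        case c
        show ?thesis unfolding c(3) 3[OF c(1), symmetric] bilinearity_relations_def
          using homA(1) homB(1) c by (intro imageI) blast
      next
        case d
        show ?thesis unfolding d(3) 4[OF d(2), symmetric] bilinearity_relations_def
          using homA(1) homB(1) d by (intro imageI) blast
      qed
    qed
  qed
qed

text \<open>Minimality of a span is used twice: the preimage of \<open>I\<close> and the image of
  \<open>I'\<close> are submodules containing the respective relations.\<close>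

lemma r_ideal: "r ` I' = I"
proof
  interpret P: module class_ring P by (rule pair_algebra_module)
  interpret P': module class_ring P' by (rule pair_algebra_module)
  have sI: "submodule class_ring I P"
    by (rule bilinearity_ideal_submodule[OF cl(1,2,5,6)])
  have sI': "submodule class_ring I' P'"
    by (rule bilinearity_ideal_submodule[OF cl(3,4,7,8)])
  have rel: "bilinearity_relations A B \<subseteq> I" "bilinearity_relations A' B' \<subseteq> I'"
    unfolding bilinearity_ideal_def
    by (intro P.in_own_span P'.in_own_span bilinearity_relations_carrier cl; assumption)+
  have "submodule class_ring {u \<in> carrier P'. r u \<in> I} P'"
    using sI P'.module_axioms pair_algebra_add_closed[of _ A' B'] pair_algebra_smult_closed[of _ A' B']
      pair_algebra_zero[of A' B']
    by (auto simp: submodule_def r_def)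
  then have "I' \<subseteq> {u \<in> carrier P'. r u \<in> I}"
    unfolding bilinearity_ideal_def[of A' B']
    using rel(1) r_relations bilinearity_relations_carrier[OF cl(3,4,7,8)]
    by (intro P'.span_is_subset) auto
  then show "r ` I' \<subseteq> I" by blast
  have "submodule class_ring (r ` I') P"
    unfolding submodule_def
  proof (intro conjI allI impI)
    show "module class_ring P" by (rule pair_algebra_module)
    show "r ` I' \<subseteq> carrier P"
      using \<open>r ` I' \<subseteq> I\<close> sI by (auto simp: submodule_def)
    show "\<zero>\<^bsub>P\<^esub> \<in> r ` I'"
      using bilinearity_ideal_zero[OF cl(3,4,7,8)] by (force simp: r_def image_iff)
  next
    fix v w assume "v \<in> r ` I'" "w \<in> r ` I'"
    then obtain a b where ab: "a \<in> I'" "b \<in> I'" "v = r a" "w = r b" by blast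
    have "r (\<lambda>s. a s + b s) \<in> r ` I'"
      using bilinearity_ideal_add[OF cl(3,4,7,8) ab(1,2)] by (rule imageI)
    then show "v \<oplus>\<^bsub>P\<^esub> w \<in> r ` I'" by (simp add: ab r_def)
  next
    fix c v assume "v \<in> r ` I'"
    then obtain a where a: "a \<in> I'" "v = r a" by blast
    have "r (\<lambda>s. c * a s) \<in> r ` I'"
      using bilinearity_ideal_smult[OF cl(3,4,7,8) a(1)] by (rule imageI)
    then show "c \<odot>\<^bsub>P\<^esub> v \<in> r ` I'" by (simp add: a r_def)
  qed
  then show "I \<subseteq> r ` I'"
    unfolding bilinearity_ideal_def[of A B]
    using rel(2) by (intro P.span_is_subset) (auto simp flip: r_relations)
qed

lemma r_coset: "r ` (I' +>\<^bsub>P'\<^esub> u) = I +>\<^bsub>P\<^esub> r u"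
proof -
  have "r ` (I' +>\<^bsub>P'\<^esub> u) = (\<lambda>i s. i s + r u s) ` (r ` I')"
    by (auto simp: a_r_coset_def' r_def image_iff)
  then show ?thesis unfolding r_ideal by (auto simp: a_r_coset_def')
qed

lemma image_r_iso: "(`) r \<in> alg_iso (tensor_algebra A' B') (tensor_algebra A B)"
proof -
  have "(`) r \<in> alg_hom (tensor_algebra A' B') (tensor_algebra A B)"
  proof (rule alg_homI)
    fix X assume "X \<in> carrier (tensor_algebra A' B')"
    then obtain u where "u \<in> carrier P'" "X = I' +>\<^bsub>P'\<^esub> u"
      by (auto simp: tensor_algebra_simps)
    then have "r u \<in> carrier P" "r ` X = I +>\<^bsub>P\<^esub> r u"
      by (simp_all add: r_coset r_carrier)
    then show "r ` X \<in> carrier (tensor_algebra A B)"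
      by (auto simp: tensor_algebra_simps)
  next
    fix X Y assume XY: "X \<in> carrier (tensor_algebra A' B')" "Y \<in> carrier (tensor_algebra A' B')"
    show "r ` (X \<oplus>\<^bsub>tensor_algebra A' B'\<^esub> Y) = r ` X \<oplus>\<^bsub>tensor_algebra A B\<^esub> r ` Y"
      by (auto simp: tensor_algebra_simps set_add_def' image_iff r_def) blast+
    \<comment> \<open>\<open>r_mult\<close> speaks about elements of \<open>carrier P'\<close>, so
      the cosets must be known to lie there before their products are compared.\<close>
    have "X \<subseteq> carrier P'" "Y \<subseteq> carrier P'"
    proof -
      have I': "I' \<subseteq> carrier P'"
        using bilinearity_ideal_submodule[OF cl(3,4,7,8)] by (auto simp: submodule_def)
      have "I' +>\<^bsub>P'\<^esub> u \<subseteq> carrier P'" if "u \<in> carrier P'" for u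
        using I' that pair_algebra_add_closed[of _ A' B'] by (auto simp: a_r_coset_def' subset_eq)
      then show "X \<subseteq> carrier P'" "Y \<subseteq> carrier P'"
        using XY by (auto simp: tensor_algebra_simps)
    qed
    then have mem: "x \<in> carrier P'" if "x \<in> X \<or> x \<in> Y" for x using that by blast
    have "r ` (X \<otimes>\<^bsub>tensor_algebra A' B'\<^esub> Y) = (\<Union>a\<in>X. \<Union>b\<in>Y. r ` (I' +>\<^bsub>P'\<^esub> (a \<otimes>\<^bsub>P'\<^esub> b)))"
      by (simp add: tensor_algebra_simps rcoset_mult_def image_UN)
    also have "\<dots> = (\<Union>a\<in>X. \<Union>b\<in>Y. I +>\<^bsub>P\<^esub> (r a \<otimes>\<^bsub>P\<^esub> r b))"
      using mem by (simp add: r_coset r_mult)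
    also have "\<dots> = r ` X \<otimes>\<^bsub>tensor_algebra A B\<^esub> r ` Y"
      by (simp add: tensor_algebra_simps rcoset_mult_def)
    finally show "r ` (X \<otimes>\<^bsub>tensor_algebra A' B'\<^esub> Y) = r ` X \<otimes>\<^bsub>tensor_algebra A B\<^esub> r ` Y" .
  next
    fix c X
    have "r ` (c \<odot>\<^bsub>tensor_algebra A' B'\<^esub> X) = (\<Union>i\<in>I'. \<Union>x\<in>X. {\<lambda>s. r i s + c * r x s})"
      by (auto simp: tensor_algebra_simps set_add_def' image_iff r_def) blast+
    also have "\<dots> = (\<Union>i\<in>r ` I'. \<Union>x\<in>r ` X. {\<lambda>s. i s + c * x s})" by simp
    also have "\<dots> = c \<odot>\<^bsub>tensor_algebra A B\<^esub> r ` X"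
      unfolding r_ideal by (auto simp: tensor_algebra_simps set_add_def')
    finally show "r ` (c \<odot>\<^bsub>tensor_algebra A' B'\<^esub> X) = c \<odot>\<^bsub>tensor_algebra A B\<^esub> r ` X" .
  qed
  moreover have "bij_betw ((`) r) (carrier (tensor_algebra A' B')) (carrier (tensor_algebra A B))"
    unfolding bij_betw_def
  proof
    have "inj r" by (rule injI) (rule r_inj)
    then show "inj_on ((`) r) (carrier (tensor_algebra A' B'))"
      by (intro inj_onI) (simp add: inj_image_eq_iff)
    show "(`) r ` carrier (tensor_algebra A' B') = carrier (tensor_algebra A B)"
    proof
      show "carrier (tensor_algebra A B) \<subseteq> (`) r ` carrier (tensor_algebra A' B')"
      proof
        fix X assume "X \<in> carrier (tensor_algebra A B)"
        then obtain v where v: "v \<in> carrier P" "X = I +>\<^bsub>P\<^esub> v"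
          by (auto simp: tensor_algebra_simps)
        obtain u where "r u = v" using r_surj by blast
        then have "X = r ` (I' +>\<^bsub>P'\<^esub> u)" "u \<in> carrier P'"
          using v r_carrier r_coset by blast+
        then show "X \<in> (`) r ` carrier (tensor_algebra A' B')"
          by (auto simp: tensor_algebra_simps)
      qed
    qed (use alg_homD(1)[OF calculation] in blast)
  qed
  ultimately show ?thesis by (simp add: alg_iso_def)
qed

lemma image_r_pure_tensor: "r ` pure_tensor A' B' (\<alpha> x) (\<alpha> y) = pure_tensor A B x y"
  by (simp add: pure_tensor_def r_coset)

end

section \<open>The commutation form of a fine grading and centralizers\<close>

lemma (in assoc_algebra) finsum_swap:
  assumes "\<And>i j. i \<in> I \<Longrightarrow> j \<in> J \<Longrightarrow> f i j \<in> carrier A"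
  shows "(\<Oplus>i\<in>I. \<Oplus>j\<in>J. f i j) = (\<Oplus>j\<in>J. \<Oplus>i\<in>I. f i j)"
  using assms
proof (induct I rule: infinite_finite_induct)
  case (insert i I)
  have "(\<Oplus>i\<in>insert i I. \<Oplus>j\<in>J. f i j) = (\<Oplus>j\<in>J. f i j) \<oplus> (\<Oplus>i\<in>I. \<Oplus>j\<in>J. f i j)"
    using insert(1,2,4) by (intro M.finsum_insert) (auto intro!: M.finsum_closed)
  also have "(\<Oplus>i\<in>I. \<Oplus>j\<in>J. f i j) = (\<Oplus>j\<in>J. \<Oplus>i\<in>I. f i j)"
    using insert(4) by (intro insert(3)) auto
  also have "(\<Oplus>j\<in>J. f i j) \<oplus> (\<Oplus>j\<in>J. \<Oplus>i\<in>I. f i j) = (\<Oplus>j\<in>J. f i j \<oplus> (\<Oplus>i\<in>I. f i j))"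
    using insert(4) by (intro M.finsum_addf[symmetric]) (auto intro!: M.finsum_closed)
  also have "\<dots> = (\<Oplus>j\<in>J. \<Oplus>i\<in>insert i I. f i j)"
    using insert(1,2,4)
    by (intro M.finsum_cong' M.finsum_insert[symmetric]) (auto intro!: M.finsum_closed)
  finally show ?case .
qed simp_all

context fine_subalgebra
begin

text \<open>The factor exists because \<open>G\<close> is commutative: both products lie on the line
  of degree \<open>s t\<close>. It does not depend on the scaling of the generators.\<close>

definition \<beta> :: "'g \<Rightarrow> 'g \<Rightarrow> 'f" where
  "\<beta> s t = (SOME b. X s \<otimes> X t = b \<odot> (X t \<otimes> X s))"

lemma X_mult_nonzero: "s \<in> T \<Longrightarrow> t \<in> T \<Longrightarrow> X s \<otimes> X t \<noteq> \<zero>"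
  using unit_mult_nonzero[of "X s" "X t"] X_nonzero by auto

lemma beta_eq:
  assumes "s \<in> T" "t \<in> T"
  shows "X s \<otimes> X t = \<beta> s t \<odot> (X t \<otimes> X s)"
proof -
  obtain c where c: "X s \<otimes> X t = c \<odot> X (s \<otimes>\<^bsub>G\<^esub> t)" using X_mult assms by blast
  obtain d where d: "d \<noteq> 0" "X t \<otimes> X s = d \<odot> X (t \<otimes>\<^bsub>G\<^esub> s)" using X_mult assms by blast
  have "X s \<otimes> X t = (c / d) \<odot> (X t \<otimes> X s)"
    unfolding c d(2) using d(1) assms by (simp add: scal_scal G.m_comm[of s t])
  then show ?thesis unfolding \<beta>_def by (rule someI)
qed

lemma scal_cancel:
  assumes "x \<in> carrier A" "x \<noteq> \<zero>" "a \<odot> x = b \<odot> x"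
  shows "a = b"
proof -
  have "(a - b) \<odot> x \<oplus> b \<odot> x = a \<odot> x" using assms(1) by (simp flip: add_scal)
  then have "(a - b) \<odot> x \<oplus> b \<odot> x = \<zero> \<oplus> b \<odot> x" using assms(1,3) by simp
  then have "(a - b) \<odot> x = \<zero>"
    using assms(1) by (subst (asm) M.add.right_cancel) auto
  then show ?thesis using assms scal_eq_zero_iff by auto
qed

lemma beta_unique:
  assumes "s \<in> T" "t \<in> T" "X s \<otimes> X t = b \<odot> (X t \<otimes> X s)"
  shows "\<beta> s t = b"
  using assms beta_eq[of s t] X_mult_nonzero[of t s] by (intro scal_cancel[of "X t \<otimes> X s"]) auto

lemma beta_mult_right:
  assumes "s \<in> T" "t \<in> T" "r \<in> T"
  shows "\<beta> s (t \<otimes>\<^bsub>G\<^esub> r) = \<beta> s t * \<beta> s r"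
proof (rule beta_unique)
  obtain c where c: "c \<noteq> 0" "X t \<otimes> X r = c \<odot> X (t \<otimes>\<^bsub>G\<^esub> r)" using X_mult assms by blast
  then have e: "X (t \<otimes>\<^bsub>G\<^esub> r) = inverse c \<odot> (X t \<otimes> X r)" using assms by (simp add: scal_scal)
  have "X s \<otimes> (X t \<otimes> X r) = (\<beta> s t * \<beta> s r) \<odot> ((X t \<otimes> X r) \<otimes> X s)"
  proof -
    have "X s \<otimes> (X t \<otimes> X r) = (\<beta> s t \<odot> (X t \<otimes> X s)) \<otimes> X r"
      using assms by (simp add: A.m_assoc flip: beta_eq)
    also have "\<dots> = \<beta> s t \<odot> (X t \<otimes> (X s \<otimes> X r))"
      using assms by (simp add: smult_mult_left A.m_assoc)
    also have "\<dots> = \<beta> s t \<odot> (X t \<otimes> (\<beta> s r \<odot> (X r \<otimes> X s)))"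
      using assms by (simp flip: beta_eq)
    also have "\<dots> = (\<beta> s t * \<beta> s r) \<odot> ((X t \<otimes> X r) \<otimes> X s)"
      using assms by (simp add: smult_mult_right scal_scal A.m_assoc)
    finally show ?thesis .
  qed
  then show "X s \<otimes> X (t \<otimes>\<^bsub>G\<^esub> r) = (\<beta> s t * \<beta> s r) \<odot> (X (t \<otimes>\<^bsub>G\<^esub> r) \<otimes> X s)"
    unfolding e using assms by (simp add: smult_mult_left smult_mult_right scal_scal ac_simps)
qed (use assms in auto)

lemma beta_swap:
  assumes "s \<in> T" "t \<in> T"
  shows "\<beta> s t * \<beta> t s = 1"
proof (rule scal_cancel)
  have "1 \<odot> (X s \<otimes> X t) = \<beta> s t \<odot> (\<beta> t s \<odot> (X s \<otimes> X t))"
    using assms by (simp flip: beta_eq)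
  then show "(\<beta> s t * \<beta> t s) \<odot> (X s \<otimes> X t) = 1 \<odot> (X s \<otimes> X t)"
    using assms by (simp add: scal_scal)
qed (use assms X_mult_nonzero in auto)

text \<open>Swapping the arguments inverts \<beta>, which turns multiplicativity on the right into
  multiplicativity on the left.\<close>

lemma beta_mult_left:
  assumes "s \<in> T" "t \<in> T" "r \<in> T"
  shows "\<beta> (s \<otimes>\<^bsub>G\<^esub> t) r = \<beta> s r * \<beta> t r"
proof -
  have "\<beta> s r * \<beta> t r = \<beta> s r * \<beta> t r * (\<beta> (s \<otimes>\<^bsub>G\<^esub> t) r * \<beta> r (s \<otimes>\<^bsub>G\<^esub> t))"
    using assms beta_swap[of "s \<otimes>\<^bsub>G\<^esub> t" r] by simp
  also have "\<dots> = \<beta> (s \<otimes>\<^bsub>G\<^esub> t) r * (\<beta> s r * \<beta> r s) * (\<beta> t r * \<beta> r t)"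
    using assms by (simp add: beta_mult_right ac_simps)
  finally show ?thesis using assms by (simp add: beta_swap)
qed

lemma X_one: "\<exists>c. X \<one>\<^bsub>G\<^esub> = c \<odot> \<one>"
  using D_one[of "X \<one>\<^bsub>G\<^esub>"] by simp

lemma beta_one:
  assumes "s \<in> T"
  shows "\<beta> \<one>\<^bsub>G\<^esub> s = 1"
proof (rule beta_unique)
  obtain c where "X \<one>\<^bsub>G\<^esub> = c \<odot> \<one>" using X_one by blast
  then show "X \<one>\<^bsub>G\<^esub> \<otimes> X s = 1 \<odot> (X s \<otimes> X \<one>\<^bsub>G\<^esub>)"
    using assms by (simp add: smult_mult_left smult_mult_right)
qed (use assms in auto)

text \<open>If \<open>\<beta> t\<close> is trivial, \<open>X t\<close> is central in
  \<open>D\<close>. Pulling it out of the sandwich identity makes \<open>\<one>\<close> a scalar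
  multiple of \<open>X t\<close>, and a nonzero element has only one degree.\<close>

lemma beta_nondegenerate:
  assumes t: "t \<in> T" and triv: "\<And>s. s \<in> T \<Longrightarrow> \<beta> t s = 1"
  shows "t = \<one>\<^bsub>G\<^esub>"
proof -
  have central: "X t \<otimes> d = d \<otimes> X t" if "d \<in> D" for d
    using that
  proof (induct rule: D_induct)
    case (hom c s)
    have "X t \<otimes> X s = X s \<otimes> X t" using beta_eq[OF t hom] triv[OF hom] t hom by simp
    then show ?case using t hom by (simp add: smult_mult_left smult_mult_right)
  qed (use t in \<open>simp add: l_distr r_distr\<close>)
  obtain p h where "matrix_subalgebra A D p h" using matrix_D by blast
  then interpret D: matrix_subalgebra A D p h .
  obtain a b c where a: "a \<in> {..<p} \<rightarrow> D" and b: "b \<in> {..<p} \<rightarrow> D"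
    and ab: "(\<Oplus>i\<in>{..<p}. a i \<otimes> X t \<otimes> b i) = \<one>" "(\<Oplus>i\<in>{..<p}. a i \<otimes> b i) = c \<odot> \<one>"
    using D.sandwich_eq_one[OF X_D[OF t] X_nonzero[OF t]] by blast
  have "(\<Oplus>i\<in>{..<p}. a i \<otimes> X t \<otimes> b i) = (\<Oplus>i\<in>{..<p}. X t \<otimes> (a i \<otimes> b i))"
  proof (rule M.finsum_cong')
    fix i assume "i \<in> {..<p}"
    then have i: "a i \<in> D" "b i \<in> D" using a b by auto
    then show "a i \<otimes> X t \<otimes> b i = X t \<otimes> (a i \<otimes> b i)"
      using t central[OF i(1)] by (simp flip: A.m_assoc)
  qed (use a b t in \<open>auto simp: Pi_iff\<close>)
  also have "\<dots> = X t \<otimes> (\<Oplus>i\<in>{..<p}. a i \<otimes> b i)"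
    using a b t by (intro A.finsum_rdistr[symmetric]) (auto simp: Pi_iff)
  finally have "\<one> = c \<odot> X t" using ab t by (simp add: smult_mult_right)
  then have "\<one> \<in> \<Gamma> t" using hom_scal t by simp
  then show ?thesis using hom_disjoint[of \<one> t "\<one>\<^bsub>G\<^esub>"] one_hom one_nonzero t by auto
qed

lemma bij_T: "s \<in> T \<Longrightarrow> bij_betw (\<lambda>t. t \<otimes>\<^bsub>G\<^esub> s) T T"
  by (rule bij_betw_byWitness[where f' = "\<lambda>t. t \<otimes>\<^bsub>G\<^esub> inv\<^bsub>G\<^esub> s"]) (auto simp: G.m_assoc)

text \<open>Orthogonality of characters: translation by some \<open>r\<close> with
  \<open>\<beta> t r \<noteq> 1\<close> leaves the sum unchanged but also multiplies it by
  \<open>\<beta> t r\<close>.\<close>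

lemma sum_beta:
  assumes t: "t \<in> T"
  shows "(\<Sum>s\<in>T. \<beta> t s) = (if t = \<one>\<^bsub>G\<^esub> then of_nat (card T) else 0)"
proof (cases "t = \<one>\<^bsub>G\<^esub>")
  case True
  then show ?thesis by (simp add: beta_one)
next
  case False
  then obtain r where r: "r \<in> T" "\<beta> t r \<noteq> 1" using beta_nondegenerate[OF t] by blast
  have "(\<Sum>s\<in>T. \<beta> t s) = (\<Sum>s\<in>T. \<beta> t (s \<otimes>\<^bsub>G\<^esub> r))"
    using sum.reindex_bij_betw[OF bij_T[OF r(1)], of "\<beta> t"] by simp
  also have "\<dots> = (\<Sum>s\<in>T. \<beta> t s) * \<beta> t r"
    using t r by (simp add: beta_mult_right sum_distrib_right)
  finally show ?thesis using r False by simp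
qed

lemma finsum_T_translate:
  assumes "s \<in> T" "f \<in> T \<rightarrow> carrier A"
  shows "(\<Oplus>t\<in>T. f (t \<otimes>\<^bsub>G\<^esub> s)) = finsum A f T"
  using M.finsum_reindex[of f "\<lambda>t. t \<otimes>\<^bsub>G\<^esub> s" T] bij_T[OF assms(1)] assms(2)
  by (auto simp: bij_betw_def)

end

section \<open>The part of degree 1 and the centralizer of the fine factor\<close>

locale graded_decomposition = fine_subalgebra A G \<Gamma> D
  for A :: "('f :: field_char_0, 'a) module" (structure) and G :: "'g monoid"
    and \<Gamma> :: "'g \<Rightarrow> 'a set" and D :: "'a set" +
  fixes C :: "'a set"
  assumes dec: "graded_matrix_decomposition G A \<Gamma> C D"
    and supp: "grading_support G (sub_alg A C) (sub_grading \<Gamma> C) \<inter> T = {\<one>\<^bsub>G\<^esub>}"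
begin

lemma unital_C: "unital_subalgebra A C"
  using dec by (simp add: graded_matrix_decomposition_def graded_subalgebra_def)

lemmas C_closed = unital_subalgebraD[OF unital_C]

lemma C_carrier [simp]: "x \<in> C \<Longrightarrow> x \<in> carrier A"
  using C_closed(2) by blast

lemma comp_C: "x \<in> C \<Longrightarrow> g \<in> carrier G \<Longrightarrow> comp x g \<in> C"
  using dec graded_space_iff[OF C_closed(1)]
  by (simp add: graded_matrix_decomposition_def graded_subalgebra_def)

lemma commute: "c \<in> C \<Longrightarrow> d \<in> D \<Longrightarrow> d \<otimes> c = c \<otimes> d"
  using dec by (auto simp: graded_matrix_decomposition_def)

text \<open>The multiplication map is surjective, so products \<open>c \<otimes> d\<close> span the
  algebra and linear claims need to be checked only on them.\<close>

lemma product_induct [consumes 1, case_names add scal product]: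
  assumes x: "x \<in> carrier A"
    and add: "\<And>x y. x \<in> carrier A \<Longrightarrow> y \<in> carrier A \<Longrightarrow> Q x \<Longrightarrow> Q y \<Longrightarrow> Q (x \<oplus> y)"
    and scal: "\<And>c x. x \<in> carrier A \<Longrightarrow> Q x \<Longrightarrow> Q (c \<odot> x)"
    and prod: "\<And>c d. c \<in> C \<Longrightarrow> d \<in> D \<Longrightarrow> Q (c \<otimes> d)"
  shows "Q x"
proof -
  interpret C: module class_ring "sub_alg A C"
    using subspace_is_vs[OF C_closed(1)] by (simp add: vectorspace_def)
  interpret D: module class_ring "sub_alg A D"
    using subspace_is_vs[OF D_closed(1)] by (simp add: vectorspace_def)
  obtain \<mu> where \<mu>: "\<mu> \<in> alg_iso (tensor_algebra (sub_alg A C) (sub_alg A D)) A"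
    and pure: "\<forall>c\<in>C. \<forall>d\<in>D. \<mu> (pure_tensor (sub_alg A C) (sub_alg A D) c d) = c \<otimes> d"
    using dec by (auto simp: graded_matrix_decomposition_def)
  have Q0: "Q \<zero>" using prod[OF C_closed(4) D_closed(4)] by simp
  have "\<mu> ` carrier (tensor_algebra (sub_alg A C) (sub_alg A D)) \<subseteq> {x \<in> carrier A. Q x}"
    using pure add scal prod Q0 C_closed(7) D_closed(7)
    by (intro tensor_hom_image_subset[OF C.abelian_monoid_axioms D.abelian_monoid_axioms _ _
          alg_iso_imp_hom[OF \<mu>]]) auto
  moreover have "x \<in> \<mu> ` carrier (tensor_algebra (sub_alg A C) (sub_alg A D))"
    using alg_iso_imp_bij[OF \<mu>] x by (auto simp: bij_betw_def)
  ultimately show ?thesis by blast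
qed

text \<open>In degree 1 the product \<open>c \<otimes> X t\<close> has the component of
  \<open>c\<close> in the inverse degree of \<open>t\<close>, times \<open>X t\<close>. If that is
  nonzero, the inverse of \<open>t\<close> lies in both supports, so \<open>t\<close> is the
  identity of \<open>G\<close> and \<open>X t\<close> is a scalar.\<close>

lemma comp_one_C:
  assumes "x \<in> carrier A"
  shows "comp x \<one>\<^bsub>G\<^esub> \<in> C"
  using assms
proof (induct rule: product_induct)
  case (product c d)
  from product(2,1) show ?case
  proof (induct rule: D_induct)
    case (add x y)
    then show ?case using C_closed(6) by (simp add: r_distr comp_add)
  next
    case (hom k t)
    have ct: "comp c (inv\<^bsub>G\<^esub> t) \<in> C" "comp c (inv\<^bsub>G\<^esub> t) \<in> \<Gamma> (inv\<^bsub>G\<^esub> t)"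
      using hom by (auto intro: comp_C comp_hom)
    have "comp (c \<otimes> X t) (inv\<^bsub>G\<^esub> t \<otimes>\<^bsub>G\<^esub> t) = comp c (inv\<^bsub>G\<^esub> t) \<otimes> X t"
      using hom by (intro comp_mult_right) auto
    then have eq: "comp (c \<otimes> (k \<odot> X t)) \<one>\<^bsub>G\<^esub> = k \<odot> (comp c (inv\<^bsub>G\<^esub> t) \<otimes> X t)"
      using hom by (simp add: smult_mult_right comp_scal)
    have "comp c (inv\<^bsub>G\<^esub> t) \<otimes> X t \<in> C"
    proof (cases "comp c (inv\<^bsub>G\<^esub> t) = \<zero>")
      case True
      then show ?thesis using hom C_closed(4) by simp
    next
      case False
      then have "inv\<^bsub>G\<^esub> t \<in> grading_support G (sub_alg A C) (sub_grading \<Gamma> C)"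
        using ct hom by (auto simp: grading_support_def)
      then have "inv\<^bsub>G\<^esub> t = \<one>\<^bsub>G\<^esub>" using supp T_inv hom by blast
      then have t: "t = \<one>\<^bsub>G\<^esub>" using hom G.inv_eq_1_iff by simp
      obtain c' where c': "X \<one>\<^bsub>G\<^esub> = c' \<odot> \<one>" using X_one by blast
      show ?thesis using ct(1) C_closed(7)[OF ct(1)] unfolding t c' by (simp add: smult_mult_right)
    qed
    then show ?case unfolding eq by (rule C_closed(7))
  qed
qed (use C_closed(6,7) in \<open>simp_all add: comp_add comp_scal\<close>)

lemma hom_one_C: "x \<in> \<Gamma> \<one>\<^bsub>G\<^esub> \<Longrightarrow> x \<in> C"
  using comp_one_C[of x] comp_of_hom[of x "\<one>\<^bsub>G\<^esub>" "\<one>\<^bsub>G\<^esub>"] hom_closed[of "\<one>\<^bsub>G\<^esub>" x] by simp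

lemma card_T: "of_nat (card T) \<noteq> (0 :: 'f)"
proof -
  have "T \<noteq> {}" using one_T by blast
  then show ?thesis using finite_T by simp
qed

text \<open>This is \<open>card T\<close> times the projection onto the centralizer of
  \<open>D\<close>; the factor is divided out in \<open>centralizer_D\<close>.\<close>

definition avg :: "'a \<Rightarrow> 'a" where
  "avg y = (\<Oplus>s\<in>T. inv X s \<otimes> y \<otimes> X s)"

lemma avg_add:
  assumes "x \<in> carrier A" "y \<in> carrier A"
  shows "avg (x \<oplus> y) = avg x \<oplus> avg y"
proof -
  have "avg x \<oplus> avg y = (\<Oplus>s\<in>T. inv X s \<otimes> x \<otimes> X s \<oplus> inv X s \<otimes> y \<otimes> X s)"
    unfolding avg_def using assms by (intro M.finsum_addf[symmetric]) auto
  also have "\<dots> = avg (x \<oplus> y)"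
    unfolding avg_def using assms
    by (intro M.finsum_cong') (auto simp: A.l_distr A.r_distr)
  finally show ?thesis by simp
qed

text \<open>Conjugation of \<open>X t\<close> by \<open>X s\<close> multiplies it by
  \<open>\<beta> t s\<close>; by orthogonality the sum over \<open>s\<close> kills every generator
  except the scalar one.\<close>

lemma avg_D:
  assumes "d \<in> D"
  shows "\<exists>k. avg d = k \<odot> \<one>"
  using assms
proof (induct rule: D_induct)
  case (add x y)
  then obtain k l where "avg x = k \<odot> \<one>" "avg y = l \<odot> \<one>" by blast
  then have "avg (x \<oplus> y) = (k + l) \<odot> \<one>" using add by (simp add: avg_add add_scal)
  then show ?case by blast
next
  case (hom c t)
  have "inv X s \<otimes> (c \<odot> X t) \<otimes> X s = \<beta> t s \<odot> (c \<odot> X t)" if s: "s \<in> T" for s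
  proof -
    have "inv X s \<otimes> X t \<otimes> X s = inv X s \<otimes> (X t \<otimes> X s)" using hom s by (simp add: A.m_assoc)
    also have "\<dots> = \<beta> t s \<odot> (inv X s \<otimes> (X s \<otimes> X t))"
      using hom s by (simp add: beta_eq[of t s] smult_mult_right)
    also have "\<dots> = \<beta> t s \<odot> X t" using hom s by (simp flip: A.m_assoc)
    finally show ?thesis
      using hom s by (simp add: smult_mult_left smult_mult_right scal_scal mult.commute)
  qed
  then have "avg (c \<odot> X t) = (\<Oplus>s\<in>T. \<beta> t s \<odot> (c \<odot> X t))"
    unfolding avg_def using hom by (intro M.finsum_cong') auto
  also have "\<dots> = (\<Sum>s\<in>T. \<beta> t s) \<odot> (c \<odot> X t)" using hom by (intro finsum_scal_left) simp
  finally have *: "avg (c \<odot> X t) = (\<Sum>s\<in>T. \<beta> t s) \<odot> (c \<odot> X t)" .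
  show ?case
  proof (cases "t = \<one>\<^bsub>G\<^esub>")
    case True
    obtain c' where "X \<one>\<^bsub>G\<^esub> = c' \<odot> \<one>" using X_one by blast
    then have eq: "c \<odot> X t = (c * c') \<odot> \<one>" by (simp add: True scal_scal)
    show ?thesis unfolding eq using *[unfolded eq] by (auto simp: scal_scal)
  next
    case False
    then have "avg (c \<odot> X t) = 0 \<odot> \<one>" unfolding * using hom by (simp add: sum_beta)
    then show ?thesis by blast
  qed
qed

text \<open>Elements of \<open>C\<close> pass through the conjugations, so on a product only the
  factor from \<open>D\<close> is averaged, and it becomes a scalar.\<close>

lemma avg_C:
  assumes "x \<in> carrier A"
  shows "avg x \<in> C"
  using assms
proof (induct rule: product_induct)
  case (add x y)
  then show ?case using C_closed(6) by (simp add: avg_add)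
next
  case (scal c x)
  have "avg (c \<odot> x) = (\<Oplus>s\<in>T. c \<odot> (inv X s \<otimes> x \<otimes> X s))"
    unfolding avg_def using scal
    by (intro M.finsum_cong') (auto simp: smult_mult_left smult_mult_right)
  also have "\<dots> = c \<odot> avg x"
    unfolding avg_def using scal by (intro finsum_scal[symmetric]) auto
  finally have "avg (c \<odot> x) = c \<odot> avg x" .
  then show ?case using scal C_closed(7) by simp
next
  case (product c d)
  have "avg (c \<otimes> d) = (\<Oplus>s\<in>T. c \<otimes> (inv X s \<otimes> d \<otimes> X s))"
    unfolding avg_def
  proof (rule M.finsum_cong')
    fix s assume s: "s \<in> T"
    have "inv X s \<otimes> (c \<otimes> d) \<otimes> X s = (inv X s \<otimes> c) \<otimes> (d \<otimes> X s)"
      using product s by (simp add: A.m_assoc)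
    then show "inv X s \<otimes> (c \<otimes> d) \<otimes> X s = c \<otimes> (inv X s \<otimes> d \<otimes> X s)"
      using product s by (simp add: commute A.m_assoc)
  qed (use product in auto)
  also have "\<dots> = c \<otimes> avg d"
    unfolding avg_def using product finite_T by (intro A.finsum_rdistr[symmetric]) auto
  finally have "avg (c \<otimes> d) = c \<otimes> avg d" .
  moreover obtain k where "avg d = k \<odot> \<one>" using avg_D product by blast
  ultimately show ?case using product C_closed(7) by (simp add: smult_mult_right)
qed

text \<open>Under \<open>avg\<close>, whose values lie in \<open>C\<close>, an element commuting
  with the generators is multiplied by \<open>card T\<close>, which is invertible in characteristic
  zero.\<close>

lemma centralizer_D:
  assumes x: "x \<in> carrier A" and comm: "\<And>t. t \<in> T \<Longrightarrow> X t \<otimes> x = x \<otimes> X t"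
  shows "x \<in> C"
proof -
  have "avg x = (\<Oplus>s\<in>T. 1 \<odot> x)"
    unfolding avg_def
  proof (rule M.finsum_cong')
    fix s assume s: "s \<in> T"
    have "inv X s \<otimes> x \<otimes> X s = inv X s \<otimes> (X s \<otimes> x)"
      using x s by (simp add: A.m_assoc comm)
    also have "\<dots> = x" using x s by (simp flip: A.m_assoc)
    finally show "inv X s \<otimes> x \<otimes> X s = 1 \<odot> x" using x by simp
  qed (use x in auto)
  also have "\<dots> = of_nat (card T) \<odot> x" using x by (subst finsum_scal_left) auto
  finally have "inverse (of_nat (card T)) \<odot> avg x = x"
    using x card_T by (simp add: scal_scal)
  then show ?thesis using C_closed(7)[OF avg_C[OF x], of "inverse (of_nat (card T))"] by simp
qed

end

section \<open>Conjugating graded homomorphisms\<close>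

locale elementary_decomposition = graded_decomposition A G \<Gamma> D C + C: matrix_subalgebra A C p h
  for A :: "('f :: field_char_0, 'a) module" (structure) and G :: "'g monoid"
    and \<Gamma> :: "'g \<Rightarrow> 'a set" and D C :: "'a set" and p :: nat and h :: "'f mat \<Rightarrow> 'a" +
  fixes \<gamma> :: "nat \<Rightarrow> 'g"
  assumes \<gamma>: "i < p \<Longrightarrow> \<gamma> i \<in> carrier G"
    and unit_hom: "i < p \<Longrightarrow> j < p \<Longrightarrow> h (matrix_unit p i j) \<in> \<Gamma> (inv\<^bsub>G\<^esub> (\<gamma> i) \<otimes>\<^bsub>G\<^esub> \<gamma> j)"
begin

lemma unit_carrier [simp]: "C.unit i j \<in> carrier A"
  using C.unit_W by (rule C_carrier)

text \<open>Block-diagonal elements relative to the matrix units of \<open>C\<close>. Arbitrary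
  entries are allowed, but products are entrywise only if the entries of the left factor commute
  with the units, as those from \<open>D\<close> do.\<close>

definition diag :: "(nat \<Rightarrow> 'a) \<Rightarrow> 'a" where
  "diag f = (\<Oplus>i\<in>{..<p}. C.unit i i \<otimes> f i)"

lemma diag_closed [simp]: "(\<And>i. i < p \<Longrightarrow> f i \<in> carrier A) \<Longrightarrow> diag f \<in> carrier A"
  unfolding diag_def by (intro M.finsum_closed) auto

lemma diag_cong: "(\<And>i. i < p \<Longrightarrow> f i = f' i) \<Longrightarrow> (\<And>i. i < p \<Longrightarrow> f' i \<in> carrier A) \<Longrightarrow> diag f = diag f'"
  unfolding diag_def by (intro M.finsum_cong') auto

lemma unit_diag:
  assumes "i < p" "j < p" and f: "\<And>i. i < p \<Longrightarrow> f i \<in> carrier A"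
  shows "C.unit i j \<otimes> diag f = C.unit i j \<otimes> f j"
proof -
  have "C.unit i j \<otimes> diag f = (\<Oplus>k\<in>{..<p}. C.unit i j \<otimes> (C.unit k k \<otimes> f k))"
    unfolding diag_def using f by (intro A.finsum_rdistr) auto
  also have "\<dots> = (\<Oplus>k\<in>{..<p}. if j = k then C.unit i j \<otimes> f k else \<zero>)"
    using f assms by (intro M.finsum_cong') (auto simp: C.unit_mult simp flip: A.m_assoc)
  also have "\<dots> = C.unit i j \<otimes> f j"
    using f assms by (intro M.finsum_singleton) auto
  finally show ?thesis .
qed

lemma diag_mult:
  assumes f: "\<And>i. i < p \<Longrightarrow> f i \<in> D" and f': "\<And>i. i < p \<Longrightarrow> f' i \<in> carrier A"
  shows "diag f \<otimes> diag f' = diag (\<lambda>i. f i \<otimes> f' i)"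
proof -
  have "diag f \<otimes> diag f' = (\<Oplus>i\<in>{..<p}. (C.unit i i \<otimes> f i) \<otimes> diag f')"
    unfolding diag_def[of f] using f f' by (intro A.finsum_ldistr) auto
  also have "\<dots> = diag (\<lambda>i. f i \<otimes> f' i)"
    unfolding diag_def[of "\<lambda>i. f i \<otimes> f' i"]
  proof (rule M.finsum_cong')
    fix i assume "i \<in> {..<p}"
    then have i: "i < p" by simp
    have "(C.unit i i \<otimes> f i) \<otimes> diag f' = f i \<otimes> (C.unit i i \<otimes> diag f')"
      using i f f' by (simp add: A.m_assoc flip: commute)
    also have "\<dots> = f i \<otimes> C.unit i i \<otimes> f' i"
      using i f f' by (simp add: unit_diag A.m_assoc)
    also have "f i \<otimes> C.unit i i = C.unit i i \<otimes> f i"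
      using i f by (intro commute) auto
    also have "\<dots> \<otimes> f' i = C.unit i i \<otimes> (f i \<otimes> f' i)"
      using i f f' by (simp add: A.m_assoc)
    finally show "(C.unit i i \<otimes> f i) \<otimes> diag f' = C.unit i i \<otimes> (f i \<otimes> f' i)" .
  qed (use f f' in auto)
  finally show ?thesis .
qed

lemma diag_const:
  assumes "x \<in> carrier A"
  shows "diag (\<lambda>_. x) = x"
proof -
  have "diag (\<lambda>_. x) = (\<Oplus>i\<in>{..<p}. C.unit i i) \<otimes> x"
    unfolding diag_def using assms by (intro A.finsum_ldistr[symmetric]) auto
  then show ?thesis using assms by (simp add: C.sum_unit)
qed

lemma diag_unit:
  assumes "i < p" "j < p" and f: "\<And>i. i < p \<Longrightarrow> f i \<in> D"
  shows "diag f \<otimes> C.unit i j = f i \<otimes> C.unit i j"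
proof -
  have "diag f \<otimes> C.unit i j = (\<Oplus>k\<in>{..<p}. (C.unit k k \<otimes> f k) \<otimes> C.unit i j)"
    unfolding diag_def using f by (intro A.finsum_ldistr) auto
  also have "\<dots> = (\<Oplus>k\<in>{..<p}. if i = k then f k \<otimes> C.unit i j else \<zero>)"
  proof (rule M.finsum_cong')
    fix k assume "k \<in> {..<p}"
    then have k: "k < p" by simp
    have "(C.unit k k \<otimes> f k) \<otimes> C.unit i j = f k \<otimes> (C.unit k k \<otimes> C.unit i j)"
      using k f by (simp add: A.m_assoc flip: commute)
    then show "(C.unit k k \<otimes> f k) \<otimes> C.unit i j = (if i = k then f k \<otimes> C.unit i j else \<zero>)"
      using k f assms(1,2) by (simp add: C.unit_mult)
  qed (use f in auto)
  also have "\<dots> = f i \<otimes> C.unit i j"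
    using f assms by (intro M.finsum_singleton) auto
  finally show ?thesis .
qed

text \<open>This is the selection of rows moved into \<open>C\<close>: equality of the rows with
  number \<open>i\<close> becomes equality after left multiplication by
  \<open>C.unit i i\<close>.\<close>

lemma invertible_unit_selection:
  assumes P: "P \<in> T \<rightarrow> C" and sum: "(\<Oplus>s\<in>T. P s) = \<one>"
  shows "\<exists>\<sigma>\<in>{..<p} \<rightarrow> T. \<exists>Q\<in>C. \<exists>R\<in>C. Q \<otimes> R = \<one> \<and> R \<otimes> Q = \<one> \<and>
    (\<forall>i<p. C.unit i i \<otimes> Q = C.unit i i \<otimes> P (\<sigma> i))"
proof -
  have "\<forall>s\<in>T. \<exists>M. M \<in> carrier_mat p p \<and> h M = P s" using P C.h_surj by blast
  then obtain M where M: "\<And>s. s \<in> T \<Longrightarrow> M s \<in> carrier_mat p p" "\<And>s. s \<in> T \<Longrightarrow> h (M s) = P s"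
    by metis
  interpret mat: abelian_group "module_mat TYPE('f) p p" by (rule abelian_group_mat)
  have c: "finsum (module_mat TYPE('f) p p) M T \<in> carrier_mat p p"
    using mat.finsum_closed[of M T] M(1) by (auto simp: module_mat_simps)
  have "h (finsum (module_mat TYPE('f) p p) M T) = (\<Oplus>s\<in>T. h (M s))"
    using M(1) by (intro C.h_finsum) auto
  also have "\<dots> = (\<Oplus>s\<in>T. P s)"
    using M(2) P by (intro M.finsum_cong') (auto simp: Pi_iff)
  finally have "h (finsum (module_mat TYPE('f) p p) M T) = h (1\<^sub>m p)"
    using sum C.h_one by simp
  then have "finsum (module_mat TYPE('f) p p) M T = 1\<^sub>m p"
    using c by (intro C.h_inj) auto
  from invertible_row_selection[OF finite_T _ this] M(1)
  obtain \<sigma> Q R where \<sigma>: "\<sigma> \<in> {..<p} \<rightarrow> T" and Q: "Q \<in> carrier_mat p p" and R: "R \<in> carrier_mat p p"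
    and QR: "Q * R = 1\<^sub>m p" "R * Q = 1\<^sub>m p"
    and rows: "\<forall>i<p. \<forall>j<p. Q $$ (i, j) = M (\<sigma> i) $$ (i, j)" by blast
  have "C.unit i i \<otimes> h Q = C.unit i i \<otimes> P (\<sigma> i)" if i: "i < p" for i
  proof -
    have s: "\<sigma> i \<in> T" using \<sigma> i by auto
    have "matrix_unit p i i * Q = matrix_unit p i i * M (\<sigma> i)"
    proof (rule eq_matI)
      fix a b assume "a < dim_row (matrix_unit p i i * M (\<sigma> i))" "b < dim_col (matrix_unit p i i * M (\<sigma> i))"
      then have ab: "a < p" "b < p" using M(1)[OF s] by auto
      show "(matrix_unit p i i * Q) $$ (a, b) = (matrix_unit p i i * M (\<sigma> i)) $$ (a, b)"
        using rows i ab
        by (simp add: matrix_unit_mult_index[OF Q i ab] matrix_unit_mult_index[OF M(1)[OF s] i ab])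
    qed (use Q M(1)[OF s] in auto)
    then have "h (matrix_unit p i i * Q) = h (matrix_unit p i i * M (\<sigma> i))" by simp
    then show ?thesis
      using Q M[OF s] by (simp add: C.h_hom C.unit_def)
  qed
  moreover have "h Q \<otimes> h R = \<one>" "h R \<otimes> h Q = \<one>"
    using Q R QR C.h_hom(3)[of Q R] C.h_hom(3)[of R Q] C.h_one by auto
  moreover have "h Q \<in> C" "h R \<in> C" using Q R C.h_hom(1) by auto
  ultimately show ?thesis using \<sigma> by blast
qed

text \<open>
  The conjugating element \<open>w\<close> is not homogeneous, but conjugation by it keeps the matrix
  units of \<open>C\<close> homogeneous, with shifted degrees.
\<close>

lemma graded_Skolem_Noether:
  assumes \<chi>: "\<chi> \<in> alg_hom (sub_alg A D) A" and \<chi>_one: "\<chi> \<one> = \<one>"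
    and \<chi>_hom: "\<And>t. t \<in> T \<Longrightarrow> \<chi> (X t) \<in> \<Gamma> t"
  shows "\<exists>w\<in>Units A. \<exists>\<gamma>'. (\<forall>i<p. \<gamma>' i \<in> carrier G) \<and> (\<forall>d\<in>D. \<chi> d \<otimes> w = w \<otimes> d) \<and>
    (\<forall>i<p. \<forall>j<p. w \<otimes> h (matrix_unit p i j) \<otimes> inv w \<in> \<Gamma> (inv\<^bsub>G\<^esub> (\<gamma>' i) \<otimes>\<^bsub>G\<^esub> \<gamma>' j))"
proof -
  note \<chi>_props = alg_homD[OF \<chi>, simplified]
  have \<chi>_carrier [simp]: "\<chi> d \<in> carrier A" if "d \<in> D" for d using \<chi>_props(1) that .
  define U where "U t = \<chi> (X t) \<otimes> inv X t" for t
  have UA [simp]: "U t \<in> carrier A" if "t \<in> T" for t using that by (simp add: U_def)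
  have U1: "U t \<in> \<Gamma> \<one>\<^bsub>G\<^esub>" if t: "t \<in> T" for t
    using graded_mult[OF _ _ \<chi>_hom[OF t] inv_X_hom[OF t]] t by (simp add: U_def)
  have UC [simp]: "U t \<in> C" if "t \<in> T" for t using hom_one_C[OF U1[OF that]] .
  have UX: "U t \<otimes> X t = \<chi> (X t)" if "t \<in> T" for t
    using that by (simp add: U_def A.m_assoc)
  have U_one: "U \<one>\<^bsub>G\<^esub> = \<one>"
  proof -
    obtain c where c: "X \<one>\<^bsub>G\<^esub> = c \<odot> \<one>" using X_one by blast
    have "\<chi> (X \<one>\<^bsub>G\<^esub>) = X \<one>\<^bsub>G\<^esub>"
      using \<chi>_props(4)[OF D_closed(3)] by (simp add: c \<chi>_one)
    then show ?thesis by (simp add: U_def)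
  qed
  have U_mult: "U s \<otimes> U t = U (s \<otimes>\<^bsub>G\<^esub> t)" if s: "s \<in> T" and t: "t \<in> T" for s t
  proof -
    obtain c where c: "c \<noteq> 0" "X s \<otimes> X t = c \<odot> X (s \<otimes>\<^bsub>G\<^esub> t)" using X_mult s t by blast
    have "c \<odot> (U s \<otimes> U t \<otimes> X (s \<otimes>\<^bsub>G\<^esub> t)) = U s \<otimes> U t \<otimes> (X s \<otimes> X t)"
      using s t by (simp add: c smult_mult_right)
    also have "\<dots> = U s \<otimes> (U t \<otimes> X s) \<otimes> X t"
      using s t by (simp add: A.m_assoc)
    \<comment> \<open>Here \<open>U t\<close> passes \<open>X s\<close> because it lies in
      \<open>C\<close>. As a result the scalar \<open>c\<close> appears on both sides and cancels,
      so \<open>U\<close> is multiplicative without a cocycle.\<close>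
    also have "\<dots> = U s \<otimes> (X s \<otimes> U t) \<otimes> X t"
      using s t by (simp add: commute)
    also have "\<dots> = (U s \<otimes> X s) \<otimes> (U t \<otimes> X t)"
      using s t by (simp add: A.m_assoc)
    also have "\<dots> = \<chi> (X s \<otimes> X t)" using s t by (simp add: UX \<chi>_props)
    also have "\<dots> = c \<odot> \<chi> (X (s \<otimes>\<^bsub>G\<^esub> t))" using s t by (simp add: c \<chi>_props)
    finally have "inverse c \<odot> (c \<odot> (U s \<otimes> U t \<otimes> X (s \<otimes>\<^bsub>G\<^esub> t))) = inverse c \<odot> (c \<odot> \<chi> (X (s \<otimes>\<^bsub>G\<^esub> t)))"
      by simp
    then have "U s \<otimes> U t \<otimes> X (s \<otimes>\<^bsub>G\<^esub> t) = \<chi> (X (s \<otimes>\<^bsub>G\<^esub> t))"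
      using s t c(1) by (simp add: scal_scal)
    then have "U (s \<otimes>\<^bsub>G\<^esub> t) = U s \<otimes> U t \<otimes> X (s \<otimes>\<^bsub>G\<^esub> t) \<otimes> inv X (s \<otimes>\<^bsub>G\<^esub> t)"
      by (simp add: U_def)
    then show ?thesis using s t by (simp add: A.m_assoc)
  qed
  define N :: 'f where "N = of_nat (card T)"
  have N: "N \<noteq> 0" using card_T by (simp add: N_def)
  \<comment> \<open>The character projection for the eigenvalues \<open>\<beta> s r\<close> of the
    \<open>U r\<close>: the coefficient \<open>\<beta> t s\<close> is the inverse of
    \<open>\<beta> s t\<close>, and the factor \<open>inverse N\<close> makes all projections add up
    to the identity.\<close>
  define P where "P s = inverse N \<odot> (\<Oplus>t\<in>T. \<beta> t s \<odot> U t)" for s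
  have P1: "P s \<in> \<Gamma> \<one>\<^bsub>G\<^esub>" if "s \<in> T" for s
    unfolding P_def by (intro hom_scal subspace_finsum[OF subspace_hom]) (auto intro!: hom_scal U1)
  have PC: "P s \<in> C" if "s \<in> T" for s using hom_one_C[OF P1[OF that]] .
  have P_U: "P s \<otimes> U r = \<beta> s r \<odot> P s" if s: "s \<in> T" and r: "r \<in> T" for s r
  proof -
    have "(\<Oplus>t\<in>T. \<beta> t s \<odot> U t) \<otimes> U r = (\<Oplus>t\<in>T. (\<beta> t s \<odot> U t) \<otimes> U r)"
      using r finite_T by (intro A.finsum_ldistr) auto
    also have "\<dots> = (\<Oplus>t\<in>T. \<beta> s r \<odot> (\<beta> (t \<otimes>\<^bsub>G\<^esub> r) s \<odot> U (t \<otimes>\<^bsub>G\<^esub> r)))"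
    proof (rule M.finsum_cong')
      fix t assume t: "t \<in> T"
      \<comment> \<open>Splitting off \<open>\<beta> r s\<close> and cancelling it against
        \<open>\<beta> s r\<close> moves the coefficient from index \<open>t\<close> to the
        translated index.\<close>
      have "\<beta> s r * \<beta> (t \<otimes>\<^bsub>G\<^esub> r) s = \<beta> t s * (\<beta> s r * \<beta> r s)"
        using s t r by (simp add: beta_mult_left)
      then show "(\<beta> t s \<odot> U t) \<otimes> U r = \<beta> s r \<odot> (\<beta> (t \<otimes>\<^bsub>G\<^esub> r) s \<odot> U (t \<otimes>\<^bsub>G\<^esub> r))"
        using s t r by (simp add: smult_mult_left scal_scal U_mult beta_swap)
    qed (use s r in auto)
    also have "\<dots> = \<beta> s r \<odot> (\<Oplus>t\<in>T. \<beta> (t \<otimes>\<^bsub>G\<^esub> r) s \<odot> U (t \<otimes>\<^bsub>G\<^esub> r))"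
      using r by (intro finsum_scal[symmetric]) auto
    also have "(\<Oplus>t\<in>T. \<beta> (t \<otimes>\<^bsub>G\<^esub> r) s \<odot> U (t \<otimes>\<^bsub>G\<^esub> r)) = (\<Oplus>t\<in>T. \<beta> t s \<odot> U t)"
      using r by (intro finsum_T_translate[of r "\<lambda>t. \<beta> t s \<odot> U t"]) auto
    finally show ?thesis
      using r by (simp add: P_def smult_mult_left scal_scal mult.commute M.finsum_closed Pi_iff)
  qed
  have "(\<Oplus>s\<in>T. P s) = inverse N \<odot> (\<Oplus>s\<in>T. \<Oplus>t\<in>T. \<beta> t s \<odot> U t)"
    unfolding P_def by (intro finsum_scal[symmetric]) (auto intro!: M.finsum_closed)
  also have "(\<Oplus>s\<in>T. \<Oplus>t\<in>T. \<beta> t s \<odot> U t) = (\<Oplus>t\<in>T. \<Oplus>s\<in>T. \<beta> t s \<odot> U t)"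
    by (intro finsum_swap) auto
  \<comment> \<open>Orthogonality leaves only the neutral degree, where \<open>U\<close> is the
    identity.\<close>
  also have "\<dots> = (\<Oplus>t\<in>T. if \<one>\<^bsub>G\<^esub> = t then N \<odot> U t else \<zero>)"
    by (intro M.finsum_cong') (auto simp: finsum_scal_left sum_beta N_def)
  also have "\<dots> = N \<odot> U \<one>\<^bsub>G\<^esub>"
    using finite_T by (intro M.finsum_singleton) auto
  finally have sum_P: "(\<Oplus>s\<in>T. P s) = \<one>" using N by (simp add: U_one scal_scal)
  \<comment> \<open>Row \<open>i\<close> of \<open>Q\<close> is row \<open>i\<close> of the
    projection \<open>P (\<sigma> i)\<close>, hence a simultaneous left eigenvector of all
    \<open>U t\<close>; no eigenspace has to be decomposed.\<close>
  obtain \<sigma> Q R where \<sigma>: "\<sigma> \<in> {..<p} \<rightarrow> T" and QC: "Q \<in> C" and RC: "R \<in> C"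
    and QR: "Q \<otimes> R = \<one>" "R \<otimes> Q = \<one>"
    and rows: "\<forall>i<p. C.unit i i \<otimes> Q = C.unit i i \<otimes> P (\<sigma> i)"
    using invertible_unit_selection[of P] PC sum_P by blast
  have \<sigma>T [simp]: "\<sigma> i \<in> T" if "i < p" for i using \<sigma> that by auto
  have [simp]: "Q \<in> carrier A" "R \<in> carrier A" using QC RC by auto
  have PA [simp]: "P s \<in> carrier A" if "s \<in> T" for s using PC[OF that] by simp
  have Q_diag: "Q = diag (\<lambda>i. P (\<sigma> i))"
  proof -
    have "Q = diag (\<lambda>_. Q)" by (simp add: diag_const)
    also have "\<dots> = diag (\<lambda>i. P (\<sigma> i))"
      unfolding diag_def using rows by (intro M.finsum_cong') auto
    finally show ?thesis .
  qed
  \<comment> \<open>Diagonal units and projections all have degree 1. Hence so do \<open>Q\<close>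
    and its inverse, and conjugation by \<open>Q\<close> does not change degrees.\<close>
  have "C.unit i i \<in> \<Gamma> \<one>\<^bsub>G\<^esub>" if "i < p" for i
    using unit_hom[OF that that] \<gamma>[OF that] by (simp add: C.unit_def)
  then have Q1: "Q \<in> \<Gamma> \<one>\<^bsub>G\<^esub>"
    unfolding Q_diag diag_def
    using graded_mult[of "\<one>\<^bsub>G\<^esub>" "\<one>\<^bsub>G\<^esub>"] P1
    by (intro subspace_finsum[OF subspace_hom]) auto
  have R1: "R \<in> \<Gamma> \<one>\<^bsub>G\<^esub>"
    using hom_inverse[OF Q1 _ _ QR] by simp
  define B where "B t = diag (\<lambda>i. \<beta> (\<sigma> i) t \<odot> \<one>)" for t
  have BD: "\<beta> (\<sigma> i) t \<odot> \<one> \<in> D" for i t using D_closed(3,7) by blast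
  have BA [simp]: "B t \<in> carrier A" for t by (simp add: B_def)
  have Q_U: "Q \<otimes> U t = B t \<otimes> Q" if t: "t \<in> T" for t
  proof -
    have "Q \<otimes> U t = (\<Oplus>i\<in>{..<p}. (C.unit i i \<otimes> P (\<sigma> i)) \<otimes> U t)"
      unfolding Q_diag diag_def using t by (intro A.finsum_ldistr) auto
    also have "\<dots> = diag (\<lambda>i. \<beta> (\<sigma> i) t \<odot> \<one> \<otimes> P (\<sigma> i))"
      unfolding diag_def
      using t by (intro M.finsum_cong') (auto simp: A.m_assoc P_U smult_mult_left)
    also have "\<dots> = B t \<otimes> diag (\<lambda>i. P (\<sigma> i))"
      unfolding B_def using t BD by (intro diag_mult[symmetric]) auto
    finally show ?thesis using Q_diag by simp
  qed
  have U_R: "U t \<otimes> R = R \<otimes> B t" if t: "t \<in> T" for t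
  proof -
    have "U t \<otimes> R = (R \<otimes> Q) \<otimes> U t \<otimes> R" using t by (simp add: QR)
    also have "\<dots> = R \<otimes> (Q \<otimes> U t) \<otimes> R" using t by (simp add: A.m_assoc del: QR)
    also have "\<dots> = R \<otimes> B t \<otimes> (Q \<otimes> R)" using t by (simp add: Q_U A.m_assoc)
    finally show ?thesis using QR by simp
  qed
  \<comment> \<open>Moving \<open>X (\<sigma> i)\<close> past \<open>X t\<close> costs the factor
    \<open>\<beta> (\<sigma> i) t\<close>, which is the diagonal entry of \<open>B t\<close>. So
    \<open>S\<close> absorbs \<open>B t\<close>.\<close>
  define S where "S = diag (\<lambda>i. X (\<sigma> i))"
  define S' where "S' = diag (\<lambda>i. inv X (\<sigma> i))"
  have [simp]: "S \<in> carrier A" "S' \<in> carrier A" by (simp_all add: S_def S'_def)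
  have SS': "S \<otimes> S' = \<one>"
  proof -
    have "S \<otimes> S' = diag (\<lambda>i. X (\<sigma> i) \<otimes> inv X (\<sigma> i))"
      unfolding S_def S'_def by (rule diag_mult) auto
    also have "\<dots> = diag (\<lambda>_. \<one>)" by (rule diag_cong) auto
    finally show ?thesis by (simp add: diag_const)
  qed
  have S'S: "S' \<otimes> S = \<one>"
  proof -
    have "S' \<otimes> S = diag (\<lambda>i. inv X (\<sigma> i) \<otimes> X (\<sigma> i))"
      unfolding S_def S'_def by (rule diag_mult) auto
    also have "\<dots> = diag (\<lambda>_. \<one>)" by (rule diag_cong) auto
    finally show ?thesis by (simp add: diag_const)
  qed
  have S_X: "B t \<otimes> (X t \<otimes> S) = S \<otimes> X t" if t: "t \<in> T" for t
  proof -
    have "X t \<otimes> S = diag (\<lambda>_. X t) \<otimes> S" using t by (simp add: diag_const)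
    also have "\<dots> = diag (\<lambda>i. X t \<otimes> X (\<sigma> i))"
      unfolding S_def using t by (intro diag_mult) auto
    finally have "B t \<otimes> (X t \<otimes> S) = diag (\<lambda>i. \<beta> (\<sigma> i) t \<odot> \<one> \<otimes> (X t \<otimes> X (\<sigma> i)))"
      unfolding B_def using t BD by (simp add: diag_mult)
    also have "\<dots> = diag (\<lambda>i. X (\<sigma> i) \<otimes> X t)"
      using t by (intro diag_cong) (simp_all add: smult_mult_left beta_eq[of "\<sigma> _" t])
    also have "\<dots> = S \<otimes> diag (\<lambda>_. X t)"
      unfolding S_def using t by (intro diag_mult[symmetric]) auto
    finally show ?thesis using t by (simp add: diag_const)
  qed
  define w where "w = R \<otimes> S"
  define w' where "w' = S' \<otimes> Q"
  have [simp]: "w \<in> carrier A" "w' \<in> carrier A" by (simp_all add: w_def w'_def)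
  have "w \<otimes> w' = R \<otimes> (S \<otimes> S') \<otimes> Q" unfolding w_def w'_def by (simp add: A.m_assoc)
  then have ww': "w \<otimes> w' = \<one>" by (simp add: SS' QR)
  have "w' \<otimes> w = S' \<otimes> (Q \<otimes> R) \<otimes> S" unfolding w_def w'_def by (simp add: A.m_assoc)
  then have w'w: "w' \<otimes> w = \<one>" by (simp add: S'S QR)
  have w: "w \<in> Units A" using ww' w'w by (auto simp: Units_def)
  have inv_w: "inv w = w'" using ww' w'w by (intro A.inv_char) auto
  have conj: "\<chi> d \<otimes> w = w \<otimes> d" if "d \<in> D" for d
    using that
  proof (induct rule: D_induct)
    case (add x y)
    then show ?case by (simp add: \<chi>_props A.l_distr A.r_distr)
  next
    case (hom c t)
    \<comment> \<open>The chain moves \<open>X t\<close> past \<open>R\<close>, which lies in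
      \<open>C\<close>, turns \<open>U t\<close> into \<open>B t\<close> on the other side of
      \<open>R\<close>, and lets \<open>S\<close> absorb \<open>B t\<close>.\<close>
    have "\<chi> (X t) \<otimes> w = U t \<otimes> (X t \<otimes> R) \<otimes> S"
      using hom unfolding w_def by (simp add: A.m_assoc flip: UX)
    also have "\<dots> = (U t \<otimes> R) \<otimes> X t \<otimes> S"
      using hom RC by (simp add: commute A.m_assoc)
    also have "\<dots> = R \<otimes> (B t \<otimes> (X t \<otimes> S))"
      using hom by (simp add: U_R A.m_assoc)
    also have "\<dots> = w \<otimes> X t"
      using hom unfolding w_def by (simp add: S_X A.m_assoc)
    finally show ?case
      using hom by (simp add: \<chi>_props smult_mult_left smult_mult_right)
  qed
  \<comment> \<open>Multiplying E_ij by \<open>X (\<sigma> i)\<close> on the left and by the inverse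
    of \<open>X (\<sigma> j)\<close> on the right changes its degree by \<open>\<sigma> i\<close>
    over \<open>\<sigma> j\<close>, so each \<open>\<gamma> i\<close> is divided by
    \<open>\<sigma> i\<close>.\<close>
  define \<gamma>' where "\<gamma>' i = \<gamma> i \<otimes>\<^bsub>G\<^esub> inv\<^bsub>G\<^esub> (\<sigma> i)" for i
  have \<gamma>': "\<gamma>' i \<in> carrier G" if "i < p" for i using \<gamma>[OF that] that by (simp add: \<gamma>'_def)
  have "w \<otimes> h (matrix_unit p i j) \<otimes> inv w \<in> \<Gamma> (inv\<^bsub>G\<^esub> (\<gamma>' i) \<otimes>\<^bsub>G\<^esub> \<gamma>' j)"
    if i: "i < p" and j: "j < p" for i j
  proof -
    let ?u = "C.unit i j" and ?Y = "X (\<sigma> i) \<otimes> C.unit i j \<otimes> inv X (\<sigma> j)"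
    have "w \<otimes> ?u \<otimes> inv w = R \<otimes> ((S \<otimes> ?u) \<otimes> S') \<otimes> Q"
      unfolding inv_w unfolding w_def w'_def by (simp add: A.m_assoc)
    also have "S \<otimes> ?u = X (\<sigma> i) \<otimes> ?u"
      unfolding S_def using i j by (intro diag_unit) auto
    also have "X (\<sigma> i) \<otimes> ?u \<otimes> S' = X (\<sigma> i) \<otimes> (?u \<otimes> S')"
      using i by (simp add: A.m_assoc)
    also have "?u \<otimes> S' = ?u \<otimes> inv X (\<sigma> j)"
      unfolding S'_def using i j by (intro unit_diag) auto
    also have "X (\<sigma> i) \<otimes> (?u \<otimes> inv X (\<sigma> j)) = ?Y"
      using i j by (simp add: A.m_assoc)
    finally have eq: "w \<otimes> ?u \<otimes> inv w = R \<otimes> ?Y \<otimes> Q" .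
    have deg: "?Y \<in> \<Gamma> (\<sigma> i \<otimes>\<^bsub>G\<^esub> (inv\<^bsub>G\<^esub> (\<gamma> i) \<otimes>\<^bsub>G\<^esub> \<gamma> j) \<otimes>\<^bsub>G\<^esub> inv\<^bsub>G\<^esub> (\<sigma> j))"
      using i j \<gamma> unit_hom[OF i j] by (intro graded_mult) (auto simp: C.unit_def)
    have degR: "R \<otimes> ?Y \<in> \<Gamma> (\<one>\<^bsub>G\<^esub> \<otimes>\<^bsub>G\<^esub> (\<sigma> i \<otimes>\<^bsub>G\<^esub> (inv\<^bsub>G\<^esub> (\<gamma> i) \<otimes>\<^bsub>G\<^esub> \<gamma> j) \<otimes>\<^bsub>G\<^esub> inv\<^bsub>G\<^esub> (\<sigma> j)))"
      using i j \<gamma> by (intro graded_mult[OF _ _ R1 deg]) auto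
    have "R \<otimes> ?Y \<otimes> Q \<in> \<Gamma> (\<one>\<^bsub>G\<^esub> \<otimes>\<^bsub>G\<^esub> (\<sigma> i \<otimes>\<^bsub>G\<^esub> (inv\<^bsub>G\<^esub> (\<gamma> i) \<otimes>\<^bsub>G\<^esub> \<gamma> j) \<otimes>\<^bsub>G\<^esub> inv\<^bsub>G\<^esub> (\<sigma> j)) \<otimes>\<^bsub>G\<^esub> \<one>\<^bsub>G\<^esub>)"
      using i j \<gamma> by (intro graded_mult[OF _ _ degR Q1]) auto
    moreover have "\<one>\<^bsub>G\<^esub> \<otimes>\<^bsub>G\<^esub> (\<sigma> i \<otimes>\<^bsub>G\<^esub> (inv\<^bsub>G\<^esub> (\<gamma> i) \<otimes>\<^bsub>G\<^esub> \<gamma> j) \<otimes>\<^bsub>G\<^esub> inv\<^bsub>G\<^esub> (\<sigma> j)) \<otimes>\<^bsub>G\<^esub> \<one>\<^bsub>G\<^esub> =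
        inv\<^bsub>G\<^esub> (\<gamma>' i) \<otimes>\<^bsub>G\<^esub> \<gamma>' j"
      unfolding \<gamma>'_def using i j \<gamma> by (simp add: G.inv_mult G.m_ac)
    ultimately show ?thesis using eq by (simp add: C.unit_def)
  qed
  then show ?thesis using w \<gamma>' conj by blast
qed

end

section \<open>Images of decompositions under automorphisms\<close>

context assoc_algebra
begin

lemma conj_iso:
  assumes w: "w \<in> Units A"
  shows "(\<lambda>x. w \<otimes> x \<otimes> inv w) \<in> alg_iso A A"
proof -
  have wA: "w \<in> carrier A" using w by (rule A.Units_closed)
  have cancel: "inv w \<otimes> (w \<otimes> x) = x" "w \<otimes> (inv w \<otimes> x) = x" if "x \<in> carrier A" for x
    using that w wA by (simp_all flip: A.m_assoc)
  have "(\<lambda>x. w \<otimes> x \<otimes> inv w) \<in> alg_hom A A"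
    using w wA
    by (intro alg_homI)
      (simp_all add: A.l_distr A.r_distr A.m_assoc cancel smult_mult_left smult_mult_right)
  moreover have "bij_betw (\<lambda>x. w \<otimes> x \<otimes> inv w) (carrier A) (carrier A)"
    by (rule bij_betw_byWitness[where f' = "\<lambda>x. inv w \<otimes> x \<otimes> w"])
      (use w wA in \<open>auto simp: A.m_assoc cancel\<close>)
  ultimately show ?thesis by (simp add: alg_iso_def)
qed

lemma alg_iso_sub_image:
  assumes \<alpha>: "\<alpha> \<in> alg_iso A A" and W: "unital_subalgebra A W"
  shows "\<alpha> \<in> alg_iso (sub_alg A W) (sub_alg A (\<alpha> ` W))"
proof -
  note h = alg_homD[OF alg_iso_imp_hom[OF \<alpha>]]
  have "inj_on \<alpha> W"
    using alg_iso_imp_bij[OF \<alpha>] unital_subalgebraD(2)[OF W] by (auto simp: bij_betw_def inj_on_subset)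
  moreover have "\<alpha> \<in> alg_hom (sub_alg A W) (sub_alg A (\<alpha> ` W))"
    using h unital_subalgebraD(2)[OF W] by (intro alg_homI) (simp_all add: subset_eq)
  ultimately show ?thesis by (simp add: alg_iso_def bij_betw_def)
qed

lemma alg_iso_one:
  assumes \<alpha>: "\<alpha> \<in> alg_iso A A"
  shows "\<alpha> \<one> = \<one>"
proof -
  note h = alg_homD[OF alg_iso_imp_hom[OF \<alpha>]]
  obtain x where x: "x \<in> carrier A" "\<alpha> x = \<one>"
    using alg_iso_imp_bij[OF \<alpha>] by (metis bij_betw_iff_bijections one_closed)
  then show ?thesis using h(3)[of "\<one>" x] h(1)[of \<one>] by simp
qed

lemma unital_subalgebra_image:
  assumes \<alpha>: "\<alpha> \<in> alg_iso A A" and W: "unital_subalgebra A W"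
  shows "unital_subalgebra A (\<alpha> ` W)"
proof -
  note h = alg_homD[OF alg_iso_imp_hom[OF \<alpha>]] and W' = unital_subalgebraD[OF W]
  have WA: "x \<in> carrier A" if "x \<in> W" for x using that W'(2) by blast
  have \<alpha>0: "\<alpha> \<zero> = \<zero>" using h(4)[of \<zero> 0] h(1)[of \<zero>] by simp
  have add: "\<alpha> x \<oplus> \<alpha> y \<in> \<alpha> ` W" if "x \<in> W" "y \<in> W" for x y
    using W'(6)[OF that] that WA by (simp flip: h)
  have mult: "\<alpha> x \<otimes> \<alpha> y \<in> \<alpha> ` W" if "x \<in> W" "y \<in> W" for x y
    using W'(5)[OF that] that WA by (simp flip: h)
  have smult: "c \<odot> \<alpha> x \<in> \<alpha> ` W" if "x \<in> W" for c x
    using W'(7)[OF that] that WA by (simp flip: h)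
  show ?thesis
  proof (rule unital_subalgebraI)
    have "\<zero> \<in> \<alpha> ` W" using imageI[OF W'(4), of \<alpha>] \<alpha>0 by simp
    then show "subspace class_ring (\<alpha> ` W) A"
      using h(1) WA add smult by (intro subspaceI) blast+
    show "\<one> \<in> \<alpha> ` W" using alg_iso_one[OF \<alpha>] W'(3) by (metis imageI)
  qed (use mult in auto)
qed

lemma is_matrix_algebra_image:
  assumes "\<alpha> \<in> alg_iso A A" "unital_subalgebra A W" "is_matrix_algebra p (sub_alg A W)"
  shows "is_matrix_algebra p (sub_alg A (\<alpha> ` W))"
  using assms(3) alg_iso_comp[OF _ alg_iso_sub_image[OF assms(1,2)]]
  by (auto simp: is_matrix_algebra_def)

lemma sub_alg_module:
  assumes "unital_subalgebra A W"
  shows "module class_ring (sub_alg A W)"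
  using subspace_is_vs[OF unital_subalgebraD(1)[OF assms]] by (simp add: vectorspace_def)

lemma sub_alg_abelian_monoid: "unital_subalgebra A W \<Longrightarrow> abelian_monoid (sub_alg A W)"
  using sub_alg_module module.axioms(2) abelian_group_def by blast

text \<open>Gradedness of the two images is a hypothesis because \<alpha> need not respect degrees.
  The new multiplication map is the old one, preceded by the pullback of cosets and followed by
  \<alpha>.\<close>

lemma decomposition_image:
  assumes \<alpha>: "\<alpha> \<in> alg_iso A A" and dec: "graded_matrix_decomposition G A \<Gamma> C D"
    and gr: "graded_space G (sub_alg A (\<alpha> ` C)) (sub_grading \<Gamma> (\<alpha> ` C))"
      "graded_space G (sub_alg A (\<alpha> ` D)) (sub_grading \<Gamma> (\<alpha> ` D))"
  shows "graded_matrix_decomposition G A \<Gamma> (\<alpha> ` C) (\<alpha> ` D)"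
proof -
  have C: "unital_subalgebra A C" and D: "unital_subalgebra A D"
    using dec by (auto simp: graded_matrix_decomposition_def graded_subalgebra_def)
  note CA = unital_subalgebraD(2)[OF C] and DA = unital_subalgebraD(2)[OF D]
  note C' = unital_subalgebra_image[OF \<alpha> C] and D' = unital_subalgebra_image[OF \<alpha> D]
  note h = alg_homD[OF alg_iso_imp_hom[OF \<alpha>]]
  have bij: "bij_betw \<alpha> (carrier A) (carrier A)" by (rule alg_iso_imp_bij[OF \<alpha>])
  \<comment> \<open>Transport asks for a bijection of the whole type, so \<alpha> is extended by the
    identity outside the carrier.\<close>
  define \<alpha>' where "\<alpha>' x = (if x \<in> carrier A then \<alpha> x else x)" for x
  have "bij_betw \<alpha>' (carrier A \<union> - carrier A) (carrier A \<union> - carrier A)"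
  proof (rule bij_betw_combine)
    show "bij_betw \<alpha>' (carrier A) (carrier A)"
      using bij by (subst bij_betw_cong[of _ _ \<alpha>]) (simp_all add: \<alpha>'_def)
    show "bij_betw \<alpha>' (- carrier A) (- carrier A)"
      by (subst bij_betw_cong[of _ _ id]) (simp_all add: \<alpha>'_def)
  qed simp
  then have bij': "bij \<alpha>'" by simp
  have \<alpha>'_eq: "\<alpha>' x = \<alpha> x" if "x \<in> C \<or> x \<in> D" for x
    using that CA DA by (auto simp: \<alpha>'_def)
  have im: "\<alpha>' ` C = \<alpha> ` C" "\<alpha>' ` D = \<alpha> ` D" using \<alpha>'_eq by (auto simp: image_iff)
  have \<alpha>'_iso: "\<alpha>' \<in> alg_iso A A"
    using \<alpha> by (auto simp: alg_iso_def alg_hom_def module_hom_def hom_def \<alpha>'_def cong: bij_betw_cong)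
  interpret tr: tensor_transport "sub_alg A C" "sub_alg A (\<alpha> ` C)" "sub_alg A D" "sub_alg A (\<alpha> ` D)" \<alpha>'
  proof (rule tensor_transport.intro)
    show "\<alpha>' \<in> alg_iso (sub_alg A C) (sub_alg A (\<alpha> ` C))"
      "\<alpha>' \<in> alg_iso (sub_alg A D) (sub_alg A (\<alpha> ` D))"
      using alg_iso_sub_image[OF \<alpha>'_iso C] alg_iso_sub_image[OF \<alpha>'_iso D] by (simp_all add: im)
  qed (use bij' sub_alg_abelian_monoid[OF C] sub_alg_abelian_monoid[OF D]
        sub_alg_abelian_monoid[OF C'] sub_alg_abelian_monoid[OF D']
        unital_subalgebraD(5,7)[OF C] unital_subalgebraD(5,7)[OF D]
        unital_subalgebraD(7)[OF C'] unital_subalgebraD(7)[OF D'] in simp_all)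
  obtain \<mu> where \<mu>: "\<mu> \<in> alg_iso (tensor_algebra (sub_alg A C) (sub_alg A D)) A"
    and pure: "\<forall>c\<in>C. \<forall>d\<in>D. \<mu> (pure_tensor (sub_alg A C) (sub_alg A D) c d) = c \<otimes> d"
    using dec by (auto simp: graded_matrix_decomposition_def)
  let ?\<nu> = "\<lambda>X. \<alpha> (\<mu> (tr.r ` X))"
  have "?\<nu> \<in> alg_iso (tensor_algebra (sub_alg A (\<alpha> ` C)) (sub_alg A (\<alpha> ` D))) A"
    using alg_iso_comp[OF alg_iso_comp[OF tr.image_r_iso \<mu>] \<alpha>] .
  moreover have "?\<nu> (pure_tensor (sub_alg A (\<alpha> ` C)) (sub_alg A (\<alpha> ` D)) (\<alpha> c) (\<alpha> d)) = \<alpha> c \<otimes> \<alpha> d"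
    if "c \<in> C" "d \<in> D" for c d
  proof -
    have "tr.r ` pure_tensor (sub_alg A (\<alpha> ` C)) (sub_alg A (\<alpha> ` D)) (\<alpha> c) (\<alpha> d) =
        pure_tensor (sub_alg A C) (sub_alg A D) c d"
      using tr.image_r_pure_tensor[of c d] that by (simp add: \<alpha>'_eq)
    then show ?thesis using that pure CA DA by (simp add: h(3) subset_eq)
  qed
  ultimately have \<nu>: "\<exists>\<mu>\<in>alg_iso (tensor_algebra (sub_alg A (\<alpha> ` C)) (sub_alg A (\<alpha> ` D))) A.
    \<forall>c\<in>\<alpha> ` C. \<forall>d\<in>\<alpha> ` D. \<mu> (pure_tensor (sub_alg A (\<alpha> ` C)) (sub_alg A (\<alpha> ` D)) c d) = c \<otimes> d"
    by (intro bexI[of _ ?\<nu>]) auto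
  have comm: "\<alpha> c \<otimes> \<alpha> d = \<alpha> d \<otimes> \<alpha> c" if "c \<in> C" "d \<in> D" for c d
  proof -
    have "c \<otimes> d = d \<otimes> c" using dec that by (auto simp: graded_matrix_decomposition_def)
    then have "\<alpha> (c \<otimes> d) = \<alpha> (d \<otimes> c)" by simp
    then show ?thesis using that CA DA by (simp add: h subset_eq)
  qed
  have "\<exists>p. is_matrix_algebra p (sub_alg A (\<alpha> ` C))" "\<exists>p. is_matrix_algebra p (sub_alg A (\<alpha> ` D))"
    using dec is_matrix_algebra_image[OF \<alpha> C] is_matrix_algebra_image[OF \<alpha> D]
    by (auto simp: graded_matrix_decomposition_def)
  then show ?thesis
    using gr C' D' comm \<nu>
    unfolding graded_matrix_decomposition_def graded_subalgebra_def by blast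
qed

end

text \<open>Applying \<open>h\<close> to the expansion of \<open>x\<close> gives an expansion into
  homogeneous elements of \<open>B\<close>, which is unique. Degrees are preserved only on
  \<open>W\<close>, since the automorphism of \<open>R2\<close> is known to respect them on
  \<open>D2\<close> alone.\<close>

lemma comp_image:
  assumes "graded_alg A G \<Gamma>" "graded_alg B G \<Delta>"
    and W: "subspace class_ring W A" and Wc: "\<And>x g. x \<in> W \<Longrightarrow> g \<in> carrier G \<Longrightarrow> graded_alg.comp A G \<Gamma> x g \<in> W"
    and h: "\<And>x. x \<in> W \<Longrightarrow> h x \<in> carrier B"
    and h_add: "\<And>x y. x \<in> W \<Longrightarrow> y \<in> W \<Longrightarrow> h (x \<oplus>\<^bsub>A\<^esub> y) = h x \<oplus>\<^bsub>B\<^esub> h y"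
    and h_zero: "h \<zero>\<^bsub>A\<^esub> = \<zero>\<^bsub>B\<^esub>"
    and h_hom: "\<And>x g. x \<in> W \<Longrightarrow> g \<in> carrier G \<Longrightarrow> x \<in> \<Gamma> g \<Longrightarrow> h x \<in> \<Delta> g"
    and x: "x \<in> W" and g: "g \<in> carrier G"
  shows "graded_alg.comp B G \<Delta> (h x) g = h (graded_alg.comp A G \<Gamma> x g)"
proof -
  interpret A: graded_alg A G \<Gamma> by fact
  interpret B: graded_alg B G \<Delta> by fact
  note W' = A.subspaceD[OF W]
  have xA: "x \<in> carrier A" using x W'(1) by blast
  have "h (finsum A f I) = finsum B (\<lambda>i. h (f i)) I" if "finite I" "f \<in> I \<rightarrow> W" for f and I :: "'c set"
    using that
  proof (induct I rule: finite_induct)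
    case (insert i I)
    have fW: "f i \<in> W" "finsum A f I \<in> W"
      using insert(4) A.subspace_finsum[OF W, of f I] by auto
    have "finsum A f (insert i I) = f i \<oplus>\<^bsub>A\<^esub> finsum A f I"
      using insert W'(1) by (intro A.M.finsum_insert) auto
    moreover have "finsum B (\<lambda>i. h (f i)) (insert i I) = h (f i) \<oplus>\<^bsub>B\<^esub> finsum B (\<lambda>i. h (f i)) I"
      using insert h by (intro B.M.finsum_insert) auto
    ultimately show ?case using insert fW by (simp add: h_add)
  qed (simp add: h_zero)
  from this[OF A.finite_G, of "A.comp x"]
  have "h x = finsum B (\<lambda>g. h (A.comp x g)) (carrier G)"
    using Wc[OF x] by (simp add: A.sum_comp[OF xA])
  then show ?thesis
    using h_hom Wc[OF x] A.comp_hom[OF xA] g by (intro B.comp_eqI) auto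
qed

section \<open>Extending the embedding of the fine part\<close>

locale graded_embedding =
  A1: graded_decomposition R1 G \<Gamma>1 D1 C1 + A2: elementary_decomposition R2 G \<Gamma>2 D2 C2 p h \<gamma>
  for R1 :: "('f :: field_char_0, 'a) module" and R2 :: "('f, 'b) module" (structure)
    and G :: "'g monoid" and \<Gamma>1 D1 C1 \<Gamma>2 D2 C2 p h \<gamma> +
  fixes \<phi> \<theta> :: "'a \<Rightarrow> 'b"
  assumes \<phi>: "\<phi> \<in> graded_hom G R1 \<Gamma>1 R2 \<Gamma>2" and \<phi>_inj: "inj_on \<phi> (carrier R1)"
    and \<theta>: "\<theta> \<in> graded_iso G (sub_alg R1 D1) (sub_grading \<Gamma>1 D1)
      (sub_alg R2 D2) (sub_grading \<Gamma>2 D2)"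
begin

lemma \<phi>_alg: "\<phi> \<in> alg_hom R1 R2"
  using \<phi> by (simp add: graded_hom_def)

lemmas \<phi>_hom = alg_homD[OF \<phi>_alg]

lemma \<phi>_closed [simp]: "x \<in> carrier R1 \<Longrightarrow> \<phi> x \<in> carrier R2"
  by (rule \<phi>_hom(1))

lemma \<phi>_graded: "g \<in> carrier G \<Longrightarrow> x \<in> \<Gamma>1 g \<Longrightarrow> \<phi> x \<in> \<Gamma>2 g"
  using \<phi> by (auto simp: graded_hom_def)

lemma \<theta>_iso: "\<theta> \<in> alg_iso (sub_alg R1 D1) (sub_alg R2 D2)"
  using \<theta> by (simp add: graded_iso_def)

lemmas \<theta>_hom = alg_homD[OF alg_iso_imp_hom[OF \<theta>_iso], simplified]

lemma \<theta>_D2 [simp]: "d \<in> D1 \<Longrightarrow> \<theta> d \<in> D2"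
  by (rule \<theta>_hom(1))

lemma \<theta>_bij: "bij_betw \<theta> D1 D2"
  using alg_iso_imp_bij[OF \<theta>_iso] by simp

lemma \<theta>_graded: "g \<in> carrier G \<Longrightarrow> x \<in> D1 \<Longrightarrow> x \<in> \<Gamma>1 g \<Longrightarrow> \<theta> x \<in> \<Gamma>2 g"
  using \<theta> by (auto simp: graded_iso_def graded_hom_def)

lemma \<theta>_one: "\<theta> \<one>\<^bsub>R1\<^esub> = \<one>"
proof -
  obtain x where x: "x \<in> D1" "\<theta> x = \<one>"
    using \<theta>_bij A2.D_closed(3) by (metis bij_betw_iff_bijections)
  then have "\<one> = \<theta> (\<one>\<^bsub>R1\<^esub> \<otimes>\<^bsub>R1\<^esub> x)" by simp
  also have "\<dots> = \<theta> \<one>\<^bsub>R1\<^esub> \<otimes> \<one>" using \<theta>_hom(3)[OF A1.D_closed(3) x(1)] x(2) by simp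
  finally show ?thesis using A1.D_closed(3) by simp
qed

lemma comp_\<theta>:
  assumes "x \<in> D1" "g \<in> carrier G"
  shows "A2.comp (\<theta> x) g = \<theta> (A1.comp x g)"
proof (rule comp_image[OF A1.graded_alg_axioms A2.graded_alg_axioms A1.D_closed(1)])
  show "\<theta> \<zero>\<^bsub>R1\<^esub> = \<zero>"
    using \<theta>_hom(4)[OF A1.D_closed(4), of 0] \<theta>_D2[OF A1.D_closed(4)] by simp
qed (use assms A1.comp_D \<theta>_hom \<theta>_graded in auto)

text \<open>As \<theta> commutes with components and is injective, \<open>x\<close> equals its own
  component in degree \<open>g\<close>. This is what makes the inverse of \<theta> preserve
  degrees.\<close>

lemma \<theta>_reflects:
  assumes "x \<in> D1" "g \<in> carrier G" "\<theta> x \<in> \<Gamma>2 g"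
  shows "x \<in> \<Gamma>1 g"
proof -
  have "\<theta> (A1.comp x g) = \<theta> x"
    using comp_\<theta>[OF assms(1,2)] A2.comp_of_hom[OF assms(3,2,2)] by simp
  then have "A1.comp x g = x"
    using \<theta>_bij A1.comp_D assms by (auto simp: bij_betw_def inj_on_def)
  then show ?thesis using A1.comp_hom[of x g] assms by simp
qed

definition e where "e = \<phi> \<one>\<^bsub>R1\<^esub>"
text \<open>The complementary idempotent, written with the scalar -1 so that closure of
  \<open>C2\<close> and of the degree 1 part under sums and scalars applies directly.\<close>

definition e' where "e' = \<one> \<oplus> (-1) \<odot> e"

lemma e_carrier [simp]: "e \<in> carrier R2"
  by (simp add: e_def)

lemma e_C2: "e \<in> C2"
  unfolding e_def by (intro A2.hom_one_C \<phi>_graded A1.one_hom) simp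

lemma e'_C2: "e' \<in> C2"
  unfolding e'_def using e_C2 A2.C_closed(3,6,7) by blast

lemma e'_carrier [simp]: "e' \<in> carrier R2"
  using e'_C2 by simp

lemma e_\<phi> [simp]: "x \<in> carrier R1 \<Longrightarrow> e \<otimes> \<phi> x = \<phi> x" "x \<in> carrier R1 \<Longrightarrow> \<phi> x \<otimes> e = \<phi> x"
  unfolding e_def by (simp_all flip: \<phi>_hom(3))

lemma add_neg: "x \<in> carrier R2 \<Longrightarrow> x \<oplus> (-1) \<odot> x = \<zero>"
  using A2.add_scal[of x 1 "-1"] by simp

lemma e'_\<phi> [simp]: "x \<in> carrier R1 \<Longrightarrow> e' \<otimes> \<phi> x = \<zero>" "x \<in> carrier R1 \<Longrightarrow> \<phi> x \<otimes> e' = \<zero>"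
  unfolding e'_def
  by (simp_all add: A2.A.l_distr A2.A.r_distr A2.smult_mult_left A2.smult_mult_right add_neg)

lemma e'_idem: "e' \<otimes> e' = e'"
proof -
  have "e' \<otimes> e' = e' \<otimes> (\<one> \<oplus> (-1) \<odot> e)" by (simp flip: e'_def)
  also have "\<dots> = e' \<oplus> (-1) \<odot> (e' \<otimes> e)"
    by (simp add: A2.A.r_distr A2.smult_mult_right)
  finally show ?thesis by (simp add: e_def)
qed

lemma e_add_e': "e \<oplus> e' = \<one>"
proof -
  have "e \<oplus> e' = \<one> \<oplus> (e \<oplus> (-1) \<odot> e)"
    unfolding e'_def by (rule A2.M.a_lcomm) simp_all
  then show ?thesis by (simp add: add_neg)
qed

lemma e'_D2: "d \<in> D2 \<Longrightarrow> d \<otimes> e' = e' \<otimes> d"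
  using A2.commute[OF e'_C2] .

text \<open>\<phi> alone would send the identity only to \<open>e\<close>; the second summand fills
  the complementary corner.\<close>

definition \<psi> where "\<psi> d = \<phi> d \<oplus> e' \<otimes> \<theta> d"

lemma \<psi>_closed [simp]: "d \<in> D1 \<Longrightarrow> \<psi> d \<in> carrier R2"
  by (simp add: \<psi>_def)

text \<open>\<open>\<phi> a\<close> annihilates \<open>e'\<close>, so the added summand contributes
  nothing.\<close>

lemma \<phi>_\<psi>:
  assumes "a \<in> carrier R1" "d \<in> D1"
  shows "\<phi> a \<otimes> \<psi> d = \<phi> a \<otimes> \<phi> d"
proof -
  have "\<phi> a \<otimes> (e' \<otimes> \<theta> d) = (\<phi> a \<otimes> e') \<otimes> \<theta> d"
    using assms by (intro A2.A.m_assoc[symmetric]) auto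
  then show ?thesis using assms by (simp add: \<psi>_def A2.A.r_distr)
qed

text \<open>On this side \<open>e'\<close> has first to be moved past \<open>\<theta> d\<close>,
  which is possible because it lies in \<open>C2\<close>.\<close>

lemma \<psi>_\<phi>:
  assumes "a \<in> carrier R1" "d \<in> D1"
  shows "\<psi> d \<otimes> \<phi> a = \<phi> d \<otimes> \<phi> a"
proof -
  have "e' \<otimes> \<theta> d \<otimes> \<phi> a = \<theta> d \<otimes> (e' \<otimes> \<phi> a)"
    using assms by (simp add: A2.A.m_assoc flip: e'_D2)
  then show ?thesis using assms by (simp add: \<psi>_def A2.A.l_distr)
qed

text \<open>Mixed products vanish because \<open>e'\<close> is orthogonal to the image of \<phi> and
  commutes with the image of \<theta>; the remaining product uses that \<open>e'\<close> is
  idempotent.\<close>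

lemma \<psi>_alg: "\<psi> \<in> alg_hom (sub_alg R1 D1) R2"
proof (rule alg_homI)
  fix x y assume xy: "x \<in> carrier (sub_alg R1 D1)" "y \<in> carrier (sub_alg R1 D1)"
  then have xy: "x \<in> D1" "y \<in> D1" by simp_all
  then show "\<psi> (x \<oplus>\<^bsub>sub_alg R1 D1\<^esub> y) = \<psi> x \<oplus> \<psi> y"
    by (simp add: \<psi>_def \<phi>_hom \<theta>_hom A2.A.r_distr A2.M.a_ac)
  have "\<psi> x \<otimes> \<psi> y = \<phi> x \<otimes> \<psi> y \<oplus> e' \<otimes> \<theta> x \<otimes> \<psi> y"
    using xy by (subst \<psi>_def) (simp add: A2.A.l_distr)
  also have "e' \<otimes> \<theta> x \<otimes> \<psi> y = \<theta> x \<otimes> e' \<otimes> \<phi> y \<oplus> \<theta> x \<otimes> e' \<otimes> (e' \<otimes> \<theta> y)"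
    using xy by (simp add: \<psi>_def A2.A.r_distr e'_D2)
  also have "\<theta> x \<otimes> e' \<otimes> \<phi> y = \<zero>" using xy by (simp add: A2.A.m_assoc)
  also have "\<theta> x \<otimes> e' \<otimes> (e' \<otimes> \<theta> y) = \<theta> x \<otimes> (e' \<otimes> e') \<otimes> \<theta> y"
    using xy by (simp add: A2.A.m_assoc)
  also have "\<dots> = e' \<otimes> (\<theta> x \<otimes> \<theta> y)"
    unfolding e'_idem using xy by (simp add: e'_D2 A2.A.m_assoc)
  finally show "\<psi> (x \<otimes>\<^bsub>sub_alg R1 D1\<^esub> y) = \<psi> x \<otimes> \<psi> y"
    using xy A2.D_closed(5) by (simp add: \<phi>_\<psi>, simp add: \<psi>_def \<phi>_hom \<theta>_hom)
next
  fix c x assume "x \<in> carrier (sub_alg R1 D1)"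
  then show "\<psi> (c \<odot>\<^bsub>sub_alg R1 D1\<^esub> x) = c \<odot> \<psi> x"
    by (simp add: \<psi>_def \<phi>_hom \<theta>_hom A2.smult_mult_right A2.scal_add)
qed simp

lemmas \<psi>_hom = alg_homD[OF \<psi>_alg, simplified]

lemma \<psi>_one: "\<psi> \<one>\<^bsub>R1\<^esub> = \<one>"
  using e_add_e' by (simp add: \<psi>_def \<theta>_one flip: e_def)

lemma \<psi>_graded:
  assumes "g \<in> carrier G" "x \<in> D1" "x \<in> \<Gamma>1 g"
  shows "\<psi> x \<in> \<Gamma>2 g"
proof -
  have "e' \<in> \<Gamma>2 \<one>\<^bsub>G\<^esub>"
    unfolding e'_def e_def
    by (intro A2.hom_add A2.hom_scal A2.one_hom \<phi>_graded A1.one_hom) simp_all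
  then have "e' \<otimes> \<theta> x \<in> \<Gamma>2 (\<one>\<^bsub>G\<^esub> \<otimes>\<^bsub>G\<^esub> g)"
    using assms \<theta>_graded by (intro A2.graded_mult) auto
  then show ?thesis
    unfolding \<psi>_def using assms \<phi>_graded by (intro A2.hom_add) auto
qed

text \<open>Conjugation by \<open>w\<close> is recorded only through its values on the image of
  \<theta> and the degrees it gives to the matrix units; this is all that later arguments use of
  \<open>w\<close>.\<close>

lemma ex_automorphism:
  "\<exists>\<alpha>\<in>alg_iso R2 R2. \<exists>\<gamma>'. (\<forall>d\<in>D1. \<alpha> (\<theta> d) = \<psi> d) \<and> (\<forall>i<p. \<gamma>' i \<in> carrier G) \<and>
    (\<forall>i<p. \<forall>j<p. \<alpha> (h (matrix_unit p i j)) \<in> \<Gamma>2 (inv\<^bsub>G\<^esub> (\<gamma>' i) \<otimes>\<^bsub>G\<^esub> \<gamma>' j))"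
proof -
  interpret D1: ring "sub_alg R1 D1"
    using A1.unital_D by (simp add: unital_subalgebra_def A1.A.subring_is_ring)
  define \<zeta> where "\<zeta> = inv_into D1 \<theta>"
  have \<zeta>: "\<zeta> \<in> alg_iso (sub_alg R2 D2) (sub_alg R1 D1)"
    using alg_iso_inv[OF A1.sub_alg_module[OF A1.unital_D] D1.monoid_axioms \<theta>_iso]
    by (simp add: \<zeta>_def)
  note \<zeta>_hom = alg_homD[OF alg_iso_imp_hom[OF \<zeta>], simplified]
  have \<zeta>\<theta>: "\<zeta> (\<theta> x) = x" if "x \<in> D1" for x
    using \<theta>_bij that by (simp add: \<zeta>_def bij_betw_def)
  have \<theta>\<zeta>: "\<theta> (\<zeta> y) = y" if "y \<in> D2" for y
    using \<theta>_bij that by (simp add: \<zeta>_def bij_betw_def f_inv_into_f)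
  have "(\<lambda>d. \<psi> (\<zeta> d)) \<in> alg_hom (sub_alg R2 D2) R2"
    by (intro alg_homI) (simp_all add: \<zeta>_hom \<psi>_hom)
  moreover have "\<psi> (\<zeta> \<one>) = \<one>"
    using \<zeta>\<theta>[OF A1.D_closed(3)] by (simp add: \<theta>_one \<psi>_one)
  moreover have "\<psi> (\<zeta> (A2.X t)) \<in> \<Gamma>2 t" if t: "t \<in> A2.T" for t
    using t \<zeta>_hom(1) by (intro \<psi>_graded \<theta>_reflects) (auto simp: \<theta>\<zeta>)
  ultimately obtain w \<gamma>' where w: "w \<in> Units R2" and \<gamma>': "\<forall>i<p. \<gamma>' i \<in> carrier G"
    and conj: "\<forall>d\<in>D2. \<psi> (\<zeta> d) \<otimes> w = w \<otimes> d"
    and deg: "\<forall>i<p. \<forall>j<p. w \<otimes> h (matrix_unit p i j) \<otimes> inv w \<in> \<Gamma>2 (inv\<^bsub>G\<^esub> (\<gamma>' i) \<otimes>\<^bsub>G\<^esub> \<gamma>' j)"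
    using A2.graded_Skolem_Noether[of "\<lambda>d. \<psi> (\<zeta> d)"] by blast
  have "w \<otimes> \<theta> d \<otimes> inv w = \<psi> d" if d: "d \<in> D1" for d
  proof -
    have "w \<otimes> \<theta> d = \<psi> d \<otimes> w" using conj d by (simp add: \<zeta>\<theta> flip: bspec[OF conj])
    then show ?thesis using d w A2.A.Units_closed[OF w] by (simp add: A2.A.m_assoc)
  qed
  then show ?thesis
    using A2.conj_iso[OF w] \<gamma>' deg
    by (intro bexI[of _ "\<lambda>x. w \<otimes> x \<otimes> inv w"] exI[of _ \<gamma>']) auto
qed

end

section \<open>The image of the decomposition of \<open>R2\<close> under the automorphism\<close>

context graded_embedding
begin

text \<open>Pulled back along \<alpha>, the condition says that an element commutes with
  \<open>D2\<close>, where \<open>centralizer_D\<close> applies. Gradedness of the new elementary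
  factor and the inclusion of the image of \<open>C1\<close> both rest on this.\<close>

lemma centralizer_image:
  assumes \<alpha>: "\<alpha> \<in> alg_iso R2 R2" and y: "y \<in> carrier R2"
    and comm: "\<And>d. d \<in> D2 \<Longrightarrow> \<alpha> d \<otimes> y = y \<otimes> \<alpha> d"
  shows "y \<in> \<alpha> ` C2"
proof -
  note \<alpha>_hom = alg_homD[OF alg_iso_imp_hom[OF \<alpha>]]
  have bij: "bij_betw \<alpha> (carrier R2) (carrier R2)" by (rule alg_iso_imp_bij[OF \<alpha>])
  obtain x where x: "x \<in> carrier R2" "y = \<alpha> x" using bij y by (auto simp: bij_betw_def)
  have "x \<in> C2"
  proof (rule A2.centralizer_D[OF x(1)])
    fix t assume t: "t \<in> A2.T"
    have "\<alpha> (A2.X t \<otimes> x) = \<alpha> (x \<otimes> A2.X t)"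
      using comm[of "A2.X t"] t x by (simp add: \<alpha>_hom)
    then show "A2.X t \<otimes> x = x \<otimes> A2.X t"
      using bij t x by (auto simp: bij_betw_def dest!: inj_onD)
  qed
  then show ?thesis using x(2) by blast
qed

text \<open>On \<open>D2\<close> the automorphism is \<psi> after the inverse of \<theta>, and both
  respect degrees.\<close>

lemma comp_automorphism:
  assumes \<alpha>: "\<alpha> \<in> alg_iso R2 R2" and \<alpha>\<theta>: "\<And>d. d \<in> D1 \<Longrightarrow> \<alpha> (\<theta> d) = \<psi> d"
    and d: "d \<in> D2" and g: "g \<in> carrier G"
  shows "A2.comp (\<alpha> d) g = \<alpha> (A2.comp d g)"
proof (rule comp_image[OF A2.graded_alg_axioms A2.graded_alg_axioms A2.D_closed(1)])
  note \<alpha>_hom = alg_homD[OF alg_iso_imp_hom[OF \<alpha>]]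
  show "\<alpha> \<zero> = \<zero>"
    using \<alpha>_hom(4)[of \<zero> 0] \<alpha>_hom(1)[of \<zero>] by simp
  show "\<alpha> x \<in> \<Gamma>2 k" if x: "x \<in> D2" "x \<in> \<Gamma>2 k" and k: "k \<in> carrier G" for x k
  proof -
    obtain x' where "x' \<in> D1" "x = \<theta> x'" using \<theta>_bij x by (auto simp: bij_betw_def)
    then show ?thesis using \<psi>_graded[OF k] \<theta>_reflects[OF _ k] x \<alpha>\<theta> by auto
  qed
qed (use assms A2.comp_D alg_homD[OF alg_iso_imp_hom[OF \<alpha>]] in auto)

lemma extended_decomposition:
  assumes "p > 0"
  shows "\<exists>C D.
      graded_matrix_decomposition G R2 \<Gamma>2 C D \<and>
      elementary_grading G (sub_alg R2 C) (sub_grading \<Gamma>2 C) \<and>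
      fine_grading G (sub_alg R2 D) (sub_grading \<Gamma>2 D) \<and>
      graded_iso G (sub_alg R2 D) (sub_grading \<Gamma>2 D)
                   (sub_alg R2 D2) (sub_grading \<Gamma>2 D2) \<noteq> {} \<and>
      \<phi> ` C1 \<subseteq> C \<and>
      ((\<lambda>x. \<phi> \<one>\<^bsub>R1\<^esub> \<otimes> x \<otimes> \<phi> \<one>\<^bsub>R1\<^esub>) ` carrier R2 = \<phi> ` carrier R1 \<longrightarrow>
       (\<lambda>x. \<phi> \<one>\<^bsub>R1\<^esub> \<otimes> x \<otimes> \<phi> \<one>\<^bsub>R1\<^esub>) ` C = \<phi> ` C1) \<and>
      (\<exists>\<psi> \<in> graded_iso G (sub_alg R1 D1) (sub_grading \<Gamma>1 D1)
                          (sub_alg R2 D) (sub_grading \<Gamma>2 D).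
         \<forall>a\<in>carrier R1. \<forall>d\<in>D1. \<phi> a \<otimes> \<phi> d = \<phi> a \<otimes> \<psi> d)"
proof -
  obtain \<alpha> \<gamma>' where \<alpha>: "\<alpha> \<in> alg_iso R2 R2" and \<alpha>\<theta>: "\<And>d. d \<in> D1 \<Longrightarrow> \<alpha> (\<theta> d) = \<psi> d"
    and \<gamma>': "\<And>i. i < p \<Longrightarrow> \<gamma>' i \<in> carrier G"
    and deg: "\<And>i j. i < p \<Longrightarrow> j < p \<Longrightarrow>
      \<alpha> (h (matrix_unit p i j)) \<in> \<Gamma>2 (inv\<^bsub>G\<^esub> (\<gamma>' i) \<otimes>\<^bsub>G\<^esub> \<gamma>' j)"
    using ex_automorphism by blast
  let ?C = "\<alpha> ` C2" and ?D = "\<alpha> ` D2"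
  note \<alpha>_hom = alg_homD[OF alg_iso_imp_hom[OF \<alpha>]]
  have bij: "bij_betw \<alpha> (carrier R2) (carrier R2)" by (rule alg_iso_imp_bij[OF \<alpha>])
  have \<alpha>_eq: "x = y" if "\<alpha> x = \<alpha> y" "x \<in> carrier R2" "y \<in> carrier R2" for x y
    using bij that by (auto simp: bij_betw_def inj_on_def)
  note comp_\<alpha> = comp_automorphism[OF \<alpha> \<alpha>\<theta>]
  have D2_eq: "D2 = \<theta> ` D1" using \<theta>_bij by (simp add: bij_betw_def)
  have uC: "unital_subalgebra R2 ?C" and uD: "unital_subalgebra R2 ?D"
    using A2.unital_subalgebra_image[OF \<alpha>] A2.unital_C A2.unital_D by blast+
  note C_props = A2.unital_subalgebraD[OF uC] and D_props = A2.unital_subalgebraD[OF uD]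
  \<comment> \<open>An element is homogeneous of degree \<open>g\<close> exactly when it equals its
    component there, and \<alpha> is injective and commutes with components on
    \<open>D2\<close>.\<close>
  have \<alpha>_hom_D: "\<alpha> d \<in> \<Gamma>2 g \<longleftrightarrow> d \<in> \<Gamma>2 g" if d: "d \<in> D2" and g: "g \<in> carrier G" for d g
  proof
    assume "\<alpha> d \<in> \<Gamma>2 g"
    then have "\<alpha> (A2.comp d g) = \<alpha> d"
      using comp_\<alpha>[OF _ d g] A2.comp_of_hom[OF _ g g] by auto
    then have "A2.comp d g = d" by (rule \<alpha>_eq) (use d g in auto)
    then show "d \<in> \<Gamma>2 g" using A2.comp_hom[of d g] d g by simp
  next
    assume "d \<in> \<Gamma>2 g"
    then have "A2.comp (\<alpha> d) g = \<alpha> d"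
      using comp_\<alpha>[OF _ d g] A2.comp_of_hom[OF _ g g] by auto
    then show "\<alpha> d \<in> \<Gamma>2 g" using A2.comp_hom[of "\<alpha> d" g] \<alpha>_hom(1) d g by simp
  qed
  have comm: "\<alpha> d \<otimes> y = y \<otimes> \<alpha> d" if "d \<in> D2" "y \<in> ?C" for d y
  proof -
    obtain c where c: "c \<in> C2" "y = \<alpha> c" using \<open>y \<in> ?C\<close> by blast
    have "\<alpha> (d \<otimes> c) = \<alpha> (c \<otimes> d)" by (simp only: A2.commute[OF c(1) that(1)])
    then show ?thesis using c that(1) by (simp add: \<alpha>_hom(3))
  qed
  have grD: "graded_space G (sub_alg R2 ?D) (sub_grading \<Gamma>2 ?D)"
    unfolding A2.graded_space_iff[OF D_props(1)]
    using comp_\<alpha> A2.comp_D by auto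
  \<comment> \<open>Components of an element that commutes with a homogeneous \<open>?Z\<close>
    commute with \<open>?Z\<close> too: compare the components of \<open>?Z \<otimes> x\<close> and
    \<open>x \<otimes> ?Z\<close> in degree \<open>t g\<close>. Linearity extends this to the whole
    new fine factor, and the centralizer criterion gives membership.\<close>
  have grC: "graded_space G (sub_alg R2 ?C) (sub_grading \<Gamma>2 ?C)"
    unfolding A2.graded_space_iff[OF C_props(1)]
  proof (intro ballI)
    fix x g assume x: "x \<in> ?C" and g: "g \<in> carrier G"
    then have xR: "x \<in> carrier R2" using C_props(2) by blast
    show "A2.comp x g \<in> ?C"
    proof (rule centralizer_image[OF \<alpha>])
      show "A2.comp x g \<in> carrier R2" using xR g by simp
      fix d assume "d \<in> D2"
      then show "\<alpha> d \<otimes> A2.comp x g = A2.comp x g \<otimes> \<alpha> d"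
      proof (induct rule: A2.D_induct)
        case (add a b)
        then show ?case using xR g \<alpha>_hom(1)
          by (simp add: \<alpha>_hom(2) A2.A.l_distr A2.A.r_distr)
      next
        case (hom k t)
        let ?Z = "\<alpha> (A2.X t)"
        have Z: "?Z \<in> \<Gamma>2 t" "?Z \<in> carrier R2" using hom \<alpha>_hom_D \<alpha>_hom(1) by auto
        have "A2.comp (?Z \<otimes> x) (t \<otimes>\<^bsub>G\<^esub> g) = ?Z \<otimes> A2.comp x g"
          using Z(1) xR g hom by (intro A2.comp_mult_left) auto
        moreover have "A2.comp (x \<otimes> ?Z) (g \<otimes>\<^bsub>G\<^esub> t) = A2.comp x g \<otimes> ?Z"
          using Z(1) xR g hom by (intro A2.comp_mult_right) auto
        moreover have "?Z \<otimes> x = x \<otimes> ?Z" using comm x hom by simp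
        moreover have "t \<otimes>\<^bsub>G\<^esub> g = g \<otimes>\<^bsub>G\<^esub> t" using hom g by (intro A1.G.m_comm) auto
        ultimately have "?Z \<otimes> A2.comp x g = A2.comp x g \<otimes> ?Z" by simp
        then show ?case
          using hom Z(2) xR g by (simp add: \<alpha>_hom(4) A2.smult_mult_left A2.smult_mult_right)
      qed
    qed
  qed
  have dec: "graded_matrix_decomposition G R2 \<Gamma>2 ?C ?D"
    by (rule A2.decomposition_image[OF \<alpha> A2.dec grC grD])
  have el: "elementary_grading G (sub_alg R2 ?C) (sub_grading \<Gamma>2 ?C)"
    unfolding elementary_grading_def
  proof (intro exI[of _ p] conjI bexI allI impI)
    show "(\<lambda>M. \<alpha> (h M)) \<in> alg_iso (module_mat TYPE('f) p p) (sub_alg R2 ?C)"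
      by (rule alg_iso_comp[OF A2.C.h_iso A2.alg_iso_sub_image[OF \<alpha> A2.unital_C]])
    show "\<gamma>' \<in> {..<p} \<rightarrow> carrier G" using \<gamma>' by simp
    fix i j assume "i < p" "j < p"
    then show "\<alpha> (h (matrix_unit p i j)) \<in> ?C \<inter> \<Gamma>2 (inv\<^bsub>G\<^esub> (\<gamma>' i) \<otimes>\<^bsub>G\<^esub> \<gamma>' j)"
      using deg A2.C.h_hom(1)[of "matrix_unit p i j"] by blast
  qed (rule assms)
  \<comment> \<open>Since \<alpha> matches degrees on \<open>D2\<close>, each nonzero component of
    the image is the line through \<open>\<alpha> (A2.X g)\<close>.\<close>
  have fine: "fine_grading G (sub_alg R2 ?D) (sub_grading \<Gamma>2 ?D)"
    unfolding fine_grading_def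
  proof
    show "\<exists>p. is_matrix_algebra p (sub_alg R2 ?D)"
      using dec by (simp add: graded_matrix_decomposition_def)
    show "\<forall>g\<in>grading_support G (sub_alg R2 ?D) (sub_grading \<Gamma>2 ?D).
      vectorspace.dim class_ring ((sub_alg R2 ?D)\<lparr>carrier := ?D \<inter> \<Gamma>2 g\<rparr>) = 1"
    proof
      fix g assume "g \<in> grading_support G (sub_alg R2 ?D) (sub_grading \<Gamma>2 ?D)"
      then have g: "g \<in> carrier G" and "?D \<inter> \<Gamma>2 g \<noteq> {\<zero>}" by (auto simp: grading_support_def)
      moreover have "\<zero> \<in> ?D \<inter> \<Gamma>2 g" using D_props(4) A2.hom_zero[OF g] by blast
      ultimately obtain d where d: "d \<in> D2" "\<alpha> d \<in> \<Gamma>2 g" "\<alpha> d \<noteq> \<zero>" by blast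
      have \<alpha>0: "\<alpha> \<zero> = \<zero>" using \<alpha>_hom(4)[of \<zero> 0] \<alpha>_hom(1)[of \<zero>] by simp
      then have "d \<in> \<Gamma>2 g" "d \<noteq> \<zero>" using d \<alpha>_hom_D[OF d(1) g] by auto
      then have t: "g \<in> A2.T" using d(1) g by (intro A2.T_memI)
      interpret V: vectorspace class_ring "sub_alg R2 (?D \<inter> \<Gamma>2 g)"
        by (intro A2.subspace_is_vs A2.subspace_inter D_props(1) A2.subspace_hom g)
      have "V.dim = 1"
      proof (rule V.dim_line)
        show "\<alpha> (A2.X g) \<in> carrier (sub_alg R2 (?D \<inter> \<Gamma>2 g))"
          using t g \<alpha>_hom_D by auto
        show "\<alpha> (A2.X g) \<noteq> \<zero>\<^bsub>sub_alg R2 (?D \<inter> \<Gamma>2 g)\<^esub>"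
          using \<alpha>_eq[of "A2.X g" \<zero>] \<alpha>0 t A2.X_nonzero[OF t] by auto
        fix y assume "y \<in> carrier (sub_alg R2 (?D \<inter> \<Gamma>2 g))"
        then obtain d' where d': "d' \<in> D2" "y = \<alpha> d'" "d' \<in> \<Gamma>2 g" using \<alpha>_hom_D g by auto
        then obtain c where "d' = c \<odot> A2.X g" using A2.X_line[OF t] by blast
        then show "\<exists>c\<in>carrier class_ring. y = c \<odot>\<^bsub>sub_alg R2 (?D \<inter> \<Gamma>2 g)\<^esub> \<alpha> (A2.X g)"
          using d' t by (auto simp: \<alpha>_hom(4))
      qed
      then show "vectorspace.dim class_ring ((sub_alg R2 ?D)\<lparr>carrier := ?D \<inter> \<Gamma>2 g\<rparr>) = 1" by simp
    qed
  qed
  have \<alpha>_D: "\<alpha> \<in> alg_iso (sub_alg R2 D2) (sub_alg R2 ?D)"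
    by (rule A2.alg_iso_sub_image[OF \<alpha> A2.unital_D])
  have iso: "inv_into D2 \<alpha> \<in> graded_iso G (sub_alg R2 ?D) (sub_grading \<Gamma>2 ?D)
      (sub_alg R2 D2) (sub_grading \<Gamma>2 D2)"
  proof -
    interpret D2: ring "sub_alg R2 D2"
      using A2.unital_D by (simp add: unital_subalgebra_def A2.A.subring_is_ring)
    have "inv_into D2 \<alpha> \<in> alg_iso (sub_alg R2 ?D) (sub_alg R2 D2)"
      using alg_iso_inv[OF A2.sub_alg_module[OF A2.unital_D] D2.monoid_axioms \<alpha>_D] by simp
    moreover have "inv_into D2 \<alpha> (\<alpha> d) = d" if "d \<in> D2" for d
      using alg_iso_imp_bij[OF \<alpha>_D] that by (simp add: bij_betw_def)
    ultimately show ?thesis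
      using \<alpha>_hom_D by (auto simp: graded_iso_def graded_hom_def alg_iso_imp_hom)
  qed
  have \<psi>_iso: "(\<lambda>d. \<alpha> (\<theta> d)) \<in> graded_iso G (sub_alg R1 D1) (sub_grading \<Gamma>1 D1)
      (sub_alg R2 ?D) (sub_grading \<Gamma>2 ?D)"
    using alg_iso_comp[OF \<theta>_iso \<alpha>_D] \<psi>_graded
    by (auto simp: graded_iso_def graded_hom_def alg_iso_imp_hom \<alpha>\<theta> simp flip: \<alpha>\<theta>)
  \<comment> \<open>Next to elements of the image of \<phi> the maps \<psi> and \<phi> agree, so
    commutation of \<open>c\<close> with \<open>D1\<close> becomes commutation of
    \<open>\<phi> c\<close> with the new fine factor.\<close>
  have \<phi>C: "\<phi> c \<in> ?C" if c: "c \<in> C1" for c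
  proof (rule centralizer_image[OF \<alpha>])
    fix d assume "d \<in> D2"
    then obtain d' where d': "d' \<in> D1" "d = \<theta> d'" using D2_eq by blast
    have "d' \<otimes>\<^bsub>R1\<^esub> c = c \<otimes>\<^bsub>R1\<^esub> d'" using A1.commute c d' by blast
    then show "\<alpha> d \<otimes> \<phi> c = \<phi> c \<otimes> \<alpha> d"
      using c d' by (simp add: \<alpha>\<theta> \<phi>_\<psi> \<psi>_\<phi> flip: \<phi>_hom(3))
  qed (use c in simp)
  have corner: "(\<lambda>x. e \<otimes> x \<otimes> e) ` ?C = \<phi> ` C1"
    if full: "(\<lambda>x. e \<otimes> x \<otimes> e) ` carrier R2 = \<phi> ` carrier R1"
  proof
    show "\<phi> ` C1 \<subseteq> (\<lambda>x. e \<otimes> x \<otimes> e) ` ?C"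
    proof
      fix y assume "y \<in> \<phi> ` C1"
      then obtain c where c: "c \<in> C1" "y = \<phi> c" by blast
      then have "y = e \<otimes> \<phi> c \<otimes> e" by simp
      then show "y \<in> (\<lambda>x. e \<otimes> x \<otimes> e) ` ?C" using \<phi>C[OF c(1)] by blast
    qed
    show "(\<lambda>x. e \<otimes> x \<otimes> e) ` ?C \<subseteq> \<phi> ` C1"
    proof
      fix y assume "y \<in> (\<lambda>x. e \<otimes> x \<otimes> e) ` ?C"
      then obtain x where x: "x \<in> ?C" "y = e \<otimes> x \<otimes> e" by blast
      \<comment> \<open>\<open>e\<close> is the image of the identity, which lies in
        \<open>C1\<close>; hence the corner of the new factor stays inside that factor.\<close>
      have "e \<in> ?C" unfolding e_def by (rule \<phi>C[OF A1.C_closed(3)])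
      then have yC: "y \<in> ?C" unfolding x(2) using x(1) C_props(5) by blast
      have "y \<in> \<phi> ` carrier R1"
        unfolding full[symmetric] x(2) using x(1) C_props(2) by blast
      then obtain r where r: "r \<in> carrier R1" "y = \<phi> r" by blast
      \<comment> \<open>\<open>y\<close> commutes with the new fine factor. Since \<open>y\<close>
        is the image of \<open>r\<close>, \<psi> may be replaced by \<phi> in this relation, and
        injectivity brings it back to \<open>R1\<close>, where the centralizer criterion
        applies.\<close>
      have "r \<in> C1"
      proof (rule A1.centralizer_D[OF r(1)])
        fix t assume t: "t \<in> A1.T"
        let ?d = "A1.X t"
        have "\<alpha> (\<theta> ?d) \<otimes> y = y \<otimes> \<alpha> (\<theta> ?d)" using comm yC t by simp
        then have "\<phi> (?d \<otimes>\<^bsub>R1\<^esub> r) = \<phi> (r \<otimes>\<^bsub>R1\<^esub> ?d)"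
          using r t by (simp add: \<alpha>\<theta> \<phi>_\<psi> \<psi>_\<phi> \<phi>_hom(3))
        then show "?d \<otimes>\<^bsub>R1\<^esub> r = r \<otimes>\<^bsub>R1\<^esub> ?d"
          using \<phi>_inj r t by (auto dest!: inj_onD)
      qed
      then show "y \<in> \<phi> ` C1" using r by blast
    qed
  qed
  show ?thesis
  proof (rule exI[of _ ?C], rule exI[of _ ?D], intro conjI impI)
    show "\<exists>\<psi>\<in>graded_iso G (sub_alg R1 D1) (sub_grading \<Gamma>1 D1) (sub_alg R2 ?D) (sub_grading \<Gamma>2 ?D).
      \<forall>a\<in>carrier R1. \<forall>d\<in>D1. \<phi> a \<otimes> \<phi> d = \<phi> a \<otimes> \<psi> d"
      using \<psi>_iso by (intro bexI[of _ "\<lambda>d. \<alpha> (\<theta> d)"]) (simp_all add: \<alpha>\<theta> \<phi>_\<psi>)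
  qed (use dec el fine iso \<phi>C corner in \<open>auto simp: e_def\<close>)
qed

end

theorem theorem3:
  fixes G :: "'g monoid"
    and R1 :: "('f :: {alg_closed_field, field_char_0}, 'a) module"
    and R2 :: "('f, 'b) module"
    and \<Gamma>1 :: "'g \<Rightarrow> 'a set" and \<Gamma>2 :: "'g \<Rightarrow> 'b set"
    and k n :: nat
    and C1 D1 :: "'a set" and C2 D2 :: "'b set"
    and \<phi> :: "'a \<Rightarrow> 'b"
  assumes "comm_group G" and "finite (carrier G)"
    and "graded_algebra G R1 \<Gamma>1" and "is_matrix_algebra k R1"
    and "graded_algebra G R2 \<Gamma>2" and "is_matrix_algebra n R2"
    and "graded_matrix_decomposition G R1 \<Gamma>1 C1 D1"
    and "elementary_grading G (sub_alg R1 C1) (sub_grading \<Gamma>1 C1)"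
    and "fine_grading G (sub_alg R1 D1) (sub_grading \<Gamma>1 D1)"
    and "grading_support G (sub_alg R1 C1) (sub_grading \<Gamma>1 C1) \<inter>
         grading_support G (sub_alg R1 D1) (sub_grading \<Gamma>1 D1) = {\<one>\<^bsub>G\<^esub>}"
    and "graded_matrix_decomposition G R2 \<Gamma>2 C2 D2"
    and "elementary_grading G (sub_alg R2 C2) (sub_grading \<Gamma>2 C2)"
    and "fine_grading G (sub_alg R2 D2) (sub_grading \<Gamma>2 D2)"
    and "grading_support G (sub_alg R2 C2) (sub_grading \<Gamma>2 C2) \<inter>
         grading_support G (sub_alg R2 D2) (sub_grading \<Gamma>2 D2) = {\<one>\<^bsub>G\<^esub>}"
    and "graded_iso G (sub_alg R1 D1) (sub_grading \<Gamma>1 D1)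
                      (sub_alg R2 D2) (sub_grading \<Gamma>2 D2) \<noteq> {}"
    and "\<phi> \<in> graded_hom G R1 \<Gamma>1 R2 \<Gamma>2" and "inj_on \<phi> (carrier R1)"
  shows "\<exists>C D.
      graded_matrix_decomposition G R2 \<Gamma>2 C D \<and>
      elementary_grading G (sub_alg R2 C) (sub_grading \<Gamma>2 C) \<and>
      fine_grading G (sub_alg R2 D) (sub_grading \<Gamma>2 D) \<and>
      graded_iso G (sub_alg R2 D) (sub_grading \<Gamma>2 D)
                   (sub_alg R2 D2) (sub_grading \<Gamma>2 D2) \<noteq> {} \<and>
      \<phi> ` C1 \<subseteq> C \<and>
      ((\<lambda>x. \<phi> \<one>\<^bsub>R1\<^esub> \<otimes>\<^bsub>R2\<^esub> x \<otimes>\<^bsub>R2\<^esub> \<phi> \<one>\<^bsub>R1\<^esub>) ` carrier R2 = \<phi> ` carrier R1 \<longrightarrow>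
       (\<lambda>x. \<phi> \<one>\<^bsub>R1\<^esub> \<otimes>\<^bsub>R2\<^esub> x \<otimes>\<^bsub>R2\<^esub> \<phi> \<one>\<^bsub>R1\<^esub>) ` C = \<phi> ` C1) \<and>
      (\<exists>\<psi> \<in> graded_iso G (sub_alg R1 D1) (sub_grading \<Gamma>1 D1)
                          (sub_alg R2 D) (sub_grading \<Gamma>2 D).
         \<forall>a\<in>carrier R1. \<forall>d\<in>D1. \<phi> a \<otimes>\<^bsub>R2\<^esub> \<phi> d = \<phi> a \<otimes>\<^bsub>R2\<^esub> \<psi> d)"
proof -
  interpret A1: graded_alg R1 G \<Gamma>1
    by (rule graded_algI) (use assms in auto)
  interpret A2: graded_alg R2 G \<Gamma>2
    by (rule graded_algI) (use assms in auto)
  interpret A1: fine_subalgebra R1 G \<Gamma>1 D1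
    by unfold_locales (use assms in \<open>auto simp: graded_matrix_decomposition_def\<close>)
  interpret A2: fine_subalgebra R2 G \<Gamma>2 D2
    by unfold_locales (use assms in \<open>auto simp: graded_matrix_decomposition_def\<close>)
  interpret A1: graded_decomposition R1 G \<Gamma>1 D1 C1
    by unfold_locales (use assms in \<open>simp_all add: A1.T_def\<close>)
  interpret A2: graded_decomposition R2 G \<Gamma>2 D2 C2
    by unfold_locales (use assms in \<open>simp_all add: A2.T_def\<close>)
  obtain p h \<gamma> where p: "p > 0" and h: "h \<in> alg_iso (module_mat TYPE('f) p p) (sub_alg R2 C2)"
    and \<gamma>: "\<gamma> \<in> {..<p} \<rightarrow> carrier G"
    and deg: "\<forall>i<p. \<forall>j<p. h (matrix_unit p i j) \<in> C2 \<inter> \<Gamma>2 (inv\<^bsub>G\<^esub> (\<gamma> i) \<otimes>\<^bsub>G\<^esub> \<gamma> j)"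
    using assms(12) unfolding elementary_grading_def by blast
  interpret A2: elementary_decomposition R2 G \<Gamma>2 D2 C2 p h \<gamma>
    by unfold_locales (use A2.unital_C h \<gamma> deg in auto)
  obtain \<theta> where \<theta>: "\<theta> \<in> graded_iso G (sub_alg R1 D1) (sub_grading \<Gamma>1 D1)
      (sub_alg R2 D2) (sub_grading \<Gamma>2 D2)"
    using assms(15) by blast
  interpret graded_embedding R1 R2 G \<Gamma>1 D1 C1 \<Gamma>2 D2 C2 p h \<gamma> \<phi> \<theta>
    by unfold_locales (use assms(16,17) \<theta> in auto)
  show ?thesis by (rule extended_decomposition[OF p])
qed

end
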